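(* Let $M$ be a smooth manifold, let $A\subset TM\setminus\mathbf 0$ be an open conic subset with $\pi(A)=M$, let $\nabla$ be an $A$-anisotropic connection, let $T\in\mathcal T^r_s(M_A)$ be an $A$-anisotropic tensor, and let $\gamma:[a,b]\to M$ be a regular smooth curve. Then, for any $v\in T_{\gamma(a)}M\cap A$, $$(\nabla_{\dot\gamma(a)}T)_v=\frac{d}{dt}P_t(T)_v\Big|_{t=a},$$ where $t\mapsto P_t(T)_v$ is the curve of $(r,s)$-tensors on the vector space $T_{\gamma(a)}M$ obtained by parallel transport of $T$ along $\gamma$ back to $\gamma(a)$.
   Context: All objects are smooth; repeated indices are summed. $\pi:TM\to M$ is the projection, $\pi_A=\pi|_A$; conic means invariant under $v\mapsto\lambda v$, $\lambda>0$. $(x,y)$ are the natural coordinates on $TU$ induced by a chart $(U,x)$; $\partial_k=\partial_{x^k}$, $\dot\partial_k=\partial_{y^k}$. **Anisotropic tensors.** $\mathcal T^r_s(M_A)$ is the space of sections over $A$ of $\pi_A^*(\bigotimes^rTM\otimes\bigotimes^sT^*M)$; so for $v\in A$, $T_v$ is an $(r,s)$-tensor on $T_{\pi(v)}M$, with components $T^{a_1\dots a_r}_{b_1\dots b_s}(x,y)$. **Anisotropic connection.** An $A$-anisotropic connection is a map $\nabla:\mathfrak X(M)\times\mathfrak X(M)\to\mathcal T^1_0(M_A)$ that is additive in both entries, with $\nabla_X(fY)=(X(f)Y)\circ\pi_A+(f\circ\pi_A)\nabla_XY$ and $\nabla_{fX+hY}Z=(f\circ\pi_A)\nabla_XZ+(h\circ\pi_A)\nabla_YZ$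 for $f,h\in\mathcal F(M)$. Its Christoffel symbols are the functions on $A\cap TU$ with $(\nabla_{\partial_i}\partial_j)_v=\Gamma^a_{ij}(v)\,\partial_a|_{\pi(v)}$. **Covariant derivative of anisotropic tensors.** $\nabla$ extends to a derivation $\nabla_X:\mathcal T^r_s(M_A)\to\mathcal T^r_s(M_A)$, $X\in\mathfrak X(M)$, satisfying the Leibniz rule for tensor products, commuting with contractions, and with $\nabla_Xh=X^i(\partial_ih-\Gamma_{ij}^ky^j\dot\partial_kh)$ for $h\in\mathcal F(A)$. In coordinates, with all components evaluated at $(x,y)$, $$(\nabla_{\partial_k}T)^{a_1\dots a_r}_{b_1\dots b_s}=\partial_kT^{a_1\dots a_r}_{b_1\dots b_s}-\Gamma^i_{kj}y^j\dot\partial_iT^{a_1\dots a_r}_{b_1\dots b_s}+\sum_{l=1}^r\Gamma^{a_l}_{kj_l}T^{a_1\dots j_l\dots a_r}_{b_1\dots b_s}-\sum_{l=1}^s\Gamma^{i_l}_{kb_l}T^{a_1\dots a_r}_{b_1\dots i_l\dots b_s}.$$ Since $(\nabla_XT)_v$ depends on $X$ only through $X_{\pi(v)}$, $(\nabla_uT)_v$ makes sense for $u\in T_{\pi(v)}M$. **Covariant derivative along curves and parallel transport.** For a vector field $W$ along $\gamma$ with values in $A$ and a vector field $X$ along $\gamma$, $D^W_\gamma X=(\dot X^i+\Gamma^i_{jk}(W)\dot\gamma^jX^k)\partial_i$. For $v\in A\cap T_{\gamma(a)}M$, let $V$ be the $A$-valued vector field along $\gamma$ with $V(a)=v$ and $D_\gamma^VV=0$;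 by ODE theory it exists uniquely on $[a,a+\varepsilon]$ for some $\varepsilon>0$, which suffices for the derivative at $t=a$. For $t$ in this interval put $P_{a,t}(v)=V(t)$ and let $P^v_{a,t}:T_{\gamma(a)}M\to T_{\gamma(t)}M$ be the linear isomorphism $P^v_{a,t}(w)=W(t)$, where $D_\gamma^VW=0$, $W(a)=w$. On covectors, $P^v_{a,t}(\theta)=\theta\circ(P^v_{a,t})^{-1}$ for $\theta\in T^*_{\gamma(a)}M$. Then $P_t(T)_v$ is the $(r,s)$-tensor on $T_{\gamma(a)}M$ $$P_t(T)_v(\theta^1,\dots,\theta^r,v_1,\dots,v_s)=T_{P_{a,t}(v)}\big(P^v_{a,t}(\theta^1),\dots,P^v_{a,t}(\theta^r),P^v_{a,t}(v_1),\dots,P^v_{a,t}(v_s)\big).$$ A curve is regular if $\dot\gamma$ never vanishes. *)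

theory Defs
  imports "HOL-Analysis.Analysis"
begin

section \<open>Smooth maps between Euclidean spaces\<close>

text \<open>On an open set U, \<open>Ck_on k U f\<close> says that f is k times differentiable and that all its
  iterated directional derivatives up to order k are continuous. Since the domain is
  finite-dimensional, this is the class \<open>C^k\<close>.\<close>

primrec Ck_on :: "nat \<Rightarrow> 'a::euclidean_space set \<Rightarrow> ('a \<Rightarrow> 'b::real_normed_vector) \<Rightarrow> bool" where
  "Ck_on 0 U f \<longleftrightarrow> continuous_on U f"
| "Ck_on (Suc k) U f \<longleftrightarrow>
     (\<forall>x\<in>U. f differentiable (at x)) \<and> (\<forall>w. Ck_on k U (\<lambda>x. frechet_derivative f (at x) w))"

text \<open>On an arbitrary set, smoothness means local extendability to smooth maps on open sets;
  on open sets this is ordinary smoothness. Closed intervals are the other case used below.\<close>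

definition smooth_on :: "'a::euclidean_space set \<Rightarrow> ('a \<Rightarrow> 'b::real_normed_vector) \<Rightarrow> bool" where
  "smooth_on S f \<longleftrightarrow>
     (\<forall>x\<in>S. \<exists>U g. open U \<and> x \<in> U \<and> (\<forall>k. Ck_on k U g) \<and> (\<forall>y\<in>S \<inter> U. g y = f y))"

section \<open>Smooth manifolds\<close>

text \<open>The underlying set of the manifold is the whole type \<open>'m\<close>; its dimension is \<open>CARD('n)\<close>.
  A chart is a pair of a domain and a map, whose values outside the domain are irrelevant.
  The atlas is not required to be maximal.\<close>

type_synonym ('m, 'n) chart = "'m set \<times> ('m \<Rightarrow> real ^ 'n)"

abbreviation cdom :: "('m, 'n) chart \<Rightarrow> 'm set" where
  "cdom c \<equiv> fst c"

abbreviation cmap :: "('m, 'n) chart \<Rightarrow> 'm \<Rightarrow> real ^ 'n" where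
  "cmap c \<equiv> snd c"

definition cinv :: "('m, 'n) chart \<Rightarrow> real ^ 'n \<Rightarrow> 'm" where
  "cinv c = inv_into (cdom c) (cmap c)"

definition is_chart :: "('m::topological_space, 'n::finite) chart \<Rightarrow> bool" where
  "is_chart c \<longleftrightarrow> open (cdom c) \<and> open (cmap c ` cdom c) \<and>
     homeomorphism (cdom c) (cmap c ` cdom c) (cmap c) (cinv c)"

definition smooth_manifold ::
  "('m::{t2_space, second_countable_topology}, 'n::finite) chart set \<Rightarrow> bool" where
  "smooth_manifold \<Phi> \<longleftrightarrow>
     (\<forall>c\<in>\<Phi>. is_chart c) \<and> (\<Union>c\<in>\<Phi>. cdom c) = UNIV \<and>
     (\<forall>c\<in>\<Phi>. \<forall>d\<in>\<Phi>. smooth_on (cmap c ` (cdom c \<inter> cdom d)) (cmap d \<circ> cinv c))"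

definition charts_at :: "('m, 'n) chart set \<Rightarrow> 'm \<Rightarrow> ('m, 'n) chart set" where
  "charts_at \<Phi> p = {c \<in> \<Phi>. p \<in> cdom c}"

section \<open>Tangent and cotangent spaces\<close>

text \<open>A tangent vector at p is the pair of p and a family of component vectors, one for each chart
  around p, which transforms under a change of charts by the Jacobian of the transition map.
  Components with respect to all other charts are set to 0, so that equality of tangent vectors is
  equality in HOL.\<close>

type_synonym ('m, 'n) tvec = "'m \<times> (('m, 'n) chart \<Rightarrow> real ^ 'n)"

abbreviation base :: "('m, 'n) tvec \<Rightarrow> 'm" where
  "base v \<equiv> fst v"

abbreviation comps :: "('m, 'n) tvec \<Rightarrow> ('m, 'n) chart \<Rightarrow> real ^ 'n" where
  "comps v \<equiv> snd v"

definition tangent_space :: "('m, 'n::finite) chart set \<Rightarrow> 'm \<Rightarrow> ('m, 'n) tvec set" where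
  "tangent_space \<Phi> p =
     {v. base v = p \<and> (\<forall>c. c \<notin> charts_at \<Phi> p \<longrightarrow> comps v c = 0) \<and>
        (\<forall>c\<in>charts_at \<Phi> p. \<forall>d\<in>charts_at \<Phi> p.
           comps v d = frechet_derivative (cmap d \<circ> cinv c) (at (cmap c p)) (comps v c))}"

definition tadd :: "('m, 'n::finite) tvec \<Rightarrow> ('m, 'n) tvec \<Rightarrow> ('m, 'n) tvec" where
  "tadd v w = (base v, \<lambda>c. comps v c + comps w c)"

definition tscale :: "real \<Rightarrow> ('m, 'n::finite) tvec \<Rightarrow> ('m, 'n) tvec" where
  "tscale a v = (base v, \<lambda>c. a *\<^sub>R comps v c)"

definition tzero :: "'m \<Rightarrow> ('m, 'n::finite) tvec" where
  "tzero p = (p, \<lambda>c. 0)"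

text \<open>The natural coordinates (x, y) on the tangent bundle over a chart domain, and their inverse.\<close>

definition tcoords :: "('m, 'n) chart \<Rightarrow> ('m, 'n) tvec \<Rightarrow> (real ^ 'n) \<times> (real ^ 'n)" where
  "tcoords c v = (cmap c (base v), comps v c)"

definition of_tcoords ::
  "('m, 'n::finite) chart set \<Rightarrow> ('m, 'n) chart \<Rightarrow> (real ^ 'n) \<times> (real ^ 'n) \<Rightarrow> ('m, 'n) tvec" where
  "of_tcoords \<Phi> c z =
     (cinv c (fst z),
      \<lambda>d. if d \<in> charts_at \<Phi> (cinv c (fst z))
          then frechet_derivative (cmap d \<circ> cinv c) (at (fst z)) (snd z) else 0)"

definition coord_vec ::
  "('m, 'n::finite) chart set \<Rightarrow> ('m, 'n) chart \<Rightarrow> 'm \<Rightarrow> 'n \<Rightarrow> ('m, 'n) tvec" where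
  "coord_vec \<Phi> c p i = of_tcoords \<Phi> c (cmap c p, axis i 1)"

text \<open>Covectors at p are linear functionals on the tangent space at p, extended by 0.\<close>

type_synonym ('m, 'n) covec = "('m, 'n) tvec \<Rightarrow> real"

definition cotangent_space :: "('m, 'n::finite) chart set \<Rightarrow> 'm \<Rightarrow> ('m, 'n) covec set" where
  "cotangent_space \<Phi> p =
     {\<theta>. (\<forall>v\<in>tangent_space \<Phi> p. \<forall>w\<in>tangent_space \<Phi> p. \<forall>a b.
            \<theta> (tadd (tscale a v) (tscale b w)) = a * \<theta> v + b * \<theta> w) \<and>
        (\<forall>v. v \<notin> tangent_space \<Phi> p \<longrightarrow> \<theta> v = 0)}"

definition coord_covec ::
  "('m, 'n::finite) chart set \<Rightarrow> ('m, 'n) chart \<Rightarrow> 'm \<Rightarrow> 'n \<Rightarrow> ('m, 'n) covec" where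
  "coord_covec \<Phi> c p i = (\<lambda>v. if v \<in> tangent_space \<Phi> p then comps v c $ i else 0)"

section \<open>Functions, vector fields and curves\<close>

definition smooth_fun :: "('m, 'n::finite) chart set \<Rightarrow> ('m \<Rightarrow> real) \<Rightarrow> bool" where
  "smooth_fun \<Phi> f \<longleftrightarrow> (\<forall>c\<in>\<Phi>. smooth_on (cmap c ` cdom c) (f \<circ> cinv c))"

definition vector_fields :: "('m, 'n::finite) chart set \<Rightarrow> ('m \<Rightarrow> ('m, 'n) tvec) set" where
  "vector_fields \<Phi> =
     {X. (\<forall>p. X p \<in> tangent_space \<Phi> p) \<and>
         (\<forall>c\<in>\<Phi>. smooth_on (cmap c ` cdom c) (\<lambda>x. comps (X (cinv c x)) c))}"

text \<open>The derivative of f in direction of the tangent vector u. By the chain rule it does not depend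
  on the chart, so an arbitrary one is picked.\<close>

definition dir_deriv :: "('m, 'n::finite) chart set \<Rightarrow> ('m, 'n) tvec \<Rightarrow> ('m \<Rightarrow> real) \<Rightarrow> real" where
  "dir_deriv \<Phi> u f =
     (let c = (SOME c. c \<in> charts_at \<Phi> (base u))
      in frechet_derivative (f \<circ> cinv c) (at (cmap c (base u))) (comps u c))"

definition smooth_curve ::
  "('m::topological_space, 'n::finite) chart set \<Rightarrow> real set \<Rightarrow> (real \<Rightarrow> 'm) \<Rightarrow> bool" where
  "smooth_curve \<Phi> I \<gamma> \<longleftrightarrow>
     continuous_on I \<gamma> \<and> (\<forall>c\<in>\<Phi>. smooth_on {t \<in> I. \<gamma> t \<in> cdom c} (cmap c \<circ> \<gamma>))"

definition velocity ::
  "('m, 'n::finite) chart set \<Rightarrow> real set \<Rightarrow> (real \<Rightarrow> 'm) \<Rightarrow> real \<Rightarrow> ('m, 'n) tvec" where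
  "velocity \<Phi> I \<gamma> t =
     (\<gamma> t, \<lambda>c. if c \<in> charts_at \<Phi> (\<gamma> t) then vector_derivative (cmap c \<circ> \<gamma>) (at t within I) else 0)"

definition regular_curve ::
  "('m, 'n::finite) chart set \<Rightarrow> real set \<Rightarrow> (real \<Rightarrow> 'm) \<Rightarrow> bool" where
  "regular_curve \<Phi> I \<gamma> \<longleftrightarrow> (\<forall>t\<in>I. velocity \<Phi> I \<gamma> t \<noteq> tzero (\<gamma> t))"

section \<open>Conic domains and anisotropic tensors\<close>

definition over :: "('m, 'n) tvec set \<Rightarrow> ('m, 'n) chart \<Rightarrow> ('m, 'n) tvec set" where
  "over A c = {v \<in> A. base v \<in> cdom c}"

text \<open>Openness refers to the topology of the tangent bundle, for which the natural coordinates are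
  homeomorphisms onto open sets.\<close>

definition conic_domain :: "('m, 'n::finite) chart set \<Rightarrow> ('m, 'n) tvec set \<Rightarrow> bool" where
  "conic_domain \<Phi> A \<longleftrightarrow>
     (\<forall>v\<in>A. v \<in> tangent_space \<Phi> (base v) \<and> v \<noteq> tzero (base v)) \<and>
     (\<forall>c\<in>\<Phi>. open (tcoords c ` over A c)) \<and>
     (\<forall>v\<in>A. \<forall>r>0. tscale r v \<in> A) \<and>
     base ` A = UNIV"

text \<open>Tensors take the lists of their covector and of their vector arguments, and vanish on
  all lists that are not admissible arguments.\<close>

type_synonym ('m, 'n) tensor = "('m, 'n) covec list \<Rightarrow> ('m, 'n) tvec list \<Rightarrow> real"

definition tensor_args ::
  "nat \<Rightarrow> nat \<Rightarrow> ('m, 'n::finite) chart set \<Rightarrow> 'm \<Rightarrow> (('m, 'n) covec list \<times> ('m, 'n) tvec list) set" where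
  "tensor_args r s \<Phi> p =
     {(\<theta>s, vs). length \<theta>s = r \<and> set \<theta>s \<subseteq> cotangent_space \<Phi> p \<and>
                length vs = s \<and> set vs \<subseteq> tangent_space \<Phi> p}"

definition tensors ::
  "nat \<Rightarrow> nat \<Rightarrow> ('m, 'n::finite) chart set \<Rightarrow> 'm \<Rightarrow> ('m, 'n) tensor set" where
  "tensors r s \<Phi> p =
     {S. (\<forall>(\<theta>s, vs)\<in>tensor_args r s \<Phi> p.
           (\<forall>l<r. \<forall>\<alpha>\<in>cotangent_space \<Phi> p. \<forall>\<beta>\<in>cotangent_space \<Phi> p. \<forall>a b.
              S (\<theta>s[l := \<lambda>u. a * \<alpha> u + b * \<beta> u]) vs = a * S (\<theta>s[l := \<alpha>]) vs + b * S (\<theta>s[l := \<beta>]) vs) \<and>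
           (\<forall>l<s. \<forall>u\<in>tangent_space \<Phi> p. \<forall>w\<in>tangent_space \<Phi> p. \<forall>a b.
              S \<theta>s (vs[l := tadd (tscale a u) (tscale b w)]) = a * S \<theta>s (vs[l := u]) + b * S \<theta>s (vs[l := w]))) \<and>
         (\<forall>\<theta>s vs. (\<theta>s, vs) \<notin> tensor_args r s \<Phi> p \<longrightarrow> S \<theta>s vs = 0)}"

text \<open>The component of the tensor S at p with upper indices \<open>as\<close> and lower indices \<open>bs\<close>.\<close>

definition tensor_comp ::
  "('m, 'n::finite) chart set \<Rightarrow> ('m, 'n) chart \<Rightarrow> 'm \<Rightarrow> ('m, 'n) tensor \<Rightarrow> 'n list \<Rightarrow> 'n list \<Rightarrow> real" where
  "tensor_comp \<Phi> c p S as bs = S (map (coord_covec \<Phi> c p) as) (map (coord_vec \<Phi> c p) bs)"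

definition aniso_tensors ::
  "nat \<Rightarrow> nat \<Rightarrow> ('m, 'n::finite) chart set \<Rightarrow> ('m, 'n) tvec set \<Rightarrow> (('m, 'n) tvec \<Rightarrow> ('m, 'n) tensor) set" where
  "aniso_tensors r s \<Phi> A =
     {T. (\<forall>v\<in>A. T v \<in> tensors r s \<Phi> (base v)) \<and>
         (\<forall>c\<in>\<Phi>. \<forall>as bs. length as = r \<longrightarrow> length bs = s \<longrightarrow>
            smooth_on (tcoords c ` over A c)
              (\<lambda>z. tensor_comp \<Phi> c (cinv c (fst z)) (T (of_tcoords \<Phi> c z)) as bs))}"

text \<open>Type (1,0) is represented directly by sections over A of the pulled back tangent bundle.\<close>

definition aniso_vector_fields ::
  "('m, 'n::finite) chart set \<Rightarrow> ('m, 'n) tvec set \<Rightarrow> (('m, 'n) tvec \<Rightarrow> ('m, 'n) tvec) set" where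
  "aniso_vector_fields \<Phi> A =
     {Y. (\<forall>v\<in>A. Y v \<in> tangent_space \<Phi> (base v)) \<and>
         (\<forall>c\<in>\<Phi>. smooth_on (tcoords c ` over A c) (\<lambda>z. comps (Y (of_tcoords \<Phi> c z)) c))}"

section \<open>Anisotropic connections\<close>

type_synonym ('m, 'n) conn =
  "('m \<Rightarrow> ('m, 'n) tvec) \<Rightarrow> ('m \<Rightarrow> ('m, 'n) tvec) \<Rightarrow> ('m, 'n) tvec \<Rightarrow> ('m, 'n) tvec"

definition aniso_connection ::
  "('m, 'n::finite) chart set \<Rightarrow> ('m, 'n) tvec set \<Rightarrow> ('m, 'n) conn \<Rightarrow> bool" where
  "aniso_connection \<Phi> A nabla \<longleftrightarrow>
     (\<forall>X\<in>vector_fields \<Phi>. \<forall>Y\<in>vector_fields \<Phi>. nabla X Y \<in> aniso_vector_fields \<Phi> A) \<and>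
     (\<forall>X\<in>vector_fields \<Phi>. \<forall>Y\<in>vector_fields \<Phi>. \<forall>Z\<in>vector_fields \<Phi>. \<forall>v\<in>A.
        nabla X (\<lambda>p. tadd (Y p) (Z p)) v = tadd (nabla X Y v) (nabla X Z v)) \<and>
     (\<forall>X\<in>vector_fields \<Phi>. \<forall>Y\<in>vector_fields \<Phi>. \<forall>Z\<in>vector_fields \<Phi>. \<forall>v\<in>A.
        nabla (\<lambda>p. tadd (X p) (Y p)) Z v = tadd (nabla X Z v) (nabla Y Z v)) \<and>
     (\<forall>X\<in>vector_fields \<Phi>. \<forall>Y\<in>vector_fields \<Phi>. \<forall>f. smooth_fun \<Phi> f \<longrightarrow> (\<forall>v\<in>A.
        nabla X (\<lambda>p. tscale (f p) (Y p)) v =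
          tadd (tscale (dir_deriv \<Phi> (X (base v)) f) (Y (base v))) (tscale (f (base v)) (nabla X Y v)))) \<and>
     (\<forall>X\<in>vector_fields \<Phi>. \<forall>Y\<in>vector_fields \<Phi>. \<forall>Z\<in>vector_fields \<Phi>. \<forall>f h.
        smooth_fun \<Phi> f \<longrightarrow> smooth_fun \<Phi> h \<longrightarrow> (\<forall>v\<in>A.
        nabla (\<lambda>p. tadd (tscale (f p) (X p)) (tscale (h p) (Y p))) Z v =
          tadd (tscale (f (base v)) (nabla X Z v)) (tscale (h (base v)) (nabla Y Z v))))"

text \<open>The coordinate fields of a chart are defined on its domain only, whereas a connection acts on
  global vector fields. A connection is local, so the coordinate fields may be replaced, near the
  base point, by arbitrary global fields that coincide with them in a neighbourhood.\<close>

definition coord_field_ext ::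
  "('m::topological_space, 'n::finite) chart set \<Rightarrow> ('m, 'n) chart \<Rightarrow> 'n \<Rightarrow> 'm \<Rightarrow> 'm \<Rightarrow> ('m, 'n) tvec" where
  "coord_field_ext \<Phi> c i p =
     (SOME X. X \<in> vector_fields \<Phi> \<and>
        (\<exists>N. open N \<and> p \<in> N \<and> N \<subseteq> cdom c \<and> (\<forall>q\<in>N. X q = coord_vec \<Phi> c q i)))"

text \<open>\<open>christoffel \<Phi> nabla c a i j v\<close> is the symbol with upper index a, where i is the index of the
  direction of differentiation and j that of the differentiated field.\<close>

definition christoffel ::
  "('m::topological_space, 'n::finite) chart set \<Rightarrow> ('m, 'n) conn \<Rightarrow> ('m, 'n) chart \<Rightarrow>
   'n \<Rightarrow> 'n \<Rightarrow> 'n \<Rightarrow> ('m, 'n) tvec \<Rightarrow> real" where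
  "christoffel \<Phi> nabla c a i j v =
     comps (nabla (coord_field_ext \<Phi> c i (base v)) (coord_field_ext \<Phi> c j (base v)) v) c $ a"

text \<open>The components, at v and in direction of the k-th coordinate field, of the covariant derivative
  of an anisotropic tensor.\<close>

definition cov_deriv_comp ::
  "('m::topological_space, 'n::finite) chart set \<Rightarrow> ('m, 'n) conn \<Rightarrow> ('m, 'n) chart \<Rightarrow>
   (('m, 'n) tvec \<Rightarrow> ('m, 'n) tensor) \<Rightarrow> ('m, 'n) tvec \<Rightarrow> 'n \<Rightarrow> 'n list \<Rightarrow> 'n list \<Rightarrow> real" where
  "cov_deriv_comp \<Phi> nabla c T v k as bs =
     (let \<Gamma> = (\<lambda>a i j. christoffel \<Phi> nabla c a i j v);
          Tc = (\<lambda>as bs z. tensor_comp \<Phi> c (cinv c (fst z)) (T (of_tcoords \<Phi> c z)) as bs);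
          z = tcoords c v
      in frechet_derivative (Tc as bs) (at z) (axis k 1, 0)
         - (\<Sum>i\<in>UNIV. \<Sum>j\<in>UNIV. \<Gamma> i k j * (comps v c $ j) * frechet_derivative (Tc as bs) (at z) (0, axis i 1))
         + (\<Sum>l<length as. \<Sum>j\<in>UNIV. \<Gamma> (as ! l) k j * Tc (as[l := j]) bs z)
         - (\<Sum>l<length bs. \<Sum>i\<in>UNIV. \<Gamma> i k (bs ! l) * Tc as (bs[l := i]) z))"

text \<open>The covariant derivative at v in direction of a tangent vector u at the base point of v: the tensor
  that has the above components (contracted with u) in every chart around the base point.\<close>

definition cov_deriv ::
  "nat \<Rightarrow> nat \<Rightarrow> ('m::topological_space, 'n::finite) chart set \<Rightarrow> ('m, 'n) conn \<Rightarrow>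
   ('m, 'n) tvec \<Rightarrow> (('m, 'n) tvec \<Rightarrow> ('m, 'n) tensor) \<Rightarrow> ('m, 'n) tvec \<Rightarrow> ('m, 'n) tensor" where
  "cov_deriv r s \<Phi> nabla u T v =
     (THE S. S \<in> tensors r s \<Phi> (base v) \<and>
        (\<forall>c\<in>charts_at \<Phi> (base v). \<forall>as bs. length as = r \<longrightarrow> length bs = s \<longrightarrow>
           tensor_comp \<Phi> c (base v) S as bs =
             (\<Sum>k\<in>UNIV. (comps u c $ k) * cov_deriv_comp \<Phi> nabla c T v k as bs)))"

section \<open>Parallel transport\<close>

text \<open>Fields along a curve are only required to be differentiable here; parallel ones solve a smooth
  ordinary differential equation and are therefore automatically smooth.\<close>

definition field_along ::
  "('m, 'n::finite) chart set \<Rightarrow> real set \<Rightarrow> (real \<Rightarrow> 'm) \<Rightarrow> (real \<Rightarrow> ('m, 'n) tvec) \<Rightarrow> bool" where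
  "field_along \<Phi> I \<gamma> X \<longleftrightarrow>
     (\<forall>t\<in>I. X t \<in> tangent_space \<Phi> (\<gamma> t) \<and>
        (\<forall>c\<in>charts_at \<Phi> (\<gamma> t). (\<lambda>\<tau>. comps (X \<tau>) c) differentiable (at t within I)))"

definition cov_deriv_along ::
  "('m::topological_space, 'n::finite) chart set \<Rightarrow> ('m, 'n) conn \<Rightarrow> real set \<Rightarrow> (real \<Rightarrow> 'm) \<Rightarrow>
   (real \<Rightarrow> ('m, 'n) tvec) \<Rightarrow> (real \<Rightarrow> ('m, 'n) tvec) \<Rightarrow> real \<Rightarrow> ('m, 'n) tvec" where
  "cov_deriv_along \<Phi> nabla I \<gamma> W X t =
     (\<gamma> t, \<lambda>c. if c \<in> charts_at \<Phi> (\<gamma> t)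
          then vector_derivative (\<lambda>\<tau>. comps (X \<tau>) c) (at t within I) +
            (\<chi> i. \<Sum>j\<in>UNIV. \<Sum>k\<in>UNIV. christoffel \<Phi> nabla c i j k (W t) *
                     (comps (velocity \<Phi> I \<gamma> t) c $ j) * (comps (X t) c $ k))
          else 0)"

definition parallel_along ::
  "('m::topological_space, 'n::finite) chart set \<Rightarrow> ('m, 'n) conn \<Rightarrow> real set \<Rightarrow> (real \<Rightarrow> 'm) \<Rightarrow>
   (real \<Rightarrow> ('m, 'n) tvec) \<Rightarrow> (real \<Rightarrow> ('m, 'n) tvec) \<Rightarrow> bool" where
  "parallel_along \<Phi> nabla I \<gamma> W X \<longleftrightarrow>
     field_along \<Phi> I \<gamma> X \<and> (\<forall>t\<in>I. cov_deriv_along \<Phi> nabla I \<gamma> W X t = tzero (\<gamma> t))"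

definition autoparallel_from ::
  "('m::topological_space, 'n::finite) chart set \<Rightarrow> ('m, 'n) tvec set \<Rightarrow> ('m, 'n) conn \<Rightarrow>
   real \<Rightarrow> real \<Rightarrow> (real \<Rightarrow> 'm) \<Rightarrow> ('m, 'n) tvec \<Rightarrow> (real \<Rightarrow> ('m, 'n) tvec) \<Rightarrow> bool" where
  "autoparallel_from \<Phi> A nabla a e \<gamma> v V \<longleftrightarrow>
     V a = v \<and> (\<forall>t\<in>{a..e}. V t \<in> A) \<and> parallel_along \<Phi> nabla {a..e} \<gamma> V V"

text \<open>For a curve on \<open>{a..b}\<close>, \<open>transport\<close> is the nonlinear transport of v from time a to time t,
  and \<open>lin_transport\<close> the linear one with reference vector v.
  The fields live on a nondegenerate interval \<open>{a..e}\<close> containing t, so that t = a is covered.\<close>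

definition transport ::
  "('m::topological_space, 'n::finite) chart set \<Rightarrow> ('m, 'n) tvec set \<Rightarrow> ('m, 'n) conn \<Rightarrow>
   real \<Rightarrow> real \<Rightarrow> (real \<Rightarrow> 'm) \<Rightarrow> real \<Rightarrow> ('m, 'n) tvec \<Rightarrow> ('m, 'n) tvec" where
  "transport \<Phi> A nabla a b \<gamma> t v =
     (THE w. \<exists>e V. a < e \<and> e \<le> b \<and> a \<le> t \<and> t \<le> e \<and> autoparallel_from \<Phi> A nabla a e \<gamma> v V \<and> V t = w)"

definition lin_transport ::
  "('m::topological_space, 'n::finite) chart set \<Rightarrow> ('m, 'n) tvec set \<Rightarrow> ('m, 'n) conn \<Rightarrow>
   real \<Rightarrow> real \<Rightarrow> (real \<Rightarrow> 'm) \<Rightarrow> real \<Rightarrow> ('m, 'n) tvec \<Rightarrow> ('m, 'n) tvec \<Rightarrow> ('m, 'n) tvec" where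
  "lin_transport \<Phi> A nabla a b \<gamma> t v w =
     (THE w'. \<exists>e V W. a < e \<and> e \<le> b \<and> a \<le> t \<and> t \<le> e \<and> autoparallel_from \<Phi> A nabla a e \<gamma> v V \<and>
        W a = w \<and> parallel_along \<Phi> nabla {a..e} \<gamma> V W \<and> W t = w')"

definition covec_transport ::
  "('m::topological_space, 'n::finite) chart set \<Rightarrow> ('m, 'n) tvec set \<Rightarrow> ('m, 'n) conn \<Rightarrow>
   real \<Rightarrow> real \<Rightarrow> (real \<Rightarrow> 'm) \<Rightarrow> real \<Rightarrow> ('m, 'n) tvec \<Rightarrow> ('m, 'n) covec \<Rightarrow> ('m, 'n) covec" where
  "covec_transport \<Phi> A nabla a b \<gamma> t v \<theta> =
     (\<lambda>u. if u \<in> tangent_space \<Phi> (\<gamma> t)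
          then \<theta> (inv_into (tangent_space \<Phi> (\<gamma> a)) (lin_transport \<Phi> A nabla a b \<gamma> t v) u) else 0)"

definition tensor_transport_back ::
  "('m::topological_space, 'n::finite) chart set \<Rightarrow> ('m, 'n) tvec set \<Rightarrow> ('m, 'n) conn \<Rightarrow>
   real \<Rightarrow> real \<Rightarrow> (real \<Rightarrow> 'm) \<Rightarrow> (('m, 'n) tvec \<Rightarrow> ('m, 'n) tensor) \<Rightarrow> ('m, 'n) tvec \<Rightarrow> real \<Rightarrow>
   ('m, 'n) tensor" where
  "tensor_transport_back \<Phi> A nabla a b \<gamma> T v t =
     (\<lambda>\<theta>s vs. T (transport \<Phi> A nabla a b \<gamma> t v)
        (map (covec_transport \<Phi> A nabla a b \<gamma> t v) \<theta>s)
        (map (lin_transport \<Phi> A nabla a b \<gamma> t v) vs))"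

text \<open>Differentiability of a curve of tensors at a fixed point p. The space of tensors is
  finite-dimensional, hence its topology is that of convergence on all arguments.\<close>

definition has_tensor_derivative ::
  "nat \<Rightarrow> nat \<Rightarrow> ('m, 'n::finite) chart set \<Rightarrow> 'm \<Rightarrow> (real \<Rightarrow> ('m, 'n) tensor) \<Rightarrow> ('m, 'n) tensor \<Rightarrow>
   real filter \<Rightarrow> bool" where
  "has_tensor_derivative r s \<Phi> p F S Fi \<longleftrightarrow>
     (\<forall>(\<theta>s, vs)\<in>tensor_args r s \<Phi> p. ((\<lambda>t. F t \<theta>s vs) has_real_derivative S \<theta>s vs) Fi)"

end

theory Submission
  imports Defs "HOL-Computational_Algebra.Polynomial"
begin

text \<open>
Fix a chart around \<open>\<gamma> a\<close>. The transported reference vector is a curve \<open>(x t, y t)\<close> in the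
natural coordinates, with \<open>y' = - \<Gamma>(y) x' y\<close>; the linear transport is a curve of matrices
\<open>M\<close> with \<open>M' = - B M\<close>, where \<open>B w = \<Gamma>(y) x' w\<close>, and its inverse is the curve \<open>N\<close> with
\<open>N' = N B\<close>. The tensor transported back to \<open>\<gamma> a\<close> is then the tensor at \<open>(x t, y t)\<close> with
\<open>M t\<close> applied in every vector slot and the transpose of \<open>N t\<close> in every covector slot. At
\<open>t = a\<close> both matrices are the identity, so that the product rule yields one term for the point
\<open>(x, y)\<close>, which is \<open>\<partial>\<^sub>k T - \<Gamma> y \<partial>T/\<partial>y\<close> contracted with the velocity, and one term
\<open>\<Gamma> T\<close> or \<open>- \<Gamma> T\<close> for each slot: the coordinate formula of the covariant derivative
(\<open>transport_back_derivative\<close>).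

The covariant derivative is the unique tensor whose components in every chart are given by that formula,
and its existence has to be shown too. Instead of transforming the components of the formula from chart to
chart, \<open>transport_back_has_cov_deriv\<close> uses that parallel transport does not refer to a chart: the
derivative of the transported tensor is one tensor, and the computation above may be carried out
in each chart separately.

Independence of the chart enters at one place only, in that a field which solves the transport equation in
one chart does so in all others (\<open>parallel_along_chartI\<close>). It rests on the inhomogeneous
transformation law of the Christoffel symbols (\<open>Gam_transform\<close>), which follows from the expression
of the connection in two charts (\<open>nabla_chart\<close>). Since connections act on global fields, that expression
needs locality, and with it cutoff functions. The same expression shows that the Christoffel symbols are
smooth functions of \<open>(x, y)\<close> (\<open>smooth_christoffel\<close>), and then the transport equations have
unique solutions by the Picard contraction and a Gronwall argument (\<open>transport_in_chart\<close>).
\<close>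


section \<open>Smooth maps between Euclidean spaces\<close>

text \<open>The derivative may be given by any formula, since it is unique at interior points; the class
  \<open>C^k\<close> on an open set depends on the values on that set only.\<close>

lemma Ck_on_SucI:
  assumes "\<And>x. x \<in> U \<Longrightarrow> (f has_derivative f' x) (at x)"
    and "open U" "\<And>w. Ck_on k U (\<lambda>x. f' x w)"
  shows "Ck_on (Suc k) U f"
proof -
  have cong: "Ck_on k U g" if "open U" "\<And>x. x \<in> U \<Longrightarrow> h x = g x" "Ck_on k U h"
    for k U and g h :: "'a \<Rightarrow> 'b"
    using that
  proof (induction k arbitrary: g h)
    case 0
    then show ?case using continuous_on_cong[of U U h g] by simp
  next
    case (Suc k)
    have 1: "frechet_derivative h (at x) = frechet_derivative g (at x)" if "x \<in> U" for x
      using Suc.prems that by (intro frechet_derivative_transform_within_open) auto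
    have 2: "g differentiable (at x)" if x: "x \<in> U" for x
    proof -
      have "h differentiable (at x)" using Suc.prems(3) x by simp
      then obtain D where "(h has_derivative D) (at x)"
        unfolding differentiable_def by blast
      then have "(g has_derivative D) (at x)"
        using has_derivative_transform_within_open[OF _ Suc.prems(1) x] Suc.prems(2) by blast
      then show ?thesis by (rule differentiableI)
    qed
    have "Ck_on k U (\<lambda>x. frechet_derivative g (at x) w)" for w
    proof (rule Suc.IH[OF Suc.prems(1)])
      show "Ck_on k U (\<lambda>x. frechet_derivative h (at x) w)" using Suc.prems(3) by simp
      show "frechet_derivative h (at x) w = frechet_derivative g (at x) w" if "x \<in> U" for x
        by (simp only: 1[OF that])
    qed
    with 2 show ?case by simp
  qed
  have eq: "f' x = frechet_derivative f (at x)" if "x \<in> U" for x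
    using assms(1)[OF that] by (rule frechet_derivative_at)
  have "Ck_on k U (\<lambda>x. frechet_derivative f (at x) w)" for w
    by (rule cong[OF assms(2) _ assms(3)[of w]]) (simp add: eq)
  then show ?thesis
    using assms(1) by (auto simp: differentiable_def)
qed

lemma Ck_on_SucE:
  assumes "Ck_on (Suc k) U f" "x \<in> U"
  shows "(f has_derivative frechet_derivative f (at x)) (at x)"
  using assms by (simp add: frechet_derivative_works)

lemma Ck_on_cong:
  assumes "open U" "\<And>x. x \<in> U \<Longrightarrow> f x = g x" "Ck_on k U f"
  shows "Ck_on k U g"
proof (cases k)
  case 0
  with assms show ?thesis using continuous_on_cong[of U U f g] by simp
next
  case (Suc j)
  show ?thesis unfolding Suc
  proof (rule Ck_on_SucI[OF _ assms(1)])
    fix x assume "x \<in> U"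
    then show "(g has_derivative frechet_derivative f (at x)) (at x)"
      using has_derivative_transform_within_open[OF Ck_on_SucE[OF assms(3)[unfolded Suc]] assms(1)] assms(2) by blast
  next
    show "Ck_on j U (\<lambda>x. frechet_derivative f (at x) w)" for w
      using assms(3) unfolding Suc by simp
  qed
qed

lemma Ck_on_subset: "Ck_on k U f \<Longrightarrow> V \<subseteq> U \<Longrightarrow> Ck_on k V f"
  by (induction k arbitrary: f) (auto intro: continuous_on_subset)

lemma Ck_on_SucD: "Ck_on (Suc k) U f \<Longrightarrow> Ck_on k U f"
proof (induction k arbitrary: f)
  case 0
  then show ?case
    by (auto intro!: continuous_at_imp_continuous_on differentiable_imp_continuous_within)
qed simp

lemma Ck_on_local:
  assumes "\<And>x. x \<in> U \<Longrightarrow> \<exists>V. open V \<and> x \<in> V \<and> Ck_on k V f"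
  shows "Ck_on k U f"
  using assms
proof (induction k arbitrary: f)
  case 0
  have "isCont f x" if "x \<in> U" for x
    using 0[OF that] continuous_on_eq_continuous_at by auto
  then show ?case by (auto intro: continuous_at_imp_continuous_on)
next
  case (Suc k)
  have "f differentiable (at x)" if "x \<in> U" for x
    using Suc.prems[OF that] by auto
  moreover have "Ck_on k U (\<lambda>x. frechet_derivative f (at x) w)" for w
  proof (rule Suc.IH)
    fix x assume "x \<in> U"
    from Suc.prems[OF this]
    show "\<exists>V. open V \<and> x \<in> V \<and> Ck_on k V (\<lambda>x. frechet_derivative f (at x) w)" by auto
  qed
  ultimately show ?case by simp
qed

text \<open>On open sets no extension is involved, which makes the calculus below a statement about
  iterated derivatives.\<close>

lemma smooth_on_open_iff:
  assumes "open S"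
  shows "smooth_on S f \<longleftrightarrow> (\<forall>k. Ck_on k S f)"
proof
  assume f: "smooth_on S f"
  show "\<forall>k. Ck_on k S f"
  proof (intro allI Ck_on_local)
    fix k x assume "x \<in> S"
    then obtain U g where "open U" "x \<in> U" "Ck_on k U g" "\<forall>y\<in>S \<inter> U. g y = f y"
      using f unfolding smooth_on_def by meson
    then show "\<exists>V. open V \<and> x \<in> V \<and> Ck_on k V f"
      using assms \<open>x \<in> S\<close> Ck_on_cong[of "S \<inter> U" g f k] Ck_on_subset[of k U g "S \<inter> U"]
      by (intro exI[of _ "S \<inter> U"]) auto
  qed
next
  assume "\<forall>k. Ck_on k S f"
  with assms show "smooth_on S f"
    unfolding smooth_on_def by (intro ballI exI[of _ S] exI[of _ f]) auto
qed

lemma smooth_on_cong: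
  assumes "open S" "\<And>x. x \<in> S \<Longrightarrow> f x = g x" "smooth_on S f"
  shows "smooth_on S g"
proof -
  have "Ck_on k S g" for k
  proof (rule Ck_on_cong[OF assms(1)])
    show "Ck_on k S f" using assms(1,3) by (simp add: smooth_on_open_iff)
  qed (rule assms(2))
  then show ?thesis using assms(1) by (simp add: smooth_on_open_iff)
qed

lemma smooth_on_subset:
  assumes "smooth_on S f" "T \<subseteq> S"
  shows "smooth_on T f"
  unfolding smooth_on_def
proof
  fix x assume "x \<in> T"
  with assms have "x \<in> S" by auto
  then obtain U g where "open U" "x \<in> U" "\<forall>k. Ck_on k U g" "\<forall>y\<in>S \<inter> U. g y = f y"
    using assms(1) unfolding smooth_on_def by meson
  with assms(2) show "\<exists>U g. open U \<and> x \<in> U \<and> (\<forall>k. Ck_on k U g) \<and> (\<forall>y\<in>T \<inter> U. g y = f y)"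
    by (intro exI[of _ U] exI[of _ g]) auto
qed

lemma smooth_on_local:
  assumes "open S" "\<And>x. x \<in> S \<Longrightarrow> \<exists>V. open V \<and> x \<in> V \<and> smooth_on V f"
  shows "smooth_on S f"
  unfolding smooth_on_open_iff[OF assms(1)]
proof (intro allI Ck_on_local)
  fix k x assume "x \<in> S"
  from assms(2)[OF this] obtain V where V: "open V" "x \<in> V" "smooth_on V f" by blast
  then have "Ck_on k V f" by (simp add: smooth_on_open_iff)
  with V show "\<exists>V. open V \<and> x \<in> V \<and> Ck_on k V f" by blast
qed

lemma smooth_on_imp_continuous_on: "open S \<Longrightarrow> smooth_on S f \<Longrightarrow> continuous_on S f"
  using smooth_on_open_iff[of S f] Ck_on.simps(1)[of S f] by blast

lemma smooth_on_has_derivative: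
  assumes "open S" "smooth_on S f" "x \<in> S"
  shows "(f has_derivative frechet_derivative f (at x)) (at x)"
  using Ck_on_SucE[of 0 S f x] assms(2,3) smooth_on_open_iff[OF assms(1), of f] by blast

lemma smooth_on_differentiable:
  "open S \<Longrightarrow> smooth_on S f \<Longrightarrow> x \<in> S \<Longrightarrow> f differentiable (at x)"
  using smooth_on_has_derivative differentiable_def by blast

lemma smooth_on_frechet_derivative:
  assumes "open S" "smooth_on S f"
  shows "smooth_on S (\<lambda>x. frechet_derivative f (at x) w)"
  using assms(2) Ck_on.simps(2)[of _ S f] unfolding smooth_on_open_iff[OF assms(1)]
  by blast

lemma Ck_on_const: "Ck_on k U (\<lambda>x. c)"
  by (induction k arbitrary: c) simp_all

lemma Ck_on_bounded_linear_compose: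
  assumes "bounded_linear h" "open U" "Ck_on k U f"
  shows "Ck_on k U (\<lambda>x. h (f x))"
  using assms(3)
proof (induction k arbitrary: f)
  case 0
  then show ?case
    using assms by (auto intro: bounded_linear.continuous_on)
next
  case (Suc k)
  show ?case
  proof (rule Ck_on_SucI[OF _ assms(2)])
    fix x assume "x \<in> U"
    then show "((\<lambda>x. h (f x)) has_derivative (\<lambda>w. h (frechet_derivative f (at x) w))) (at x)"
      using Ck_on_SucE[OF Suc.prems] assms bounded_linear.has_derivative by blast
  qed (use Suc in simp)
qed

lemma Ck_on_id: "open U \<Longrightarrow> Ck_on k U (\<lambda>x. x)"
proof (cases k)
  case (Suc j)
  assume "open U"
  then show ?thesis unfolding Suc
    by (intro Ck_on_SucI[where f'="\<lambda>x w. w"]) (auto intro: Ck_on_const)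
qed simp

lemma Ck_on_add:
  assumes "open U" "Ck_on k U f" "Ck_on k U g"
  shows "Ck_on k U (\<lambda>x. f x + g x)"
  using assms(2,3)
proof (induction k arbitrary: f g)
  case 0
  then show ?case by (auto intro: continuous_intros)
next
  case (Suc k)
  show ?case
  proof (rule Ck_on_SucI[OF _ assms(1)])
    fix x assume "x \<in> U"
    then show "((\<lambda>x. f x + g x) has_derivative
        (\<lambda>w. frechet_derivative f (at x) w + frechet_derivative g (at x) w)) (at x)"
      using Suc.prems Ck_on_SucE has_derivative_add by blast
  qed (use Suc in simp)
qed

lemma Ck_on_bounded_bilinear:
  assumes "bounded_bilinear B" "open U" "Ck_on k U f" "Ck_on k U g"
  shows "Ck_on k U (\<lambda>x. B (f x) (g x))"
  using assms(3,4)
proof (induction k arbitrary: f g)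
  case 0
  then show ?case using bounded_bilinear.continuous_on[OF assms(1)] by auto
next
  case (Suc k)
  note [simp] = Ck_on_SucD[OF Suc.prems(1)] Ck_on_SucD[OF Suc.prems(2)]
  show ?case
  proof (rule Ck_on_SucI[OF _ assms(2)])
    fix x assume x: "x \<in> U"
    show "((\<lambda>x. B (f x) (g x)) has_derivative
        (\<lambda>w. B (f x) (frechet_derivative g (at x) w) + B (frechet_derivative f (at x) w) (g x))) (at x)"
      by (rule bounded_bilinear.FDERIV[OF assms(1) Ck_on_SucE[OF Suc.prems(1) x]
            Ck_on_SucE[OF Suc.prems(2) x]])
  next
    fix w
    show "Ck_on k U (\<lambda>x. B (f x) (frechet_derivative g (at x) w) + B (frechet_derivative f (at x) w) (g x))"
      using Suc.prems by (intro Ck_on_add assms(2) Suc.IH) simp_all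
  qed
qed

lemma Ck_on_sum:
  assumes "open U" "\<And>i. i \<in> I \<Longrightarrow> Ck_on k U (f i)"
  shows "Ck_on k U (\<lambda>x. \<Sum>i\<in>I. f i x)"
  using assms(2)
  by (induction I rule: infinite_finite_induct) (auto intro: Ck_on_const Ck_on_add assms(1))

text \<open>Expanding the inner derivative in a basis turns the chain rule into a finite sum of products of
  functions that are one order better, so that the claim follows by induction on the order.\<close>

lemma Ck_on_compose:
  fixes g :: "'a::euclidean_space \<Rightarrow> 'b::euclidean_space" and f :: "'b \<Rightarrow> 'c::real_normed_vector"
  assumes "open U" "open V" "g ` U \<subseteq> V" "Ck_on k V f" "Ck_on k U g"
  shows "Ck_on k U (\<lambda>x. f (g x))"
  using assms(4,5)
proof (induction k arbitrary: f)
  case 0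
  then show ?case using assms(3) by (auto intro: continuous_on_compose2)
next
  case (Suc k)
  let ?df = "\<lambda>y. frechet_derivative f (at y)" and ?dg = "\<lambda>x. frechet_derivative g (at x)"
  have expand: "?df (g x) (?dg x w) = (\<Sum>b\<in>Basis. (?dg x w \<bullet> b) *\<^sub>R ?df (g x) b)" if "x \<in> U" for x w
  proof -
    have "linear (?df (g x))"
      using that Suc.prems assms(3) by (intro linear_frechet_derivative) auto
    then show ?thesis
      by (subst euclidean_representation[of "?dg x w", symmetric]) (simp add: linear_sum linear_scale)
  qed
  show ?case
  proof (rule Ck_on_SucI[OF _ assms(1)])
    fix x assume x: "x \<in> U"
    then have "g x \<in> V" using assms by auto
    have "((\<lambda>x. f (g x)) has_derivative (\<lambda>w. ?df (g x) (?dg x w))) (at x)"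
      using has_derivative_compose[OF Ck_on_SucE[OF Suc.prems(2) x] Ck_on_SucE[OF Suc.prems(1) \<open>g x \<in> V\<close>]]
      by (simp add: o_def)
    then show "((\<lambda>x. f (g x)) has_derivative (\<lambda>w. \<Sum>b\<in>Basis. (?dg x w \<bullet> b) *\<^sub>R ?df (g x) b)) (at x)"
      using expand[OF x] by simp
  next
    fix w
    have "Ck_on k U (\<lambda>x. ?dg x w \<bullet> b)" for b
      using Suc.prems(2)
      by (intro Ck_on_bounded_linear_compose[OF bounded_linear_inner_left]) (simp_all add: assms)
    moreover have "Ck_on k U (\<lambda>x. ?df (g x) b)" for b
      using Suc.prems Suc.IH[of "\<lambda>y. ?df y b"] Ck_on_SucD by auto
    ultimately show "Ck_on k U (\<lambda>x. \<Sum>b\<in>Basis. (?dg x w \<bullet> b) *\<^sub>R ?df (g x) b)"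
      by (intro Ck_on_sum Ck_on_bounded_bilinear[OF bounded_bilinear_scaleR] assms(1))
  qed
qed

lemma smooth_on_const: "open S \<Longrightarrow> smooth_on S (\<lambda>x. c)"
  by (simp add: smooth_on_open_iff Ck_on_const)

lemma smooth_on_ident: "open S \<Longrightarrow> smooth_on S (\<lambda>x. x)"
  by (simp add: smooth_on_open_iff Ck_on_id)

lemma smooth_on_bounded_linear:
  assumes "bounded_linear h" "open S" "smooth_on S f"
  shows "smooth_on S (\<lambda>x. h (f x))"
  using assms(3) unfolding smooth_on_open_iff[OF assms(2)]
  by (blast intro: Ck_on_bounded_linear_compose[OF assms(1,2), of _ f])

lemma smooth_on_add:
  assumes "open S" "smooth_on S f" "smooth_on S g"
  shows "smooth_on S (\<lambda>x. f x + g x)"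
  using assms(2,3) unfolding smooth_on_open_iff[OF assms(1)]
  by (intro allI Ck_on_add assms) auto

lemma smooth_on_sum:
  assumes "open S" "\<And>i. i \<in> I \<Longrightarrow> smooth_on S (F i)"
  shows "smooth_on S (\<lambda>x. \<Sum>i\<in>I. F i x)"
  using assms(2) unfolding smooth_on_open_iff[OF assms(1)]
  by (intro allI Ck_on_sum assms) auto

lemma smooth_on_scaleR:
  assumes "open S" "smooth_on S f" "smooth_on S g"
  shows "smooth_on S (\<lambda>x. f x *\<^sub>R g x)"
  using assms(2,3) unfolding smooth_on_open_iff[OF assms(1)]
  by (intro allI Ck_on_bounded_bilinear[OF bounded_bilinear_scaleR] assms(1)) auto

lemma smooth_on_mult:
  fixes f g :: "'a::euclidean_space \<Rightarrow> real"
  assumes "open S" "smooth_on S f" "smooth_on S g"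
  shows "smooth_on S (\<lambda>x. f x * g x)"
  using smooth_on_scaleR[OF assms] by simp

lemma smooth_on_compose:
  assumes "open S" "open V" "g ` S \<subseteq> V" "smooth_on V f" "smooth_on S g"
  shows "smooth_on S (\<lambda>x. f (g x))"
  using assms(4,5) unfolding smooth_on_open_iff[OF assms(1)] smooth_on_open_iff[OF assms(2)]
  by (blast intro: Ck_on_compose[OF assms(1-3), of _ f])

lemma smooth_on_vec_nth: "open S \<Longrightarrow> smooth_on S f \<Longrightarrow> smooth_on S (\<lambda>x. f x $ i)"
  by (rule smooth_on_bounded_linear[OF bounded_linear_vec_nth])

lemma vec_eq_sum_axis: "(y::real^'n) = (\<Sum>i\<in>UNIV. (y $ i) *\<^sub>R axis i 1)"
  by (simp add: vec_eq_iff axis_def if_distrib[of "(*) _"] cong: if_cong)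

lemma sum_mult_axis: "(\<Sum>l\<in>UNIV. f l * (axis k 1 :: real^'n) $ l) = f k"
  by (simp add: axis_def if_distrib[of "(*) _"] cong: if_cong)

lemma linear_eq_sum_axis:
  assumes "linear f"
  shows "f (y::real^'n) = (\<Sum>i\<in>UNIV. (y $ i) *\<^sub>R f (axis i 1))"
  by (subst vec_eq_sum_axis[of y]) (simp add: linear_sum[OF assms] linear_scale[OF assms])

lemma smooth_on_vec_lambda:
  fixes f :: "'n::finite \<Rightarrow> 'a::euclidean_space \<Rightarrow> real"
  assumes "open S" "\<And>i. smooth_on S (f i)"
  shows "smooth_on S (\<lambda>x. \<chi> i. f i x)"
proof -
  have "smooth_on S (\<lambda>x. \<Sum>i\<in>UNIV. f i x *\<^sub>R axis i (1::real))"
    using assms by (intro smooth_on_sum smooth_on_scaleR smooth_on_const) auto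
  then show ?thesis
    by (subst vec_eq_sum_axis) simp
qed

text \<open>The derivative is smooth for each fixed direction; a direction that varies with the point is
  expanded in the coordinate directions.\<close>

lemma smooth_on_frechet_derivative_apply:
  fixes f :: "real^'n \<Rightarrow> 'b::real_normed_vector"
  assumes "open S" "smooth_on S f" "smooth_on S y"
  shows "smooth_on S (\<lambda>x. frechet_derivative f (at x) (y x))"
proof (rule smooth_on_cong[OF assms(1)])
  show "smooth_on S (\<lambda>x. \<Sum>i\<in>UNIV. (y x $ i) *\<^sub>R frechet_derivative f (at x) (axis i 1))"
    using assms
    by (intro smooth_on_sum smooth_on_scaleR smooth_on_vec_nth smooth_on_frechet_derivative)
  show "(\<Sum>i\<in>UNIV. (y x $ i) *\<^sub>R frechet_derivative f (at x) (axis i 1)) =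
      frechet_derivative f (at x) (y x)" if "x \<in> S" for x
    by (rule linear_eq_sum_axis[symmetric])
      (rule linear_frechet_derivative[OF smooth_on_differentiable[OF assms(1,2) that]])
qed

text \<open>Together with \<open>local_lipschitz_compact_implies_lipschitz\<close> this bounds the difference quotients
  of a smooth map on every compact set, convex or not. That is what uniqueness of solutions of
  differential equations uses, where nothing is known about the position of the two trajectories.\<close>

lemma smooth_on_imp_local_lipschitz:
  fixes f :: "'a::euclidean_space \<Rightarrow> 'b::euclidean_space"
  assumes "open U" "smooth_on U f"
  shows "local_lipschitz {0::real} U (\<lambda>_. f)"
proof (rule local_lipschitzI)
  fix t :: real and x assume "x \<in> U"
  let ?d = "\<lambda>x. frechet_derivative f (at x)"
  obtain r where r: "r > 0" "cball x r \<subseteq> U"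
    using \<open>x \<in> U\<close> assms(1) open_contains_cball by blast
  have c: "continuous_on (cball x r) (\<lambda>z. \<Sum>b\<in>Basis. norm (?d z b))"
    using smooth_on_imp_continuous_on[OF assms(1) smooth_on_frechet_derivative[OF assms]] r
    by (intro continuous_intros) (auto intro: continuous_on_subset)
  (* A bound for the partial derivatives bounds the operator norm, and a ball is convex, so that the
     mean value inequality applies. *)
  obtain B where "\<And>z. z \<in> cball x r \<Longrightarrow> norm (\<Sum>b\<in>Basis. norm (?d z b)) \<le> B"
    using compact_imp_bounded[OF compact_continuous_image[OF c compact_cball]]
    unfolding bounded_iff by blast
  then have B: "\<And>z. z \<in> cball x r \<Longrightarrow> (\<Sum>b\<in>Basis. norm (?d z b)) \<le> B"
    using abs_le_D1 by fastforce
  have "0 \<le> (\<Sum>b\<in>Basis. norm (?d x b))" by (intro sum_nonneg) simp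
  also have "\<dots> \<le> B" using r by (intro B) simp
  finally have "0 \<le> B" .
  have "B-lipschitz_on (cball x r) f"
  proof (rule lipschitz_onI)
    fix y z assume yz: "y \<in> cball x r" "z \<in> cball x r"
    show "dist (f y) (f z) \<le> B * dist y z"
      unfolding dist_norm
    proof (rule differentiable_bound[of "cball x r" f ?d])
      fix u assume u: "u \<in> cball x r"
      then have d: "(f has_derivative ?d u) (at u)"
        using smooth_on_has_derivative[OF assms] r by blast
      then show "(f has_derivative ?d u) (at u within cball x r)"
        by (rule has_derivative_at_withinI)
      have lin: "linear (?d u)" using d by (rule has_derivative_linear)
      have "norm (?d u w) \<le> B * norm w" for w
      proof -
        have "?d u w = (\<Sum>b\<in>Basis. (w \<bullet> b) *\<^sub>R ?d u b)"
          by (subst euclidean_representation[of w, symmetric]) (simp add: linear_sum linear_scale lin)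
        also have "norm \<dots> \<le> (\<Sum>b\<in>Basis. norm w * norm (?d u b))"
          by (intro sum_norm_le) (auto intro!: mult_right_mono Basis_le_norm)
        also have "\<dots> = norm w * (\<Sum>b\<in>Basis. norm (?d u b))" by (simp add: sum_distrib_left)
        also have "\<dots> \<le> norm w * B" using B[OF u] by (intro mult_left_mono) auto
        finally show ?thesis by (simp add: mult.commute)
      qed
      then show "onorm (?d u) \<le> B" by (intro onorm_bound \<open>0 \<le> B\<close>)
    qed (use yz in auto)
  qed (fact \<open>0 \<le> B\<close>)
  then show "\<exists>u>0. \<exists>L. \<forall>t\<in>cball t u \<inter> {0}. L-lipschitz_on (cball x u \<inter> U) f"
    using r by (intro exI[of _ r] conjI exI[of _ B]) (auto simp: Int_absorb2)
qed

lemma smooth_on_lipschitz_on_compact: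
  fixes f :: "'a::euclidean_space \<Rightarrow> 'b::euclidean_space"
  assumes "open U" "smooth_on U f" "compact K" "K \<subseteq> U"
  obtains L where "L-lipschitz_on K f"
proof -
  have "local_lipschitz {0::real} K (\<lambda>_. f)"
    using smooth_on_imp_local_lipschitz[OF assms(1,2)] local_lipschitz_subset assms(4) by blast
  from local_lipschitz_compact_implies_lipschitz[OF this assms(3)] obtain L
    where "\<And>t. t \<in> {0::real} \<Longrightarrow> L-lipschitz_on K f"
    by (metis compact_sing continuous_on_const)
  then show ?thesis
    using that by auto
qed

section \<open>Cutoff functions\<close>

text \<open>The function \<open>exp (- 1 / t)\<close>, cut off at 0, is smooth because the family of its products with
  polynomials in \<open>1 / t\<close> is closed under differentiation, and all members vanish at 0 to
  first order.\<close>

definition flat :: "real poly \<Rightarrow> real \<Rightarrow> real" where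
  "flat p t = (if t > 0 then poly p (1 / t) * exp (- (1 / t)) else 0)"

lemma flat_tendsto_0:
  fixes p :: "real poly"
  shows "((\<lambda>t. poly p (1 / t) * exp (- (1 / t))) \<longlongrightarrow> 0) (at_right 0)"
proof -
  have "((\<lambda>s. poly p s * exp (- s)) \<longlongrightarrow> 0) at_top"
  proof -
    have "((\<lambda>s::real. \<Sum>i\<le>degree p. coeff p i * (s ^ i / exp s)) \<longlongrightarrow> (\<Sum>i\<le>degree p. coeff p i * 0)) (at_top :: real filter)"
      by (intro tendsto_sum tendsto_mult[OF tendsto_const] tendsto_power_div_exp_0)
    moreover have "(\<Sum>i\<le>degree p. coeff p i * (s ^ i / exp s)) = poly p s * exp (- s)" for s
      by (simp add: poly_altdef sum_distrib_right exp_minus divide_inverse mult.assoc)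
    ultimately show ?thesis by simp
  qed
  from filterlim_compose[OF this filterlim_inverse_at_top_right] show ?thesis
    by (simp add: inverse_eq_divide)
qed

text \<open>With \<open>s = 1 / t\<close> the derivative of \<open>p s exp (- s)\<close> is \<open>s\<^sup>2 (p s - p' s) exp (- s)\<close>.
  At 0 the right difference quotient is itself of this form, with \<open>p\<close> multiplied by the variable.\<close>

lemma DERIV_flat:
  "(flat p has_real_derivative flat ((p - pderiv p) * [:0, 0, 1:]) t) (at t)"
proof -
  consider "t > 0" | "t < 0" | "t = 0" by linarith
  then show ?thesis
  proof cases
    case 1
    have "((\<lambda>t. poly p (1 / t) * exp (- (1 / t))) has_real_derivative
        flat ((p - pderiv p) * [:0, 0, 1:]) t) (at t)"
      using 1 by (auto intro!: derivative_eq_intros simp: flat_def field_simps power2_eq_square)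
    then show ?thesis
      by (rule has_field_derivative_transform_within_open[where S="{0<..}"]) (use 1 in \<open>auto simp: flat_def\<close>)
  next
    case 2
    have "((\<lambda>t. 0) has_real_derivative flat ((p - pderiv p) * [:0, 0, 1:]) t) (at t)"
      using 2 by (simp add: flat_def)
    then show ?thesis
      by (rule has_field_derivative_transform_within_open[where S="{..<0}"]) (use 2 in \<open>auto simp: flat_def\<close>)
  next
    case 3
    have "((\<lambda>h. flat p h / h) \<longlongrightarrow> 0) (at_right 0)"
    proof (rule Lim_transform_eventually[OF flat_tendsto_0[of "p * [:0, 1:]"]])
      show "\<forall>\<^sub>F h in at_right 0. poly (p * [:0, 1:]) (1 / h) * exp (- (1 / h)) = flat p h / h"
        by (auto simp: eventually_at_right_less flat_def intro!: eventually_at_rightI[of 0 1])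
    qed
    moreover have "((\<lambda>h. flat p h / h) \<longlongrightarrow> 0) (at_left 0)"
      by (rule Lim_transform_eventually[OF tendsto_const])
        (auto simp: flat_def intro!: eventually_at_leftI[of "-1"])
    ultimately have "((\<lambda>h. flat p h / h) \<longlongrightarrow> 0) (at 0)"
      by (intro filterlim_split_at)
    then show ?thesis using 3 by (simp add: DERIV_def flat_def)
  qed
qed

lemma smooth_on_flat: "smooth_on UNIV (flat p)"
proof -
  have "Ck_on k UNIV (flat p)" for k
  proof (induction k arbitrary: p)
    case 0
    have "isCont (flat p) t" for t using DERIV_flat by (rule DERIV_isCont)
    then show ?case by (simp add: continuous_at_imp_continuous_on)
  next
    case (Suc k)
    show ?case
    proof (rule Ck_on_SucI)
      show "(flat p has_derivative (\<lambda>w. flat ((p - pderiv p) * [:0, 0, 1:]) t * w)) (at t)" for t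
        using DERIV_flat by (rule has_field_derivative_imp_has_derivative)
      show "Ck_on k UNIV (\<lambda>t. flat ((p - pderiv p) * [:0, 0, 1:]) t * w)" for w
        by (rule Ck_on_bounded_linear_compose[OF bounded_linear_mult_left _ Suc.IH]) simp
    qed simp
  qed
  then show ?thesis by (simp add: smooth_on_open_iff)
qed

text \<open>Nesting the flat function makes it constant on both sides: up to distance \<open>r\<close> the inner function
  vanishes, and from distance \<open>2 * r\<close> on its value is at least the level from which it is subtracted, so
  that the outer function vanishes.\<close>

lemma cutoff_exists:
  fixes x0 :: "'a::euclidean_space"
  assumes "r > 0"
  obtains \<beta> :: "'a \<Rightarrow> real" where "smooth_on UNIV \<beta>"
    "\<And>x. norm (x - x0) \<le> r \<Longrightarrow> \<beta> x = 1" "\<And>x. norm (x - x0) \<ge> 2 * r \<Longrightarrow> \<beta> x = 0"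
proof
  define \<phi> where "\<phi> = flat 1"
  (* The value of the inner function at distance 2 * r. *)
  define \<kappa> where "\<kappa> = \<phi> (3 * r\<^sup>2)"
  define \<beta> where "\<beta> = (\<lambda>x. (1 / \<phi> \<kappa>) * \<phi> (\<kappa> + - \<phi> ((x - x0) \<bullet> (x - x0) + - r\<^sup>2)))"
  have \<phi>: "smooth_on UNIV \<phi>" unfolding \<phi>_def by (rule smooth_on_flat)
  have pos: "\<phi> t > 0" if "t > 0" for t using that by (simp add: \<phi>_def flat_def)
  have zero: "\<phi> t = 0" if "t \<le> 0" for t using that by (simp add: \<phi>_def flat_def)
  have mono: "\<phi> s \<le> \<phi> t" if "0 < s" "s \<le> t" for s t
    using that by (simp add: \<phi>_def flat_def frac_le)
  have "\<kappa> > 0" unfolding \<kappa>_def using assms by (intro pos) simp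
  have "smooth_on UNIV (\<lambda>x. x - x0)"
    using smooth_on_add[OF open_UNIV smooth_on_ident[OF open_UNIV] smooth_on_const[OF open_UNIV], of "- x0"] by simp
  then have "smooth_on UNIV (\<lambda>x. (x - x0) \<bullet> (x - x0))"
    using Ck_on_bounded_bilinear[OF bounded_bilinear_inner open_UNIV, of _ "\<lambda>x. x - x0" "\<lambda>x. x - x0"]
    by (simp add: smooth_on_open_iff)
  then have "smooth_on UNIV (\<lambda>x. \<phi> ((x - x0) \<bullet> (x - x0) + - r\<^sup>2))"
    by (intro smooth_on_compose[OF _ _ _ \<phi>] smooth_on_add smooth_on_const) auto
  then have "smooth_on UNIV (\<lambda>x. - \<phi> ((x - x0) \<bullet> (x - x0) + - r\<^sup>2))"
    by (intro smooth_on_bounded_linear[OF bounded_linear_minus[OF bounded_linear_ident]]) auto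
  then show "smooth_on UNIV \<beta>" unfolding \<beta>_def
    by (intro smooth_on_mult smooth_on_const smooth_on_compose[OF _ _ _ \<phi>] smooth_on_add) auto
  show "\<beta> x = 1" if "norm (x - x0) \<le> r" for x
  proof -
    have "(norm (x - x0))\<^sup>2 \<le> r\<^sup>2" using that by (intro power_mono) auto
    then have "\<phi> ((x - x0) \<bullet> (x - x0) + - r\<^sup>2) = 0"
      by (intro zero) (simp add: power2_norm_eq_inner)
    with pos[OF \<open>\<kappa> > 0\<close>] show ?thesis by (simp add: \<beta>_def)
  qed
  show "\<beta> x = 0" if "norm (x - x0) \<ge> 2 * r" for x
  proof -
    have "(norm (x - x0))\<^sup>2 \<ge> (2 * r)\<^sup>2" using that assms by (intro power_mono) auto
    then have "\<kappa> \<le> \<phi> ((x - x0) \<bullet> (x - x0) + - r\<^sup>2)"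
      unfolding \<kappa>_def using assms by (intro mono) (auto simp: power2_norm_eq_inner)
    then show ?thesis by (simp add: \<beta>_def zero)
  qed
qed

section \<open>Charts, tangent vectors and covectors\<close>

lemma tvec_ops [simp]:
  "base (tadd u w) = base u" "comps (tadd u w) c = comps u c + comps w c"
  "base (tscale r u) = base u" "comps (tscale r u) c = r *\<^sub>R comps u c"
  "base (tzero p) = p" "comps (tzero p) c = 0"
  by (simp_all add: tadd_def tscale_def tzero_def)

locale manifold =
  fixes \<Phi> :: "('m::{t2_space, second_countable_topology}, 'n::finite) chart set"
  assumes smooth: "smooth_manifold \<Phi>"
begin

text \<open>The Jacobian matrix of the change from chart \<open>c\<close> to chart \<open>d\<close>.\<close>

abbreviation J :: "('m, 'n) chart \<Rightarrow> ('m, 'n) chart \<Rightarrow> real^'n \<Rightarrow> real^'n \<Rightarrow> real^'n" where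
  "J c d x \<equiv> frechet_derivative (cmap d \<circ> cinv c) (at x)"

abbreviation tvec_of :: "('m, 'n) chart \<Rightarrow> 'm \<Rightarrow> real^'n \<Rightarrow> ('m, 'n) tvec" where
  "tvec_of c p y \<equiv> of_tcoords \<Phi> c (cmap c p, y)"

definition covec_of :: "('m, 'n) chart \<Rightarrow> 'm \<Rightarrow> real^'n \<Rightarrow> ('m, 'n) covec" where
  "covec_of c p \<eta> = (\<lambda>v. if v \<in> tangent_space \<Phi> p then \<eta> \<bullet> comps v c else 0)"

lemma is_chart: "c \<in> \<Phi> \<Longrightarrow> is_chart c"
  using smooth by (simp add: smooth_manifold_def)

lemma open_cdom [simp, intro]: "c \<in> \<Phi> \<Longrightarrow> open (cdom c)"
  and open_cmap_cdom [simp, intro]: "c \<in> \<Phi> \<Longrightarrow> open (cmap c ` cdom c)"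
  and chart_homeomorphism:
    "c \<in> \<Phi> \<Longrightarrow> homeomorphism (cdom c) (cmap c ` cdom c) (cmap c) (cinv c)"
  using is_chart by (auto simp: is_chart_def)

lemma cinv_cmap [simp]: "c \<in> \<Phi> \<Longrightarrow> p \<in> cdom c \<Longrightarrow> cinv c (cmap c p) = p"
  using chart_homeomorphism homeomorphism_apply1 by fastforce

lemma continuous_on_cmap: "c \<in> \<Phi> \<Longrightarrow> continuous_on (cdom c) (cmap c)"
  and continuous_on_cinv: "c \<in> \<Phi> \<Longrightarrow> continuous_on (cmap c ` cdom c) (cinv c)"
  using chart_homeomorphism homeomorphism_def by metis+

lemma open_cmap_image:
  assumes "c \<in> \<Phi>" "open N" "N \<subseteq> cdom c"
  shows "open (cmap c ` N)"
proof -
  have "openin (top_of_set (cmap c ` cdom c)) (cmap c ` N)"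
    using chart_homeomorphism[OF assms(1)]
    by (rule homeomorphism_imp_open_map) (use assms in \<open>simp add: openin_open_eq\<close>)
  then show ?thesis
    using assms(1) openin_open_trans by blast
qed

lemma open_overlap: "c \<in> \<Phi> \<Longrightarrow> d \<in> \<Phi> \<Longrightarrow> open (cmap c ` (cdom c \<inter> cdom d))"
  by (intro open_cmap_image) auto

lemma smooth_transition:
  "c \<in> \<Phi> \<Longrightarrow> d \<in> \<Phi> \<Longrightarrow> smooth_on (cmap c ` (cdom c \<inter> cdom d)) (cmap d \<circ> cinv c)"
  using smooth by (simp add: smooth_manifold_def)

lemma transition_image:
  assumes "c \<in> \<Phi>" "d \<in> \<Phi>"
  shows "(cmap d \<circ> cinv c) ` cmap c ` (cdom c \<inter> cdom d) \<subseteq> cmap d ` (cdom d \<inter> cdom c)"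
proof
  fix y assume "y \<in> (cmap d \<circ> cinv c) ` cmap c ` (cdom c \<inter> cdom d)"
  then obtain q where q: "q \<in> cdom c" "q \<in> cdom d" "y = cmap d (cinv c (cmap c q))" by auto
  with assms have "y = cmap d q" by simp
  with q show "y \<in> cmap d ` (cdom d \<inter> cdom c)" by blast
qed

lemma chart_around: obtains c where "c \<in> charts_at \<Phi> p"
  using smooth unfolding smooth_manifold_def charts_at_def by blast

lemma charts_atD: "c \<in> charts_at \<Phi> p \<Longrightarrow> c \<in> \<Phi>" "c \<in> charts_at \<Phi> p \<Longrightarrow> p \<in> cdom c"
  by (auto simp: charts_at_def)

lemma charts_atI: "c \<in> \<Phi> \<Longrightarrow> p \<in> cdom c \<Longrightarrow> c \<in> charts_at \<Phi> p"
  by (auto simp: charts_at_def)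

lemma has_derivative_transition:
  assumes "c \<in> charts_at \<Phi> p" "d \<in> charts_at \<Phi> p"
  shows "((cmap d \<circ> cinv c) has_derivative J c d (cmap c p)) (at (cmap c p))"
  using assms by (intro smooth_on_has_derivative[OF open_overlap smooth_transition]) (auto simp: charts_at_def)

lemma linear_J:
  assumes "c \<in> charts_at \<Phi> p" "d \<in> charts_at \<Phi> p"
  shows "linear (J c d (cmap c p))"
  using has_derivative_transition[OF assms] by (rule has_derivative_linear)

lemma J_self:
  assumes "c \<in> charts_at \<Phi> p"
  shows "J c c (cmap c p) = (\<lambda>y. y)"
proof -
  have "((cmap c \<circ> cinv c) has_derivative (\<lambda>y. y)) (at (cmap c p))"
    using assms
    by (intro has_derivative_transform_within_open[OF has_derivative_ident, of "cmap c ` cdom c"])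
      (auto simp: charts_at_def)
  then show ?thesis by (rule frechet_derivative_at[symmetric])
qed

text \<open>The chain rule for changes of charts. It makes the components of a tangent vector in one chart
  determine consistent components in all others.\<close>

lemma J_cocycle:
  assumes "c \<in> charts_at \<Phi> p" "d \<in> charts_at \<Phi> p" "e \<in> charts_at \<Phi> p"
  shows "J d e (cmap d p) (J c d (cmap c p) y) = J c e (cmap c p) y"
proof -
  have p: "c \<in> \<Phi>" "d \<in> \<Phi>" "e \<in> \<Phi>" "p \<in> cdom c" "p \<in> cdom d" "p \<in> cdom e"
    using assms by (auto simp: charts_at_def)
  have "((cmap e \<circ> cinv d) \<circ> (cmap d \<circ> cinv c) has_derivative
      J d e (cmap d p) \<circ> J c d (cmap c p)) (at (cmap c p))"
    using has_derivative_transition[OF assms(2,3)] p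
    by (intro diff_chain_at has_derivative_transition[OF assms(1,2)]) auto
  then have "((cmap e \<circ> cinv c) has_derivative J d e (cmap d p) \<circ> J c d (cmap c p)) (at (cmap c p))"
    by (rule has_derivative_transform_within_open[of _ _ _ _ "cmap c ` (cdom c \<inter> cdom d)"])
      (use p open_overlap in auto)
  then have "J d e (cmap d p) \<circ> J c d (cmap c p) = J c e (cmap c p)"
    by (rule frechet_derivative_at)
  from fun_cong[OF this, of y] show ?thesis by simp
qed

lemma base_tvec_of [simp]: "c \<in> charts_at \<Phi> p \<Longrightarrow> base (tvec_of c p y) = p"
  by (simp add: of_tcoords_def charts_atD)

lemma comps_tvec_of:
  assumes "c \<in> charts_at \<Phi> p"
  shows "comps (tvec_of c p y) d = (if d \<in> charts_at \<Phi> p then J c d (cmap c p) y else 0)"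
  using assms by (simp add: of_tcoords_def charts_atD)

lemma comps_tvec_of_self [simp]:
  assumes "c \<in> charts_at \<Phi> p"
  shows "comps (tvec_of c p y) c = y"
  using assms by (simp add: comps_tvec_of J_self)

lemma tvec_of_in_tangent_space [simp, intro]:
  assumes "c \<in> charts_at \<Phi> p"
  shows "tvec_of c p y \<in> tangent_space \<Phi> p"
  using assms by (auto simp: tangent_space_def comps_tvec_of J_cocycle)

lemma base_tangent_space: "v \<in> tangent_space \<Phi> p \<Longrightarrow> base v = p"
  unfolding tangent_space_def by blast

lemma comps_change:
  assumes "v \<in> tangent_space \<Phi> p" "c \<in> charts_at \<Phi> p" "d \<in> charts_at \<Phi> p"
  shows "comps v d = J c d (cmap c p) (comps v c)"
  using assms unfolding tangent_space_def by blast

lemma comps_outside: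
  assumes "v \<in> tangent_space \<Phi> p" "d \<notin> charts_at \<Phi> p"
  shows "comps v d = 0"
  using assms unfolding tangent_space_def by blast

lemma tangent_space_eqI:
  assumes "u \<in> tangent_space \<Phi> p" "w \<in> tangent_space \<Phi> p" "c \<in> charts_at \<Phi> p"
    "comps u c = comps w c"
  shows "u = w"
proof (rule prod_eqI)
  show "fst u = fst w" using assms base_tangent_space by simp
  show "comps u = comps w"
  proof
    fix d show "comps u d = comps w d"
    proof (cases "d \<in> charts_at \<Phi> p")
      case True
      then show ?thesis
        using assms(3,4) comps_change[OF assms(1), of c d] comps_change[OF assms(2), of c d] by simp
    next
      case False
      then show ?thesis using assms comps_outside by simp
    qed
  qed
qed

lemma tvec_of_comps [simp]:
  assumes "v \<in> tangent_space \<Phi> p" "c \<in> charts_at \<Phi> p"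
  shows "tvec_of c p (comps v c) = v"
  using assms by (intro tangent_space_eqI[of _ p]) auto

lemma tangent_spaceI:
  assumes "base v = p" "\<And>c. c \<notin> charts_at \<Phi> p \<Longrightarrow> comps v c = 0"
    "\<And>c d. c \<in> charts_at \<Phi> p \<Longrightarrow> d \<in> charts_at \<Phi> p \<Longrightarrow> comps v d = J c d (cmap c p) (comps v c)"
  shows "v \<in> tangent_space \<Phi> p"
  using assms unfolding tangent_space_def by blast

lemma tangent_space_tadd [simp, intro]:
  assumes "u \<in> tangent_space \<Phi> p" "w \<in> tangent_space \<Phi> p"
  shows "tadd u w \<in> tangent_space \<Phi> p"
proof (rule tangent_spaceI)
  fix c d assume cd: "c \<in> charts_at \<Phi> p" "d \<in> charts_at \<Phi> p"
  show "comps (tadd u w) d = J c d (cmap c p) (comps (tadd u w) c)"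
    unfolding tvec_ops comps_change[OF assms(1) cd] comps_change[OF assms(2) cd]
    by (rule linear_add[OF linear_J[OF cd], symmetric])
qed (use base_tangent_space[OF assms(1)] comps_outside[OF assms(1)] comps_outside[OF assms(2)] in simp_all)

lemma tangent_space_tscale [simp, intro]:
  assumes "u \<in> tangent_space \<Phi> p"
  shows "tscale r u \<in> tangent_space \<Phi> p"
proof (rule tangent_spaceI)
  fix c d assume cd: "c \<in> charts_at \<Phi> p" "d \<in> charts_at \<Phi> p"
  show "comps (tscale r u) d = J c d (cmap c p) (comps (tscale r u) c)"
    unfolding tvec_ops comps_change[OF assms(1) cd]
    by (rule linear_scale[OF linear_J[OF cd], symmetric])
qed (use base_tangent_space[OF assms] comps_outside[OF assms] in simp_all)

lemma tangent_space_tzero [simp, intro]: "tzero p \<in> tangent_space \<Phi> p"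
  by (rule tangent_spaceI) (simp_all add: linear_0[OF linear_J])

lemma tvec_of_linear:
  assumes "c \<in> charts_at \<Phi> p"
  shows "tvec_of c p (r *\<^sub>R y + q *\<^sub>R z) = tadd (tscale r (tvec_of c p y)) (tscale q (tvec_of c p z))"
  using assms by (intro tangent_space_eqI[of _ p _ c]) auto

lemma coord_vec_eq: "coord_vec \<Phi> c p i = tvec_of c p (axis i 1)"
  by (simp add: coord_vec_def)

lemma coord_covec_eq: "coord_covec \<Phi> c p i = covec_of c p (axis i 1)"
  by (simp add: coord_covec_def covec_of_def inner_axis' fun_eq_iff)

lemma covec_of_in_cotangent_space [simp, intro]: "covec_of c p \<eta> \<in> cotangent_space \<Phi> p"
  by (auto simp: cotangent_space_def covec_of_def inner_add_right)

lemma covec_of_linear: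
  "covec_of c p (r *\<^sub>R \<eta> + q *\<^sub>R \<zeta>) = (\<lambda>u. r * covec_of c p \<eta> u + q * covec_of c p \<zeta> u)"
  by (auto simp: covec_of_def inner_add_left)

text \<open>A linear functional is determined by its values on the coordinate vectors.\<close>

lemma covec_of_surj:
  assumes "\<theta> \<in> cotangent_space \<Phi> p" "c \<in> charts_at \<Phi> p"
  obtains \<eta> where "\<theta> = covec_of c p \<eta>"
proof
  let ?f = "\<lambda>y. \<theta> (tvec_of c p y)"
  have "linear ?f"
  proof (rule linearI)
    fix y z and r :: real
    have lin: "?f (r *\<^sub>R y + q *\<^sub>R z) = r * ?f y + q * ?f z" for r q y z
      using assms unfolding tvec_of_linear[OF assms(2)] by (simp add: cotangent_space_def)
    show "?f (y + z) = ?f y + ?f z" using lin[of 1 y 1 z] by simp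
    show "?f (r *\<^sub>R y) = r *\<^sub>R ?f y" using lin[of r y 0 y] by simp
  qed
  then have f: "?f y = (\<chi> i. ?f (axis i 1)) \<bullet> y" for y
    by (subst linear_eq_sum_axis) (simp_all add: inner_vec_def mult.commute)
  show "\<theta> = covec_of c p (\<chi> i. ?f (axis i 1))"
  proof
    fix v
    show "\<theta> v = covec_of c p (\<chi> i. ?f (axis i 1)) v"
    proof (cases "v \<in> tangent_space \<Phi> p")
      case True
      then show ?thesis using f[of "comps v c"] assms(2) by (simp add: covec_of_def)
    next
      case False
      then have "\<theta> v = 0" using assms(1) unfolding cotangent_space_def by blast
      with False show ?thesis by (simp add: covec_of_def)
    qed
  qed
qed

section \<open>Functions and vector fields\<close>

lemma vector_fieldsI:
  assumes "\<And>p. X p \<in> tangent_space \<Phi> p"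
    "\<And>c. c \<in> \<Phi> \<Longrightarrow> smooth_on (cmap c ` cdom c) (\<lambda>x. comps (X (cinv c x)) c)"
  shows "X \<in> vector_fields \<Phi>"
  using assms unfolding vector_fields_def by blast

lemma vector_fieldsD:
  assumes "X \<in> vector_fields \<Phi>"
  shows "X p \<in> tangent_space \<Phi> p"
    "c \<in> \<Phi> \<Longrightarrow> smooth_on (cmap c ` cdom c) (\<lambda>x. comps (X (cinv c x)) c)"
  using assms unfolding vector_fields_def by blast+

lemma smooth_funD:
  "smooth_fun \<Phi> f \<Longrightarrow> c \<in> \<Phi> \<Longrightarrow> smooth_on (cmap c ` cdom c) (\<lambda>x. f (cinv c x))"
  unfolding smooth_fun_def comp_def by blast

lemma vector_fields_tadd:
  assumes "X \<in> vector_fields \<Phi>" "Y \<in> vector_fields \<Phi>"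
  shows "(\<lambda>p. tadd (X p) (Y p)) \<in> vector_fields \<Phi>"
proof (rule vector_fieldsI)
  show "tadd (X p) (Y p) \<in> tangent_space \<Phi> p" for p
    using assms by (intro tangent_space_tadd vector_fieldsD)
  show "smooth_on (cmap c ` cdom c) (\<lambda>x. comps (tadd (X (cinv c x)) (Y (cinv c x))) c)" if "c \<in> \<Phi>" for c
    unfolding tvec_ops using assms that by (intro smooth_on_add vector_fieldsD) auto
qed

lemma vector_fields_tscale:
  assumes "X \<in> vector_fields \<Phi>" "smooth_fun \<Phi> f"
  shows "(\<lambda>p. tscale (f p) (X p)) \<in> vector_fields \<Phi>"
proof (rule vector_fieldsI)
  show "tscale (f p) (X p) \<in> tangent_space \<Phi> p" for p
    using assms by (intro tangent_space_tscale vector_fieldsD)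
  show "smooth_on (cmap c ` cdom c) (\<lambda>x. comps (tscale (f (cinv c x)) (X (cinv c x))) c)" if "c \<in> \<Phi>" for c
    unfolding tvec_ops using assms that by (intro smooth_on_scaleR vector_fieldsD smooth_funD) auto
qed

lemma vector_fields_tzero: "tzero \<in> vector_fields \<Phi>"
  by (rule vector_fieldsI) (simp_all add: smooth_on_const)

lemma smooth_fun_const: "smooth_fun \<Phi> (\<lambda>_. r)"
  by (auto simp: smooth_fun_def comp_def intro!: smooth_on_const)

text \<open>The definition picks an arbitrary chart; by the chain rule any other one, in particular the one
  in which the computation takes place, gives the same value.\<close>

lemma dir_deriv_chart:
  assumes f: "smooth_fun \<Phi> f" and u: "u \<in> tangent_space \<Phi> p" and c: "c \<in> charts_at \<Phi> p"
  shows "dir_deriv \<Phi> u f = frechet_derivative (f \<circ> cinv c) (at (cmap c p)) (comps u c)"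
proof -
  define d where "d = (SOME c. c \<in> charts_at \<Phi> p)"
  have d: "d \<in> charts_at \<Phi> p" unfolding d_def using c by (rule someI)
  have p: "c \<in> \<Phi>" "d \<in> \<Phi>" "p \<in> cdom c" "p \<in> cdom d" using c d by (auto simp: charts_at_def)
  have "((f \<circ> cinv c) has_derivative frechet_derivative (f \<circ> cinv c) (at (cmap c p))) (at (cmap c p))"
    using f p by (intro smooth_on_has_derivative[of "cmap c ` cdom c"]) (auto simp: smooth_fun_def)
  then have "((f \<circ> cinv c) \<circ> (cmap c \<circ> cinv d) has_derivative
      frechet_derivative (f \<circ> cinv c) (at (cmap c p)) \<circ> J d c (cmap d p)) (at (cmap d p))"
    using p by (intro diff_chain_at has_derivative_transition[OF d c]) auto
  then have "((f \<circ> cinv d) has_derivative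
      frechet_derivative (f \<circ> cinv c) (at (cmap c p)) \<circ> J d c (cmap d p)) (at (cmap d p))"
    by (rule has_derivative_transform_within_open[of _ _ _ _ "cmap d ` (cdom d \<inter> cdom c)"])
      (use p open_overlap in auto)
  then have "frechet_derivative (f \<circ> cinv d) (at (cmap d p)) =
      frechet_derivative (f \<circ> cinv c) (at (cmap c p)) \<circ> J d c (cmap d p)"
    by (rule frechet_derivative_at[symmetric])
  moreover have "J d c (cmap d p) (comps u d) = comps u c"
    using comps_change[OF u d c] by simp
  ultimately show ?thesis
    using base_tangent_space[OF u] by (simp add: dir_deriv_def Let_def d_def[symmetric])
qed

lemma dir_deriv_const:
  assumes f: "smooth_fun \<Phi> f" and u: "u \<in> tangent_space \<Phi> p"
    and N: "open N" "p \<in> N" "\<And>q. q \<in> N \<Longrightarrow> f q = r"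
  shows "dir_deriv \<Phi> u f = 0"
proof -
  obtain c where c: "c \<in> charts_at \<Phi> p" by (rule chart_around)
  then have p: "c \<in> \<Phi>" "p \<in> cdom c" by (auto simp: charts_at_def)
  have "((f \<circ> cinv c) has_derivative (\<lambda>w. 0)) (at (cmap c p))"
    by (rule has_derivative_transform_within_open[OF has_derivative_const, of "cmap c ` (N \<inter> cdom c)" _ r])
      (use N p open_cmap_image[of c "N \<inter> cdom c"] in auto)
  then have "frechet_derivative (f \<circ> cinv c) (at (cmap c p)) = (\<lambda>w. 0)"
    by (rule frechet_derivative_at[symmetric])
  then show ?thesis using dir_deriv_chart[OF f u c] by simp
qed

text \<open>A coordinate ball is compact, hence closed in the manifold because the manifold is Hausdorff.
  This is what allows functions supported in it to be extended by 0.\<close>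

lemma chart_cutoff:
  assumes c: "c \<in> charts_at \<Phi> p" and N: "open N" "p \<in> N"
  obtains \<beta> K N' where "smooth_on UNIV \<beta>" "closed K" "K \<subseteq> N \<inter> cdom c"
    "open N'" "p \<in> N'" "N' \<subseteq> K" "\<And>q. q \<in> N' \<Longrightarrow> \<beta> (cmap c q) = (1::real)"
    "\<And>q. q \<in> cdom c \<Longrightarrow> q \<notin> K \<Longrightarrow> \<beta> (cmap c q) = 0"
proof -
  have p: "c \<in> \<Phi>" "p \<in> cdom c" using c by (auto simp: charts_at_def)
  let ?x = "cmap c p"
  have "open (cmap c ` (N \<inter> cdom c))" using p N by (intro open_cmap_image) auto
  then obtain e where e: "e > 0" "cball ?x e \<subseteq> cmap c ` (N \<inter> cdom c)"
    using N p open_contains_cball by blast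
  define r where "r = e / 2"
  have r: "r > 0" "cball ?x (2 * r) \<subseteq> cmap c ` (N \<inter> cdom c)" using e by (simp_all add: r_def)
  obtain \<beta> :: "real^'n \<Rightarrow> real" where \<beta>: "smooth_on UNIV \<beta>"
    "\<And>x. norm (x - ?x) \<le> r \<Longrightarrow> \<beta> x = 1" "\<And>x. norm (x - ?x) \<ge> 2 * r \<Longrightarrow> \<beta> x = 0"
    using cutoff_exists[OF r(1)] by blast
  define K where "K = cinv c ` cball ?x (2 * r)"
  define N' where "N' = {q \<in> cdom c. cmap c q \<in> ball ?x r}"
  show thesis
  proof
    have "continuous_on (cball ?x (2 * r)) (cinv c)"
      using r p by (intro continuous_on_subset[OF continuous_on_cinv]) auto
    then show "closed K" unfolding K_def
      by (intro compact_imp_closed compact_continuous_image compact_cball)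
    show "K \<subseteq> N \<inter> cdom c"
    proof
      fix q assume "q \<in> K"
      then obtain x where x: "x \<in> cball ?x (2 * r)" "q = cinv c x" by (auto simp: K_def)
      then obtain q' where "q' \<in> N \<inter> cdom c" "x = cmap c q'" using r by blast
      then show "q \<in> N \<inter> cdom c" using x p by simp
    qed
    have "open (cdom c \<inter> cmap c -` ball ?x r)"
      using p continuous_open_preimage[OF continuous_on_cmap] by blast
    then show "open N'" by (simp add: N'_def vimage_def Collect_conj_eq)
    show "p \<in> N'" using p r by (simp add: N'_def)
    show "N' \<subseteq> K"
    proof
      fix q assume q: "q \<in> N'"
      then have "q = cinv c (cmap c q)" using p by (simp add: N'_def)
      moreover have "cmap c q \<in> cball ?x (2 * r)" using q r by (auto simp: N'_def)
      ultimately show "q \<in> K" unfolding K_def by blast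
    qed
    show "\<beta> (cmap c q) = 1" if "q \<in> N'" for q
      using that by (intro \<beta>(2)) (auto simp: N'_def dist_norm norm_minus_commute)
    show "\<beta> (cmap c q) = 0" if "q \<in> cdom c" "q \<notin> K" for q
    proof (rule \<beta>(3), rule ccontr)
      assume "\<not> 2 * r \<le> norm (cmap c q - ?x)"
      then have "cmap c q \<in> cball ?x (2 * r)" by (simp add: dist_norm norm_minus_commute)
      moreover have "q = cinv c (cmap c q)" using that p by simp
      ultimately show False using that(2) unfolding K_def by blast
    qed
  qed (fact \<beta>(1))
qed

text \<open>Connections act on global objects, so local ones are multiplied by a cutoff function. The extension
  agrees with the given object on a whole neighbourhood, hence also in its derivatives at the
  point.\<close>

lemma local_function_extension:
  fixes h :: "real^'n \<Rightarrow> real"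
  assumes c: "c \<in> charts_at \<Phi> p" and N: "open N" "p \<in> N"
    and h: "smooth_on (cmap c ` cdom c) h"
  obtains f N' where "smooth_fun \<Phi> f" "open N'" "p \<in> N'" "N' \<subseteq> N \<inter> cdom c"
    "\<forall>q\<in>N'. f q = h (cmap c q)" "\<forall>q. q \<notin> N \<longrightarrow> f q = 0"
proof -
  have p: "c \<in> \<Phi>" "p \<in> cdom c" using c by (auto simp: charts_at_def)
  obtain \<beta> K N' where \<beta>: "smooth_on UNIV \<beta>" "closed K" "K \<subseteq> N \<inter> cdom c"
    "open N'" "p \<in> N'" "N' \<subseteq> K" "\<And>q. q \<in> N' \<Longrightarrow> \<beta> (cmap c q) = (1::real)"
    "\<And>q. q \<in> cdom c \<Longrightarrow> q \<notin> K \<Longrightarrow> \<beta> (cmap c q) = 0"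
    using chart_cutoff[OF c N] by blast
  define f where "f = (\<lambda>q. if q \<in> cdom c then \<beta> (cmap c q) * h (cmap c q) else 0)"
  have zero: "f q = 0" if "q \<notin> K" for q using that \<beta>(8) by (simp add: f_def)
  show thesis
  proof
    show "smooth_fun \<Phi> f" unfolding smooth_fun_def
    proof (intro ballI smooth_on_local)
      fix d x assume d: "d \<in> \<Phi>" and "x \<in> cmap d ` cdom d"
      then obtain q where q: "q \<in> cdom d" "x = cmap d q" by blast
      show "\<exists>V. open V \<and> x \<in> V \<and> smooth_on V (f \<circ> cinv d)"
      proof (cases "q \<in> cdom c")
        case True
        let ?V = "cmap d ` (cdom d \<inter> cdom c)"
        have V: "open ?V" using d p open_overlap by blast
        have "smooth_on (cmap c ` cdom c) (\<lambda>x. \<beta> x * h x)"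
          using p smooth_on_subset[OF \<beta>(1)] h by (intro smooth_on_mult) auto
        moreover have "(cmap c \<circ> cinv d) ` ?V \<subseteq> cmap c ` cdom c"
          using transition_image[OF d p(1)] by (rule order_trans) auto
        ultimately have "smooth_on ?V (\<lambda>x. \<beta> ((cmap c \<circ> cinv d) x) * h ((cmap c \<circ> cinv d) x))"
          using smooth_on_compose[OF V open_cmap_cdom[OF p(1)] _ _ smooth_transition[OF d p(1)]]
          by blast
        then have "smooth_on ?V (f \<circ> cinv d)"
          by (rule smooth_on_cong[OF V, rotated]) (use p d in \<open>auto simp: f_def\<close>)
        then show ?thesis using V q True by (intro exI[of _ ?V]) auto
      next
        case False
        let ?V = "cmap d ` (cdom d \<inter> - K)"
        have V: "open ?V" using d \<beta> by (intro open_cmap_image) auto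
        have "smooth_on ?V (f \<circ> cinv d)"
          by (rule smooth_on_cong[OF V _ smooth_on_const[OF V, of 0]]) (use d zero in auto)
        then show ?thesis using V q False \<beta>(3) by (intro exI[of _ ?V]) auto
      qed
    qed (simp add: p)
    show "\<forall>q\<in>N'. f q = h (cmap c q)"
      using \<beta>(3,6,7) by (auto simp: f_def)
    show "\<forall>q. q \<notin> N \<longrightarrow> f q = 0" using zero \<beta>(3) by auto
  qed (use \<beta> in auto)
qed

text \<open>The field is given by its components in one chart; in another chart the Jacobian of the transition map
  enters, which is smooth because the transition map is.\<close>

lemma local_vector_field_extension:
  assumes c: "c \<in> charts_at \<Phi> p" and Y: "smooth_on (cmap c ` cdom c) Y"
  obtains X N where "X \<in> vector_fields \<Phi>" "open N" "p \<in> N" "N \<subseteq> cdom c"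
    "\<forall>q\<in>N. X q = tvec_of c q (Y (cmap c q))"
proof -
  have p: "c \<in> \<Phi>" "p \<in> cdom c" using c by (auto simp: charts_at_def)
  obtain \<beta> K N where \<beta>: "smooth_on UNIV \<beta>" "closed K" "K \<subseteq> UNIV \<inter> cdom c"
    "open N" "p \<in> N" "N \<subseteq> K" "\<And>q. q \<in> N \<Longrightarrow> \<beta> (cmap c q) = (1::real)"
    "\<And>q. q \<in> cdom c \<Longrightarrow> q \<notin> K \<Longrightarrow> \<beta> (cmap c q) = 0"
    using chart_cutoff[OF c open_UNIV UNIV_I] by blast
  define X where "X = (\<lambda>q. if q \<in> cdom c then tvec_of c q (\<beta> (cmap c q) *\<^sub>R Y (cmap c q)) else tzero q)"
  have X_in: "X q \<in> tangent_space \<Phi> q" for q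
    using p by (auto simp: X_def charts_at_def)
  have zero: "comps (X q) d = 0" if "q \<notin> K" for q d
    using that \<beta>(8) p linear_0[OF linear_J] by (auto simp: X_def comps_tvec_of charts_at_def)
  show thesis
  proof
    show "X \<in> vector_fields \<Phi>"
    proof (intro vector_fieldsI X_in smooth_on_local)
      fix d x assume d: "d \<in> \<Phi>" and "x \<in> cmap d ` cdom d"
      then obtain q where q: "q \<in> cdom d" "x = cmap d q" by blast
      show "\<exists>V. open V \<and> x \<in> V \<and> smooth_on V (\<lambda>x. comps (X (cinv d x)) d)"
      proof (cases "q \<in> cdom c")
        case True
        let ?V = "cmap d ` (cdom d \<inter> cdom c)" and ?U = "cmap c ` (cdom c \<inter> cdom d)"
        have V: "open ?V" "open ?U" using d p open_overlap by blast+
        have Y': "smooth_on ?U Y" using Y by (rule smooth_on_subset) auto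
        have "smooth_on ?U (\<lambda>x. \<beta> x *\<^sub>R Y x)"
          using smooth_on_subset[OF \<beta>(1)] by (intro smooth_on_scaleR Y' V) auto
        from smooth_on_frechet_derivative_apply[OF V(2) smooth_transition[OF p(1) d] this]
        have "smooth_on ?U (\<lambda>x. J c d x (\<beta> x *\<^sub>R Y x))" .
        from smooth_on_compose[OF V(1,2) transition_image[OF d p(1)] this smooth_transition[OF d p(1)]]
        have "smooth_on ?V (\<lambda>x. J c d ((cmap c \<circ> cinv d) x)
            (\<beta> ((cmap c \<circ> cinv d) x) *\<^sub>R Y ((cmap c \<circ> cinv d) x)))" .
        then have "smooth_on ?V (\<lambda>x. comps (X (cinv d x)) d)"
          by (rule smooth_on_cong[OF V(1), rotated])
            (use p d in \<open>auto simp: X_def comps_tvec_of charts_at_def\<close>)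
        then show ?thesis using V q True by (intro exI[of _ ?V]) auto
      next
        case False
        let ?V = "cmap d ` (cdom d \<inter> - K)"
        have V: "open ?V" using d \<beta> by (intro open_cmap_image) auto
        have "smooth_on ?V (\<lambda>x. comps (X (cinv d x)) d)"
          by (rule smooth_on_cong[OF V _ smooth_on_const[OF V, of 0]]) (use d zero[of _ d] in auto)
        then show ?thesis using V q False \<beta>(3) by (intro exI[of _ ?V]) auto
      qed
    qed (simp add: p)
    show "\<forall>q\<in>N. X q = tvec_of c q (Y (cmap c q))"
      using \<beta>(3,6,7) by (auto simp: X_def)
  qed (use \<beta> in auto)
qed

text \<open>Coordinate fields have global extensions, so the choice in the definition is a genuine one.\<close>

lemma coord_field_ext:
  assumes c: "c \<in> charts_at \<Phi> p"
  shows "coord_field_ext \<Phi> c i p \<in> vector_fields \<Phi>"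
    and "\<exists>N. open N \<and> p \<in> N \<and> N \<subseteq> cdom c \<and>
      (\<forall>q\<in>N. coord_field_ext \<Phi> c i p q = tvec_of c q (axis i 1))"
proof -
  have sm: "smooth_on (cmap c ` cdom c) (\<lambda>_. axis i 1 :: real^'n)"
    using charts_atD[OF c] by (intro smooth_on_const) auto
  obtain X N where "X \<in> vector_fields \<Phi>" "open N" "p \<in> N" "N \<subseteq> cdom c"
    "\<forall>q\<in>N. X q = tvec_of c q (axis i 1)"
    by (rule local_vector_field_extension[OF c sm])
  then have "\<exists>X. X \<in> vector_fields \<Phi> \<and>
      (\<exists>N. open N \<and> p \<in> N \<and> N \<subseteq> cdom c \<and> (\<forall>q\<in>N. X q = coord_vec \<Phi> c q i))"
    unfolding coord_vec_eq by blast
  from someI_ex[OF this] show "coord_field_ext \<Phi> c i p \<in> vector_fields \<Phi>"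
    and "\<exists>N. open N \<and> p \<in> N \<and> N \<subseteq> cdom c \<and>
      (\<forall>q\<in>N. coord_field_ext \<Phi> c i p q = tvec_of c q (axis i 1))"
    unfolding coord_vec_eq coord_field_ext_def by blast+
qed

end

section \<open>Anisotropic connections in a chart\<close>

locale aniso_conn = manifold \<Phi>
  for \<Phi> :: "('m::{t2_space, second_countable_topology}, 'n::finite) chart set" +
  fixes A :: "('m, 'n) tvec set" and nabla :: "('m, 'n) conn"
  assumes conic: "conic_domain \<Phi> A" and conn: "aniso_connection \<Phi> A nabla"
begin

lemma A_tangent: "v \<in> A \<Longrightarrow> v \<in> tangent_space \<Phi> (base v)"
  using conic unfolding conic_domain_def by blast

lemma open_tcoords_A: "c \<in> \<Phi> \<Longrightarrow> open (tcoords c ` over A c)"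
  using conic unfolding conic_domain_def by blast

lemma of_tcoords_tcoords:
  assumes "v \<in> tangent_space \<Phi> (base v)" "c \<in> charts_at \<Phi> (base v)"
  shows "of_tcoords \<Phi> c (tcoords c v) = v"
  using tvec_of_comps[OF assms] by (simp add: tcoords_def)

lemma tcoords_A_E:
  assumes "z \<in> tcoords c ` over A c" "c \<in> \<Phi>"
  obtains v where "v \<in> A" "c \<in> charts_at \<Phi> (base v)" "z = tcoords c v" "of_tcoords \<Phi> c z = v"
  using assms of_tcoords_tcoords[OF A_tangent] by (auto simp: over_def charts_at_def)

lemma tcoords_A_I: "v \<in> A \<Longrightarrow> c \<in> charts_at \<Phi> (base v) \<Longrightarrow> tcoords c v \<in> tcoords c ` over A c"
  by (auto simp: over_def charts_at_def)

lemma nabla_in: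
  assumes "X \<in> vector_fields \<Phi>" "Y \<in> vector_fields \<Phi>"
  shows "v \<in> A \<Longrightarrow> nabla X Y v \<in> tangent_space \<Phi> (base v)"
    and "c \<in> \<Phi> \<Longrightarrow> smooth_on (tcoords c ` over A c) (\<lambda>z. comps (nabla X Y (of_tcoords \<Phi> c z)) c)"
proof -
  have "nabla X Y \<in> aniso_vector_fields \<Phi> A"
    using conn assms unfolding aniso_connection_def by blast
  then show "v \<in> A \<Longrightarrow> nabla X Y v \<in> tangent_space \<Phi> (base v)"
    and "c \<in> \<Phi> \<Longrightarrow> smooth_on (tcoords c ` over A c) (\<lambda>z. comps (nabla X Y (of_tcoords \<Phi> c z)) c)"
    unfolding aniso_vector_fields_def by blast+
qed

lemma nabla_tadd_right:
  assumes "X \<in> vector_fields \<Phi>" "Y \<in> vector_fields \<Phi>" "Z \<in> vector_fields \<Phi>" "v \<in> A"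
  shows "nabla X (\<lambda>p. tadd (Y p) (Z p)) v = tadd (nabla X Y v) (nabla X Z v)"
  using conn assms unfolding aniso_connection_def by blast

lemma nabla_tadd_left:
  assumes "X \<in> vector_fields \<Phi>" "Y \<in> vector_fields \<Phi>" "Z \<in> vector_fields \<Phi>" "v \<in> A"
  shows "nabla (\<lambda>p. tadd (X p) (Y p)) Z v = tadd (nabla X Z v) (nabla Y Z v)"
  using conn assms unfolding aniso_connection_def by blast

lemma nabla_tscale_right:
  assumes "X \<in> vector_fields \<Phi>" "Y \<in> vector_fields \<Phi>" "smooth_fun \<Phi> f" "v \<in> A"
  shows "nabla X (\<lambda>p. tscale (f p) (Y p)) v =
    tadd (tscale (dir_deriv \<Phi> (X (base v)) f) (Y (base v))) (tscale (f (base v)) (nabla X Y v))"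
  using conn assms unfolding aniso_connection_def by blast

lemma nabla_tscale_left:
  assumes X: "X \<in> vector_fields \<Phi>" and Z: "Z \<in> vector_fields \<Phi>" and f: "smooth_fun \<Phi> f" and v: "v \<in> A"
  shows "nabla (\<lambda>p. tscale (f p) (X p)) Z v = tscale (f (base v)) (nabla X Z v)"
proof -
  have "nabla (\<lambda>p. tadd (tscale (f p) (X p)) (tscale 0 (X p))) Z v =
      tadd (tscale (f (base v)) (nabla X Z v)) (tscale 0 (nabla X Z v))"
    using conn X Z f v smooth_fun_const[of 0] unfolding aniso_connection_def by blast
  moreover have "tadd u (tscale 0 w) = u" for u w :: "('m, 'n) tvec"
    by (simp add: tadd_def tscale_def)
  ultimately show ?thesis by simp
qed

text \<open>Multiplication by a cutoff function that is 1 near the base point changes neither value, by the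
  Leibniz rule, and it makes the two fields equal everywhere.\<close>

lemma cutoff_tscale_eq:
  assumes "Y \<in> vector_fields \<Phi>" "Y' \<in> vector_fields \<Phi>" "\<And>q. q \<in> N \<Longrightarrow> Y q = Y' q"
    "\<And>q. q \<notin> N \<Longrightarrow> f q = 0"
  shows "(\<lambda>q. tscale (f q) (Y q)) = (\<lambda>q. tscale (f q) (Y' q))"
proof
  fix q
  have "base (Y q) = base (Y' q)"
    using base_tangent_space[OF vector_fieldsD(1)] assms(1,2) by simp
  then show "tscale (f q) (Y q) = tscale (f q) (Y' q)"
    using assms(3,4)[of q] by (cases "q \<in> N") (simp_all add: tscale_def)
qed

lemma cutoff_fun:
  assumes "open N" "p \<in> N"
  obtains f N' where "smooth_fun \<Phi> f" "open N'" "p \<in> N'"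
    "\<forall>q\<in>N'. f q = (1::real)" "\<forall>q. q \<notin> N \<longrightarrow> f q = 0"
proof -
  obtain c where c: "c \<in> charts_at \<Phi> p" by (rule chart_around)
  have h: "smooth_on (cmap c ` cdom c) (\<lambda>_. 1::real)"
    using charts_atD[OF c] by (intro smooth_on_const) auto
  show ?thesis
    by (rule local_function_extension[OF c assms h]) (erule that; simp)
qed

lemma nabla_local_right:
  assumes X: "X \<in> vector_fields \<Phi>" and Y: "Y \<in> vector_fields \<Phi>" "Y' \<in> vector_fields \<Phi>" and v: "v \<in> A"
    and N: "open N" "base v \<in> N" "\<And>q. q \<in> N \<Longrightarrow> Y q = Y' q"
  shows "nabla X Y v = nabla X Y' v"
proof -
  obtain f N' where f: "smooth_fun \<Phi> f" "open N'" "base v \<in> N'"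
    "\<forall>q\<in>N'. f q = 1" "\<forall>q. q \<notin> N \<longrightarrow> f q = 0"
    by (rule cutoff_fun[OF N(1,2)])
  have eq: "nabla X (\<lambda>q. tscale (f q) (Z q)) v = nabla X Z v" if Z: "Z \<in> vector_fields \<Phi>" for Z
  proof -
    have "dir_deriv \<Phi> (X (base v)) f = 0"
      by (rule dir_deriv_const[OF f(1) vector_fieldsD(1)[OF X] f(2,3)]) (use f(4) in auto)
    moreover have "base (Z (base v)) = base (nabla X Z v)"
      using base_tangent_space[OF vector_fieldsD(1)[OF Z]] base_tangent_space[OF nabla_in(1)[OF X Z v]]
      by simp
    ultimately show ?thesis
      using nabla_tscale_right[OF X Z f(1) v] f(3,4) by (simp add: tadd_def tscale_def)
  qed
  have "(\<lambda>q. tscale (f q) (Y q)) = (\<lambda>q. tscale (f q) (Y' q))"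
    by (rule cutoff_tscale_eq[OF Y N(3)]) (use f(5) in auto)
  then show ?thesis using eq[OF Y(1)] eq[OF Y(2)] by simp
qed

lemma nabla_local_left:
  assumes X: "X \<in> vector_fields \<Phi>" "X' \<in> vector_fields \<Phi>" and Z: "Z \<in> vector_fields \<Phi>" and v: "v \<in> A"
    and N: "open N" "base v \<in> N" "\<And>q. q \<in> N \<Longrightarrow> X q = X' q"
  shows "nabla X Z v = nabla X' Z v"
proof -
  obtain f N' where f: "smooth_fun \<Phi> f" "open N'" "base v \<in> N'"
    "\<forall>q\<in>N'. f q = 1" "\<forall>q. q \<notin> N \<longrightarrow> f q = 0"
    by (rule cutoff_fun[OF N(1,2)])
  have eq: "nabla (\<lambda>q. tscale (f q) (X q)) Z v = nabla X Z v" if "X \<in> vector_fields \<Phi>" for X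
    using nabla_tscale_left[OF that Z f(1) v] f(3,4) by (simp add: tscale_def)
  have "(\<lambda>q. tscale (f q) (X q)) = (\<lambda>q. tscale (f q) (X' q))"
    by (rule cutoff_tscale_eq[OF X N(3)]) (use f(5) in auto)
  then show ?thesis using eq[OF X(1)] eq[OF X(2)] by simp
qed

text \<open>A combination of vector fields, written in components so that the empty combination is the zero field
  and sums can be built up by induction on the index set.\<close>

definition lincomb :: "('n \<Rightarrow> 'm \<Rightarrow> real) \<Rightarrow> ('n \<Rightarrow> 'm \<Rightarrow> ('m, 'n) tvec) \<Rightarrow> 'n set \<Rightarrow> 'm \<Rightarrow> ('m, 'n) tvec" where
  "lincomb g E F p = (p, \<lambda>d. \<Sum>k\<in>F. g k p *\<^sub>R comps (E k p) d)"

lemma lincomb_empty: "lincomb g E {} = tzero"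
  by (simp add: lincomb_def tzero_def fun_eq_iff)

lemma lincomb_insert:
  assumes "k \<notin> F" "E k \<in> vector_fields \<Phi>"
  shows "lincomb g E (insert k F) = (\<lambda>p. tadd (tscale (g k p) (E k p)) (lincomb g E F p))"
  using assms base_tangent_space[OF vector_fieldsD(1)[OF assms(2)]]
  by (simp add: lincomb_def tadd_def tscale_def fun_eq_iff)

lemma lincomb_in:
  assumes "\<And>k. smooth_fun \<Phi> (g k)" "\<And>k. E k \<in> vector_fields \<Phi>"
  shows "lincomb g E F \<in> vector_fields \<Phi>"
  using finite[of F]
proof (induction F)
  case empty
  show ?case unfolding lincomb_empty by (rule vector_fields_tzero)
next
  case (insert k F)
  then show ?case
    unfolding lincomb_insert[OF insert(2) assms(2)]
    by (intro vector_fields_tadd vector_fields_tscale assms)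
qed

lemma nabla_lincomb_right:
  assumes g: "\<And>k. smooth_fun \<Phi> (g k)" and E: "\<And>k. E k \<in> vector_fields \<Phi>"
    and X: "X \<in> vector_fields \<Phi>" and v: "v \<in> A"
  shows "comps (nabla X (lincomb g E F) v) c =
    (\<Sum>k\<in>F. dir_deriv \<Phi> (X (base v)) (g k) *\<^sub>R comps (E k (base v)) c + g k (base v) *\<^sub>R comps (nabla X (E k) v) c)"
  using finite[of F]
proof (induction F)
  case empty
  have "nabla X (\<lambda>p. tadd (tzero p) (tzero p)) v = tadd (nabla X tzero v) (nabla X tzero v)"
    by (rule nabla_tadd_right[OF X vector_fields_tzero vector_fields_tzero v])
  moreover have "(\<lambda>p. tadd (tzero p) (tzero p)) = (tzero :: 'm \<Rightarrow> ('m, 'n) tvec)"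
    by (simp add: tadd_def tzero_def fun_eq_iff)
  ultimately have "nabla X tzero v = tadd (nabla X tzero v) (nabla X tzero v)" by simp
  from arg_cong[OF this, of "\<lambda>u. comps u c"] show ?case
    by (simp add: lincomb_empty)
next
  case (insert k F)
  then show ?case
    unfolding lincomb_insert[OF insert(2) E] nabla_tadd_right[OF X vector_fields_tscale[OF E g] lincomb_in[OF g E] v]
      nabla_tscale_right[OF X E g v]
    by simp
qed

lemma nabla_lincomb_left:
  assumes g: "\<And>k. smooth_fun \<Phi> (g k)" and E: "\<And>k. E k \<in> vector_fields \<Phi>"
    and Z: "Z \<in> vector_fields \<Phi>" and v: "v \<in> A"
  shows "comps (nabla (lincomb g E F) Z v) c = (\<Sum>k\<in>F. g k (base v) *\<^sub>R comps (nabla (E k) Z v) c)"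
  using finite[of F]
proof (induction F)
  case empty
  have "nabla (\<lambda>p. tadd (tzero p) (tzero p)) Z v = tadd (nabla tzero Z v) (nabla tzero Z v)"
    by (rule nabla_tadd_left[OF vector_fields_tzero vector_fields_tzero Z v])
  moreover have "(\<lambda>p. tadd (tzero p) (tzero p)) = (tzero :: 'm \<Rightarrow> ('m, 'n) tvec)"
    by (simp add: tadd_def tzero_def fun_eq_iff)
  ultimately have "nabla tzero Z v = tadd (nabla tzero Z v) (nabla tzero Z v)" by simp
  from arg_cong[OF this, of "\<lambda>u. comps u c"] show ?case
    by (simp add: lincomb_empty)
next
  case (insert k F)
  then show ?case
    unfolding lincomb_insert[OF insert(2) E] nabla_tadd_left[OF vector_fields_tscale[OF E g] lincomb_in[OF g E] Z v]
      nabla_tscale_left[OF E Z g v]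
    by simp
qed

text \<open>Near a point every field is a combination of the extended coordinate fields with globally defined
  coefficients, to which additivity and the Leibniz rule of the connection apply.\<close>

lemma frame_expansion:
  assumes c: "c \<in> charts_at \<Phi> p" and Y: "Y \<in> vector_fields \<Phi>"
  obtains g N where "\<forall>k. smooth_fun \<Phi> (g k)" "open N" "p \<in> N" "N \<subseteq> cdom c"
    "\<forall>q\<in>N. \<forall>k. g k q = comps (Y q) c $ k"
    "\<forall>q\<in>N. Y q = lincomb g (\<lambda>k. coord_field_ext \<Phi> c k p) UNIV q"
proof -
  have p: "c \<in> \<Phi>" "p \<in> cdom c" using c by (auto simp: charts_at_def)
  let ?E = "\<lambda>k. coord_field_ext \<Phi> c k p"
  have "\<exists>f N. smooth_fun \<Phi> f \<and> open N \<and> p \<in> N \<and> N \<subseteq> cdom c \<and> (\<forall>q\<in>N. f q = comps (Y q) c $ k)" for k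
  proof -
    have h: "smooth_on (cmap c ` cdom c) (\<lambda>x. comps (Y (cinv c x)) c $ k)"
      using p by (intro smooth_on_vec_nth vector_fieldsD(2)[OF Y]) auto
    show ?thesis
    proof (rule local_function_extension[OF c open_UNIV UNIV_I h])
      fix f N
      assume "smooth_fun \<Phi> f" "open N" "p \<in> N" "N \<subseteq> UNIV \<inter> cdom c"
        "\<forall>q\<in>N. f q = comps (Y (cinv c (cmap c q))) c $ k"
      then show ?thesis using p by (intro exI[of _ f] exI[of _ N]) auto
    qed
  qed
  then obtain g N where g: "\<And>k. smooth_fun \<Phi> (g k)" "\<And>k. open (N k)" "\<And>k. p \<in> N k" "\<And>k. N k \<subseteq> cdom c"
    "\<And>k q. q \<in> N k \<Longrightarrow> g k q = comps (Y q) c $ k"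
    by metis
  obtain M where M: "\<And>k. open (M k)" "\<And>k. p \<in> M k" "\<And>k q. q \<in> M k \<Longrightarrow> ?E k q = tvec_of c q (axis k 1)"
    using coord_field_ext(2)[OF c] by metis
  let ?N = "\<Inter>k. N k \<inter> M k"
  have N_cdom: "q \<in> cdom c" if "q \<in> ?N" for q using that g(4) by blast
  show thesis
  proof
    show "open ?N" using g(2) M(1) by (intro open_INT) auto
    show "\<forall>q\<in>?N. Y q = lincomb g ?E UNIV q"
    proof
      fix q assume q: "q \<in> ?N"
      then have cq: "c \<in> charts_at \<Phi> q" using N_cdom p by (auto intro: charts_atI)
      have "comps (lincomb g ?E UNIV q) c = (\<Sum>k\<in>UNIV. comps (Y q) c $ k *\<^sub>R axis k 1)"
        using q g(5) M(3) cq by (simp add: lincomb_def)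
      also have "\<dots> = comps (Y q) c" by (rule vec_eq_sum_axis[symmetric])
      finally show "Y q = lincomb g ?E UNIV q"
        using lincomb_in[OF g(1) coord_field_ext(1)[OF c], where F=UNIV] cq
        by (intro tangent_space_eqI[OF vector_fieldsD(1)[OF Y] vector_fieldsD(1) cq]) auto
    qed
  qed (use g M N_cdom in auto)
qed

text \<open>The Christoffel symbols as a bilinear map. It is not a tensor: see \<open>Gam_transform\<close> for
  its behaviour under a change of charts.\<close>

definition Gam :: "('m, 'n) chart \<Rightarrow> ('m, 'n) tvec \<Rightarrow> real^'n \<Rightarrow> real^'n \<Rightarrow> real^'n" where
  "Gam c v u w = (\<chi> i. \<Sum>j\<in>UNIV. \<Sum>k\<in>UNIV. christoffel \<Phi> nabla c i j k v * (u $ j) * (w $ k))"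

text \<open>The Christoffel symbols are defined by the coordinate fields alone. Near a point every field is a
  combination of these, so that locality and the Leibniz rule give the usual formula for
  arbitrary fields.\<close>

lemma nabla_chart:
  assumes X: "X \<in> vector_fields \<Phi>" and Y: "Y \<in> vector_fields \<Phi>" and v: "v \<in> A"
    and c: "c \<in> charts_at \<Phi> (base v)"
  shows "comps (nabla X Y v) c =
    frechet_derivative (\<lambda>x. comps (Y (cinv c x)) c) (at (cmap c (base v))) (comps (X (base v)) c)
    + Gam c v (comps (X (base v)) c) (comps (Y (base v)) c)"
proof -
  define p where "p = base v"
  have c': "c \<in> charts_at \<Phi> p" using c by (simp add: p_def)
  have p: "c \<in> \<Phi>" "p \<in> cdom c" using c' by (auto simp: charts_at_def)
  let ?E = "\<lambda>k. coord_field_ext \<Phi> c k p" and ?Yc = "\<lambda>x. comps (Y (cinv c x)) c"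
  let ?u = "comps (X p) c" and ?w = "comps (Y p) c"
  have E: "?E k \<in> vector_fields \<Phi>" for k by (rule coord_field_ext(1)[OF c'])
  have Ep: "comps (?E k p) c = axis k 1" for k
    using coord_field_ext(2)[OF c', of k] c' by auto
  (* The expansion of the direction produces no derivatives, that of the differentiated field does. *)
  have left: "comps (nabla X (?E k) v) c = (\<Sum>j\<in>UNIV. ?u $ j *\<^sub>R comps (nabla (?E j) (?E k) v) c)" for k
  proof -
    obtain h M where h: "\<forall>k. smooth_fun \<Phi> (h k)" "open M" "p \<in> M" "M \<subseteq> cdom c"
      "\<forall>q\<in>M. \<forall>k. h k q = comps (X q) c $ k" "\<forall>q\<in>M. X q = lincomb h ?E UNIV q"
      by (rule frame_expansion[OF c' X])
    note h1 = h(1)[rule_format] and h6 = h(6)[rule_format]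
    have "nabla X (?E k) v = nabla (lincomb h ?E UNIV) (?E k) v"
      by (rule nabla_local_left[OF X lincomb_in[OF h1 E] E v h(2) _ h6])
        (use h(3) in \<open>simp_all add: p_def\<close>)
    then show ?thesis
      using nabla_lincomb_left[OF h1 E E v] h(3,5) by (simp add: p_def)
  qed
  obtain g N where g: "\<forall>k. smooth_fun \<Phi> (g k)" "open N" "p \<in> N" "N \<subseteq> cdom c"
    "\<forall>q\<in>N. \<forall>k. g k q = comps (Y q) c $ k" "\<forall>q\<in>N. Y q = lincomb g ?E UNIV q"
    by (rule frame_expansion[OF c' Y])
  note g1 = g(1)[rule_format] and g6 = g(6)[rule_format]
  have dg: "dir_deriv \<Phi> (X p) (g k) = frechet_derivative ?Yc (at (cmap c p)) ?u $ k" for k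
  proof -
    have "(?Yc has_derivative frechet_derivative ?Yc (at (cmap c p))) (at (cmap c p))"
      using p by (intro smooth_on_has_derivative[OF open_cmap_cdom vector_fieldsD(2)[OF Y]]) auto
    from bounded_linear.has_derivative[OF bounded_linear_vec_nth[of k] this]
    have "((g k \<circ> cinv c) has_derivative (\<lambda>h. frechet_derivative ?Yc (at (cmap c p)) h $ k)) (at (cmap c p))"
      by (rule has_derivative_transform_within_open[of _ _ _ _ "cmap c ` N"])
        (use p g open_cmap_image in auto)
    from frechet_derivative_at[OF this]
    have "frechet_derivative (g k \<circ> cinv c) (at (cmap c p)) ?u = frechet_derivative ?Yc (at (cmap c p)) ?u $ k"
      by metis
    then show ?thesis
      using dir_deriv_chart[OF g1 vector_fieldsD(1)[OF X] c'] by simp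
  qed
  have "nabla X Y v = nabla X (lincomb g ?E UNIV) v"
    by (rule nabla_local_right[OF X Y lincomb_in[OF g1 E] v g(2) _ g6])
      (use g(3) in \<open>simp_all add: p_def\<close>)
  then have eq: "comps (nabla X Y v) c =
      (\<Sum>k\<in>UNIV. (frechet_derivative ?Yc (at (cmap c p)) ?u $ k) *\<^sub>R axis k 1 + ?w $ k *\<^sub>R comps (nabla X (?E k) v) c)"
    using nabla_lincomb_right[OF g1 E X v] g(3,5) dg Ep by (simp add: p_def)
  have "comps (nabla X Y v) c $ i =
      (frechet_derivative ?Yc (at (cmap c p)) ?u + Gam c v ?u ?w) $ i" for i
  proof -
    have "comps (nabla X Y v) c $ i = frechet_derivative ?Yc (at (cmap c p)) ?u $ i
      + (\<Sum>k\<in>UNIV. ?w $ k * (\<Sum>j\<in>UNIV. ?u $ j * christoffel \<Phi> nabla c i j k v))"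
      unfolding eq sum.distrib vec_eq_sum_axis[symmetric]
      by (simp add: left[unfolded p_def] christoffel_def p_def)
    also have "(\<Sum>k\<in>UNIV. ?w $ k * (\<Sum>j\<in>UNIV. ?u $ j * christoffel \<Phi> nabla c i j k v)) = Gam c v ?u ?w $ i"
      unfolding Gam_def by (simp add: sum_distrib_left) (subst sum.swap, simp add: mult_ac)
    finally show ?thesis by simp
  qed
  then show ?thesis unfolding p_def[symmetric] by (simp add: vec_eq_iff)
qed

lemma Gam_axis: "Gam c v (axis j 1) (axis k 1) $ i = christoffel \<Phi> nabla c i j k v"
  by (simp add: Gam_def sum_mult_axis)

lemma frechet_derivative_locally_const:
  assumes "open S" "x \<in> S" "\<And>y. y \<in> S \<Longrightarrow> f y = k"
  shows "frechet_derivative f (at x) = (\<lambda>_. 0)"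
  by (rule frechet_derivative_at[symmetric])
    (rule has_derivative_transform_within_open[OF has_derivative_const assms(1,2)], simp add: assms(3))

text \<open>The transformation law of the Christoffel symbols: compare both sides of \<open>nabla_chart\<close>, in the
  two charts, for fields with constant components in one of them.\<close>

lemma Gam_transform:
  assumes v: "v \<in> A" and c: "c \<in> charts_at \<Phi> (base v)" and d: "d \<in> charts_at \<Phi> (base v)"
  defines "x \<equiv> cmap c (base v)"
  shows "Gam d v (J c d x u) (J c d x w) + frechet_derivative (\<lambda>x. J c d x w) (at x) u
    = J c d x (Gam c v u w)"
proof -
  define p where "p = base v"
  have cd: "c \<in> charts_at \<Phi> p" "d \<in> charts_at \<Phi> p" using c d by (auto simp: p_def)
  have p: "c \<in> \<Phi>" "d \<in> \<Phi>" "p \<in> cdom c" "p \<in> cdom d" using cd by (auto simp: charts_at_def)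
  have xp: "x = cmap c p" by (simp add: x_def p_def)
  have const: "smooth_on (cmap c ` cdom c) (\<lambda>_. y)" for y :: "real^'n"
    using p by (intro smooth_on_const) auto
  obtain X M where X: "X \<in> vector_fields \<Phi>" "open M" "p \<in> M" "M \<subseteq> cdom c"
    "\<forall>q\<in>M. X q = tvec_of c q u"
    by (rule local_vector_field_extension[OF cd(1) const])
  obtain Y N where Y: "Y \<in> vector_fields \<Phi>" "open N" "p \<in> N" "N \<subseteq> cdom c"
    "\<forall>q\<in>N. Y q = tvec_of c q w"
    by (rule local_vector_field_extension[OF cd(1) const])
  have chart: "c \<in> charts_at \<Phi> q" if "q \<in> N" for q using that p Y(4) by (auto intro: charts_atI)
  have uw: "comps (X p) c = u" "comps (Y p) c = w" "comps (X p) d = J c d x u" "comps (Y p) d = J c d x w"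
    using X(3,5) Y(3,5) cd by (auto simp: comps_tvec_of xp)
  have "frechet_derivative (\<lambda>x. comps (Y (cinv c x)) c) (at x) = (\<lambda>_. 0)"
  proof (rule frechet_derivative_locally_const)
    show "open (cmap c ` N)" using p Y by (intro open_cmap_image)
    show "comps (Y (cinv c y)) c = w" if "y \<in> cmap c ` N" for y
      using that p Y(4,5) chart by auto
  qed (use Y xp in auto)
  then have c_side: "comps (nabla X Y v) c = Gam c v u w"
    using nabla_chart[OF X(1) Y(1) v c] uw by (simp add: p_def x_def)
  (* In the other chart the components of Y are no longer constant; their derivative is the
     inhomogeneous term. *)
  let ?U = "cmap d ` (N \<inter> cdom d)" and ?H = "\<lambda>y. frechet_derivative (\<lambda>x. J c d x w) (at x) y"
  have dJ: "((\<lambda>x. J c d x w) has_derivative ?H) (at x)"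
    using p by (intro smooth_on_has_derivative[OF open_overlap smooth_on_frechet_derivative[OF open_overlap smooth_transition]])
      (auto simp: xp)
  have "((\<lambda>x. J c d x w) \<circ> (cmap c \<circ> cinv d) has_derivative ?H \<circ> J d c (cmap d p)) (at (cmap d p))"
    using dJ p by (intro diff_chain_at has_derivative_transition[OF cd(2,1)]) (simp add: xp)
  then have "((\<lambda>x. comps (Y (cinv d x)) d) has_derivative ?H \<circ> J d c (cmap d p)) (at (cmap d p))"
  proof (rule has_derivative_transform_within_open)
    show "open ?U" using p Y by (intro open_cmap_image) auto
    fix y assume "y \<in> ?U"
    then obtain q where q: "q \<in> N" "q \<in> cdom d" "y = cmap d q" by blast
    then have "d \<in> charts_at \<Phi> q" using p by (auto intro: charts_atI)
    then show "((\<lambda>x. J c d x w) \<circ> (cmap c \<circ> cinv d)) y = comps (Y (cinv d y)) d"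
      using q p Y(5)[rule_format, OF q(1)] comps_tvec_of[OF chart[OF q(1)], of w d] by simp
  qed (use p Y in auto)
  from fun_cong[OF frechet_derivative_at[OF this], of "J c d x u"]
  have "frechet_derivative (\<lambda>x. comps (Y (cinv d x)) d) (at (cmap d p)) (J c d x u) =
      ?H (J d c (cmap d p) (J c d x u))"
    by simp
  also have "J d c (cmap d p) (J c d x u) = u"
    unfolding xp J_cocycle[OF cd(1,2,1)] J_self[OF cd(1)] ..
  finally have "frechet_derivative (\<lambda>x. comps (Y (cinv d x)) d) (at (cmap d p)) (J c d x u) = ?H u" .
  then have "comps (nabla X Y v) d = ?H u + Gam d v (J c d x u) (J c d x w)"
    using nabla_chart[OF X(1) Y(1) v d] uw by (simp add: p_def)
  moreover have "comps (nabla X Y v) d = J c d x (comps (nabla X Y v) c)"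
    using comps_change[OF nabla_in(1)[OF X(1) Y(1) v] c d] by (simp add: x_def)
  ultimately show ?thesis using c_side by (simp add: add.commute)
qed

text \<open>The extensions of the coordinate fields in the definition of the Christoffel symbols are chosen anew at
  each base point. By locality those chosen at one point serve for all nearby points, and with
  these fixed fields smoothness is part of the definition of a connection.\<close>

lemma smooth_christoffel:
  assumes c: "c \<in> \<Phi>"
  shows "smooth_on (tcoords c ` over A c) (\<lambda>z. christoffel \<Phi> nabla c i j k (of_tcoords \<Phi> c z))"
proof (rule smooth_on_local[OF open_tcoords_A[OF c]])
  fix z0 assume "z0 \<in> tcoords c ` over A c"
  then obtain v0 where v0: "v0 \<in> A" "c \<in> charts_at \<Phi> (base v0)" "z0 = tcoords c v0"
    using c by (rule tcoords_A_E)
  let ?E = "\<lambda>k. coord_field_ext \<Phi> c k (base v0)"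
  have E: "?E k \<in> vector_fields \<Phi>" for k by (rule coord_field_ext(1)[OF v0(2)])
  obtain M where M: "\<And>k. open (M k)" "\<And>k. base v0 \<in> M k" "\<And>k. M k \<subseteq> cdom c"
    "\<And>k q. q \<in> M k \<Longrightarrow> ?E k q = tvec_of c q (axis k 1)"
    using coord_field_ext(2)[OF v0(2)] by metis
  define N where "N = M j \<inter> M k"
  have N: "open N" "base v0 \<in> N" "N \<subseteq> cdom c" using M by (auto simp: N_def)
  let ?V = "tcoords c ` over A c \<inter> (cmap c ` N) \<times> UNIV"
  have V: "open ?V" using c N by (intro open_Int open_Times open_tcoords_A open_cmap_image) auto
  have "smooth_on ?V (\<lambda>z. comps (nabla (?E j) (?E k) (of_tcoords \<Phi> c z)) c $ i)"
    by (intro smooth_on_vec_nth V smooth_on_subset[OF nabla_in(2)[OF E E c]]) auto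
  moreover have "comps (nabla (?E j) (?E k) (of_tcoords \<Phi> c z)) c $ i =
      christoffel \<Phi> nabla c i j k (of_tcoords \<Phi> c z)" if z: "z \<in> ?V" for z
  proof -
    have "z \<in> tcoords c ` over A c" using z by blast
    then obtain v where v: "v \<in> A" "c \<in> charts_at \<Phi> (base v)" "z = tcoords c v" "of_tcoords \<Phi> c z = v"
      using c by (rule tcoords_A_E)
    have "base v \<in> N"
    proof -
      have "cmap c (base v) \<in> cmap c ` N" using z v(3) by (auto simp: tcoords_def)
      then obtain q where "q \<in> N" "cmap c (base v) = cmap c q" by blast
      then show ?thesis using c N(3) charts_atD[OF v(2)] cinv_cmap by (metis subsetD)
    qed
    then have b: "base v \<in> M j" "base v \<in> M k" by (auto simp: N_def)
    have "frechet_derivative (\<lambda>x. comps (?E k (cinv c x)) c) (at (cmap c (base v))) = (\<lambda>_. 0)"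
    proof (rule frechet_derivative_locally_const)
      show "open (cmap c ` M k)" using c M by (intro open_cmap_image)
      show "comps (?E k (cinv c y)) c = axis k 1" if y: "y \<in> cmap c ` M k" for y
      proof -
        obtain q where q: "q \<in> M k" "y = cmap c q" using y by blast
        then have "c \<in> charts_at \<Phi> q" using M(3) c by (auto intro: charts_atI)
        then show ?thesis using q(2) cinv_cmap[of c q] charts_atD[of c q] M(4)[OF q(1)] by simp
      qed
    qed (use b in auto)
    then show ?thesis
      using nabla_chart[OF E[of j] E[of k] v(1,2)] M(4)[OF b(1)] M(4)[OF b(2)] v(2,4) Gam_axis by simp
  qed
  ultimately have "smooth_on ?V (\<lambda>z. christoffel \<Phi> nabla c i j k (of_tcoords \<Phi> c z))"
    by (rule smooth_on_cong[OF V, rotated])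
  then show "\<exists>V. open V \<and> z0 \<in> V \<and> smooth_on V (\<lambda>z. christoffel \<Phi> nabla c i j k (of_tcoords \<Phi> c z))"
    using V v0 N c by (intro exI[of _ ?V]) (auto simp: tcoords_def over_def charts_at_def)
qed

end

section \<open>Ordinary differential equations\<close>

text \<open>The Picard operator is a contraction on the bounded continuous functions on the whole line with
  values in the ball; freezing the time outside the interval makes this space available.\<close>

lemma picard_local_existence:
  fixes F :: "real \<Rightarrow> 'a::banach \<Rightarrow> 'a"
  assumes "a < e0" "R > 0" and cont: "continuous_on ({a..e0} \<times> cball y0 R) (\<lambda>(t, y). F t y)"
    and lip: "\<And>t. t \<in> {a..e0} \<Longrightarrow> L-lipschitz_on (cball y0 R) (F t)"
  obtains e y where "a < e" "e \<le> e0" "y a = y0" "\<forall>t\<in>{a..e}. y t \<in> cball y0 R"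
    "\<forall>t\<in>{a..e}. (y has_vector_derivative F t (y t)) (at t within {a..e})"
proof -
  have "L \<ge> 0" using lip[of a] \<open>a < e0\<close> lipschitz_on_nonneg[of L "cball y0 R" "F a"] by simp
  have "continuous_on {a..e0} (\<lambda>t. case (t, y0) of (t, y) \<Rightarrow> F t y)"
    using \<open>R > 0\<close> by (intro continuous_on_compose2[OF cont] continuous_intros) auto
  then have "compact ((\<lambda>t. F t y0) ` {a..e0})"
    by (intro compact_continuous_image) simp_all
  then obtain C where C: "\<forall>t\<in>{a..e0}. norm (F t y0) \<le> C"
    by (auto dest!: compact_imp_bounded simp: bounded_iff)
  define B where "B = \<bar>C\<bar> + L * R + 1"
  have "B > 0" using \<open>L \<ge> 0\<close> \<open>R > 0\<close> by (simp add: B_def add_nonneg_pos)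
  have B: "norm (F t y) \<le> B" if "t \<in> {a..e0}" "y \<in> cball y0 R" for t y
  proof -
    have "dist (F t y) (F t y0) \<le> L * dist y y0"
      using lip[OF that(1)] that(2) \<open>R > 0\<close> by (intro lipschitz_onD) auto
    also have "\<dots> \<le> L * R" using that(2) \<open>L \<ge> 0\<close> by (intro mult_left_mono) (auto simp: dist_commute)
    finally have "norm (F t y) \<le> norm (F t y0) + L * R"
      using norm_triangle_sub[of "F t y" "F t y0"] by (simp add: dist_norm)
    then show ?thesis using bspec[OF C that(1)] by (simp add: B_def)
  qed
  (* The first bound keeps the image of a curve in the ball, the second makes the operator contract by 1/2. *)
  define \<delta> where "\<delta> = min (R / B) (1 / (2 * (L + 1)))"
  define e where "e = min e0 (a + \<delta>)"
  have "\<delta> > 0" using \<open>R > 0\<close> \<open>B > 0\<close> \<open>L \<ge> 0\<close> by (simp add: \<delta>_def)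
  then have e: "a < e" "e \<le> e0" "e - a \<le> \<delta>" using \<open>a < e0\<close> by (auto simp: e_def)
  have eB: "B * (e - a) \<le> R"
  proof -
    have "B * (e - a) \<le> B * (R / B)"
      using e(3) \<open>B > 0\<close> by (intro mult_left_mono) (auto simp: \<delta>_def)
    then show ?thesis using \<open>B > 0\<close> by simp
  qed
  have eL: "L * (e - a) \<le> 1 / 2"
  proof -
    have "L * (e - a) \<le> (L + 1) * (1 / (2 * (L + 1)))"
      using e \<open>L \<ge> 0\<close> by (intro mult_mono) (auto simp: \<delta>_def)
    also have "\<dots> = 1 / 2" using \<open>L \<ge> 0\<close> by (simp add: divide_simps)
    finally show ?thesis .
  qed
  define c where "c = (\<lambda>t. max a (min e t))"
  have c: "c t \<in> {a..e}" for t using e by (auto simp: c_def)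
  have c_id: "c t = t" if "t \<in> {a..e}" for t using that by (auto simp: c_def)
  have c_cont: "continuous_on UNIV c" unfolding c_def by (intro continuous_intros)
  define S :: "(real \<Rightarrow>\<^sub>C 'a) set" where "S = PiC UNIV (\<lambda>_. cball y0 R)"
  have S: "apply_bcontfun u t \<in> cball y0 R" if "u \<in> S" for u t
    using that by (auto simp: S_def mem_PiC_iff)
  have F_cont: "continuous_on {a..e} (\<lambda>s. F s (apply_bcontfun u s))" if "u \<in> S" for u
  proof -
    have "continuous_on {a..e} (\<lambda>s. case (s, apply_bcontfun u s) of (t, y) \<Rightarrow> F t y)"
      using S[OF that] e by (intro continuous_on_compose2[OF cont] continuous_intros) auto
    then show ?thesis by simp
  qed
  define Q where "Q = (\<lambda>u t. y0 + integral {a..c t} (\<lambda>s. F s (apply_bcontfun u s)))"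
  have Q_ball: "Q u t \<in> cball y0 R" if "u \<in> S" for u t
  proof -
    have "norm (integral {a..c t} (\<lambda>s. F s (apply_bcontfun u s))) \<le> B * (c t - a)"
      using c[of t] e S[OF that] by (intro integral_bound continuous_on_subset[OF F_cont[OF that]] B) auto
    also have "\<dots> \<le> B * (e - a)" using c[of t] \<open>B > 0\<close> by (intro mult_left_mono) auto
    finally show ?thesis using eB by (simp add: Q_def dist_norm)
  qed
  have Q_bcont: "Q u \<in> bcontfun" if "u \<in> S" for u
  proof -
    have "continuous_on {a..e} (\<lambda>t. integral {a..t} (\<lambda>s. F s (apply_bcontfun u s)))"
      using F_cont[OF that] by (intro indefinite_integral_continuous_1 integrable_continuous_real)
    then have "continuous_on UNIV (\<lambda>t. integral {a..c t} (\<lambda>s. F s (apply_bcontfun u s)))"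
      by (rule continuous_on_compose2[OF _ c_cont]) (use c in auto)
    then have "continuous_on UNIV (Q u)"
      unfolding Q_def by (intro continuous_on_add continuous_on_const)
    moreover have "bounded (range (Q u))"
      using Q_ball[OF that] by (intro bounded_subset[OF bounded_cball]) auto
    ultimately show ?thesis by (simp add: bcontfun_def)
  qed
  define P where "P = (\<lambda>u. Bcontfun (Q u))"
  have P: "apply_bcontfun (P u) = Q u" if "u \<in> S" for u
    unfolding P_def by (rule Bcontfun_inverse[OF Q_bcont[OF that]])
  have "\<exists>!u\<in>S. P u = u"
  proof (rule Banach_fix)
    show "complete S"
      unfolding S_def by (intro closed_PiC[THEN complete_eq_closed[THEN iffD2]]) auto
    have "const_bcontfun y0 \<in> S"
      using \<open>R > 0\<close> by (auto simp: S_def mem_PiC_iff const_bcontfun.rep_eq)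
    then show "S \<noteq> {}" by blast
    show "P ` S \<subseteq> S"
      using P Q_ball by (auto simp: S_def mem_PiC_iff)
    show "dist (P u) (P w) \<le> 1 / 2 * dist u w" if uw: "u \<in> S" "w \<in> S" for u w
    proof (rule dist_bound)
      fix t
      let ?f = "\<lambda>u s. F s (apply_bcontfun u s)"
      have sub: "{a..c t} \<subseteq> {a..e}" using c[of t] by auto
      have int: "?f u integrable_on {a..c t}" "?f w integrable_on {a..c t}"
        using integrable_continuous_real[OF continuous_on_subset[OF F_cont sub]] uw by blast+
      have "dist (Q u t) (Q w t) = norm (integral {a..c t} (\<lambda>s. ?f u s - ?f w s))"
        by (simp add: Q_def dist_norm integral_diff[OF int])
      also have "\<dots> \<le> (L * dist u w) * (c t - a)"
      proof (rule integral_bound)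
        show "continuous_on {a..c t} (\<lambda>s. ?f u s - ?f w s)"
          using uw by (intro continuous_on_diff continuous_on_subset[OF F_cont sub])
        show "norm (?f u s - ?f w s) \<le> L * dist u w" if "s \<in> {a..c t}" for s
        proof -
          have "dist (?f u s) (?f w s) \<le> L * dist (apply_bcontfun u s) (apply_bcontfun w s)"
            using lip[of s] that sub e S uw by (intro lipschitz_onD) auto
          also have "\<dots> \<le> L * dist u w" using \<open>L \<ge> 0\<close> by (intro mult_left_mono dist_bounded)
          finally show ?thesis by (simp add: dist_norm)
        qed
      qed (use c[of t] in auto)
      also have "\<dots> \<le> (L * dist u w) * (e - a)"
        using c[of t] \<open>L \<ge> 0\<close> by (intro mult_left_mono) auto
      also have "\<dots> = (L * (e - a)) * dist u w" by simp
      also have "\<dots> \<le> 1 / 2 * dist u w" using eL by (intro mult_right_mono) auto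
      finally show "dist (apply_bcontfun (P u) t) (apply_bcontfun (P w) t) \<le> 1 / 2 * dist u w"
        by (simp add: P uw)
    qed
  qed simp_all
  then obtain u where u: "u \<in> S" "P u = u" by blast
  define y where "y = apply_bcontfun u"
  have y: "y t = y0 + integral {a..t} (\<lambda>s. F s (y s))" if "t \<in> {a..e}" for t
    using fun_cong[OF P[OF u(1)], of t] c_id[OF that] unfolding u(2) by (simp add: y_def Q_def)
  show thesis
  proof (rule that)
    show "y a = y0" using y[of a] e by simp
    show "\<forall>t\<in>{a..e}. y t \<in> cball y0 R" using S[OF u(1)] by (simp add: y_def)
    show "\<forall>t\<in>{a..e}. (y has_vector_derivative F t (y t)) (at t within {a..e})"
    proof
      fix t assume t: "t \<in> {a..e}"
      have "((\<lambda>t. y0 + integral {a..t} (\<lambda>s. F s (y s))) has_vector_derivative 0 + F t (y t)) (at t within {a..e})"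
        using F_cont[OF u(1)] t unfolding y_def
        by (intro has_vector_derivative_add has_vector_derivative_const integral_has_vector_derivative)
      then have "((\<lambda>t. y0 + integral {a..t} (\<lambda>s. F s (y s))) has_vector_derivative F t (y t)) (at t within {a..e})"
        by (simp only: add_0)
      then show "(y has_vector_derivative F t (y t)) (at t within {a..e})"
        by (rule has_vector_derivative_transform[OF t, rotated]) (rule y)
    qed
  qed (use e in auto)
qed

text \<open>The squared distance of the two curves, weighted by an exponential, does not increase. The bound is
  required along the two curves only, and \<open>f\<close>, \<open>g\<close> are just their velocities.\<close>

lemma ode_solutions_coincide:
  fixes u w :: "real \<Rightarrow> 'a::real_inner"
  assumes u: "\<And>t. t \<in> {a..e} \<Longrightarrow> (u has_vector_derivative f t) (at t within {a..e})"
    and w: "\<And>t. t \<in> {a..e} \<Longrightarrow> (w has_vector_derivative g t) (at t within {a..e})"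
    and lip: "\<And>t. t \<in> {a..e} \<Longrightarrow> norm (f t - g t) \<le> L * norm (u t - w t)"
    and "u a = w a" "t \<in> {a..e}"
  shows "u t = w t"
proof -
  define d where "d = (\<lambda>t. (u t - w t) \<bullet> (u t - w t) * exp (- 2 * L * t))"
  have cont: "continuous_on {a..e} u" "continuous_on {a..e} w"
    using u w has_vector_derivative_continuous continuous_on_eq_continuous_within by blast+
  have "d a \<ge> d t"
  proof (rule DERIV_nonpos_imp_decreasing_open[of a t d])
    show "continuous_on {a..t} d"
      unfolding d_def using \<open>t \<in> {a..e}\<close>
      by (intro continuous_intros continuous_on_subset[OF cont(1)] continuous_on_subset[OF cont(2)]) auto
    show "\<exists>y. DERIV d s :> y \<and> y \<le> 0" if s: "a < s" "s < t" for s
    proof -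
      let ?z = "u s - w s" and ?z' = "f s - g s"
      have "at s within {a..e} = at s" using s \<open>t \<in> {a..e}\<close> by (intro at_within_Icc_at) auto
      then have "(u has_vector_derivative f s) (at s)" "(w has_vector_derivative g s) (at s)"
        using u[of s] w[of s] s \<open>t \<in> {a..e}\<close> by auto
      then have "((\<lambda>t. u t - w t) has_derivative (\<lambda>h. h *\<^sub>R ?z')) (at s)"
        using has_vector_derivative_diff[of u "f s" "at s" w "g s"]
        by (simp add: has_vector_derivative_def)
      from has_derivative_inner[OF this this]
      have "((\<lambda>t. (u t - w t) \<bullet> (u t - w t)) has_real_derivative 2 * (?z \<bullet> ?z')) (at s)"
        by (rule has_derivative_imp_has_field_derivative) (simp add: inner_commute algebra_simps)
      moreover have "((\<lambda>t. exp (- 2 * L * t)) has_real_derivative exp (- 2 * L * s) * (- 2 * L)) (at s)"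
        by (auto intro!: derivative_eq_intros)
      ultimately have 1: "DERIV d s :> (?z \<bullet> ?z) * (exp (- 2 * L * s) * (- 2 * L))
          + (2 * (?z \<bullet> ?z')) * exp (- 2 * L * s)"
        unfolding d_def by (rule DERIV_mult[THEN DERIV_cong]) (simp add: mult.commute)
      have "?z \<bullet> ?z' \<le> norm ?z * norm ?z'" by (rule norm_cauchy_schwarz)
      also have "\<dots> \<le> norm ?z * (L * norm ?z)"
        using lip[of s] s \<open>t \<in> {a..e}\<close> by (intro mult_left_mono) auto
      also have "\<dots> = L * (?z \<bullet> ?z)" by (simp add: dot_square_norm power2_eq_square)
      finally have "(?z \<bullet> ?z') * exp (- 2 * L * s) \<le> L * (?z \<bullet> ?z) * exp (- 2 * L * s)"
        by (intro mult_right_mono) auto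
      then have "(?z \<bullet> ?z) * (exp (- 2 * L * s) * (- 2 * L)) + (2 * (?z \<bullet> ?z')) * exp (- 2 * L * s) \<le> 0"
        by (simp add: algebra_simps)
      with 1 show ?thesis by blast
    qed
  qed (use \<open>t \<in> {a..e}\<close> in auto)
  then have "(u t - w t) \<bullet> (u t - w t) * exp (- 2 * L * t) \<le> 0"
    using \<open>u a = w a\<close> by (simp add: d_def)
  then have "(u t - w t) \<bullet> (u t - w t) \<le> 0"
    by (simp add: mult_le_0_iff)
  then show ?thesis
    using inner_ge_zero[of "u t - w t"] by (metis antisym eq_iff_diff_eq_0 inner_eq_zero_iff)
qed

text \<open>The inverse of a fundamental solution solves an equation of its own, hence is obtained together
  with its derivative and without inverting anything: the product of the two solutions has derivative 0.\<close>

lemma fundamental_solution: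
  fixes B :: "real \<Rightarrow> ('a::euclidean_space \<Rightarrow>\<^sub>L 'a)"
  assumes "a < e0" and B: "continuous_on {a..e0} B"
  obtains e M N where "a < e" "e \<le> e0" "M a = id_blinfun" "N a = id_blinfun"
    "\<forall>t\<in>{a..e}. (M has_vector_derivative - (B t o\<^sub>L M t)) (at t within {a..e})"
    "\<forall>t\<in>{a..e}. (N has_vector_derivative N t o\<^sub>L B t) (at t within {a..e})"
    "\<forall>t\<in>{a..e}. N t o\<^sub>L M t = id_blinfun"
proof -
  have "compact (B ` {a..e0})" using B by (intro compact_continuous_image) auto
  then obtain C where "\<forall>t\<in>{a..e0}. norm (B t) \<le> C"
    by (auto dest!: compact_imp_bounded simp: bounded_iff)
  then have C: "norm (B t) \<le> C" if "t \<in> {a..e0}" for t using that by blast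
  have "0 \<le> norm (B a)" by simp
  also have "\<dots> \<le> C" using \<open>a < e0\<close> by (intro C) auto
  finally have "C \<ge> 0" .
  let ?ball = "cball (id_blinfun :: 'a \<Rightarrow>\<^sub>L 'a) 1"
  have B2: "continuous_on ({a..e0} \<times> ?ball) (\<lambda>z. B (fst z))"
    by (rule continuous_on_compose2[OF B]) (auto intro: continuous_intros)
  have le: "norm (P o\<^sub>L Q) \<le> C * norm Q" if "norm P \<le> C" for P Q :: "'a \<Rightarrow>\<^sub>L 'a"
    using norm_blinfun_compose[of P Q] mult_right_mono[OF that norm_ge_zero[of Q]] by linarith
  have ge: "norm (Q o\<^sub>L P) \<le> C * norm Q" if "norm P \<le> C" for P Q :: "'a \<Rightarrow>\<^sub>L 'a"
    using norm_blinfun_compose[of Q P] mult_left_mono[OF that norm_ge_zero[of Q]] by (simp add: mult.commute)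
  have contM: "continuous_on ({a..e0} \<times> ?ball) (\<lambda>(t, M). - (B t o\<^sub>L M))"
    unfolding case_prod_beta
    by (intro continuous_on_minus bounded_bilinear.continuous_on[OF bounded_bilinear_blinfun_compose]
        B2 continuous_on_snd continuous_on_id)
  have lipM: "C-lipschitz_on ?ball (\<lambda>M. - (B t o\<^sub>L M))" if "t \<in> {a..e0}" for t
  proof (rule lipschitz_onI)
    fix P Q :: "'a \<Rightarrow>\<^sub>L 'a"
    have "(B t o\<^sub>L Q) - (B t o\<^sub>L P) = B t o\<^sub>L (Q - P)"
      by (rule bounded_bilinear.diff_right[OF bounded_bilinear_blinfun_compose, symmetric])
    then show "dist (- (B t o\<^sub>L P)) (- (B t o\<^sub>L Q)) \<le> C * dist P Q"
      using le[OF C[OF that], of "Q - P"] by (simp add: dist_norm norm_minus_commute[of P Q])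
  qed (fact \<open>C \<ge> 0\<close>)
  obtain e1 M where M: "a < e1" "e1 \<le> e0" "M a = id_blinfun" "\<forall>t\<in>{a..e1}. M t \<in> ?ball"
    "\<forall>t\<in>{a..e1}. (M has_vector_derivative - (B t o\<^sub>L M t)) (at t within {a..e1})"
    by (rule picard_local_existence[OF \<open>a < e0\<close> zero_less_one contM lipM])
  have contN: "continuous_on ({a..e0} \<times> ?ball) (\<lambda>(t, N). N o\<^sub>L B t)"
    unfolding case_prod_beta
    by (intro bounded_bilinear.continuous_on[OF bounded_bilinear_blinfun_compose]
        B2 continuous_on_snd continuous_on_id)
  have lipN: "C-lipschitz_on ?ball (\<lambda>N. N o\<^sub>L B t)" if "t \<in> {a..e0}" for t
  proof (rule lipschitz_onI)
    fix P Q :: "'a \<Rightarrow>\<^sub>L 'a"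
    have "(P o\<^sub>L B t) - (Q o\<^sub>L B t) = (P - Q) o\<^sub>L B t"
      by (rule bounded_bilinear.diff_left[OF bounded_bilinear_blinfun_compose, symmetric])
    then show "dist (P o\<^sub>L B t) (Q o\<^sub>L B t) \<le> C * dist P Q"
      using ge[OF C[OF that], of "P - Q"] by (simp add: dist_norm)
  qed (fact \<open>C \<ge> 0\<close>)
  obtain e2 N where N: "a < e2" "e2 \<le> e0" "N a = id_blinfun" "\<forall>t\<in>{a..e2}. N t \<in> ?ball"
    "\<forall>t\<in>{a..e2}. (N has_vector_derivative N t o\<^sub>L B t) (at t within {a..e2})"
    by (rule picard_local_existence[OF \<open>a < e0\<close> zero_less_one contN lipN])
  define e where "e = min e1 e2"
  have M': "(M has_vector_derivative - (B t o\<^sub>L M t)) (at t within {a..e})" if "t \<in> {a..e}" for t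
    by (rule has_vector_derivative_within_subset[OF bspec[OF M(5)]]) (use that in \<open>simp_all add: e_def\<close>)
  have N': "(N has_vector_derivative N t o\<^sub>L B t) (at t within {a..e})" if "t \<in> {a..e}" for t
    by (rule has_vector_derivative_within_subset[OF bspec[OF N(5)]]) (use that in \<open>simp_all add: e_def\<close>)
  have der: "((\<lambda>t. N t o\<^sub>L M t) has_vector_derivative 0) (at t within {a..e})" if t: "t \<in> {a..e}" for t
  proof -
    have "((\<lambda>t. N t o\<^sub>L M t) has_vector_derivative (N t o\<^sub>L - (B t o\<^sub>L M t)) + ((N t o\<^sub>L B t) o\<^sub>L M t)) (at t within {a..e})"
      by (rule bounded_bilinear.has_vector_derivative[OF bounded_bilinear_blinfun_compose N'[OF t] M'[OF t]])
    moreover have "(N t o\<^sub>L - (B t o\<^sub>L M t)) + ((N t o\<^sub>L B t) o\<^sub>L M t) = 0"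
      by (rule blinfun_eqI) (simp add: blinfun.bilinear_simps)
    ultimately show ?thesis by simp
  qed
  have "a < e" "e \<le> e0" using M(1,2) N(1,2) by (auto simp: e_def)
  have id: "id_blinfun o\<^sub>L id_blinfun = (id_blinfun :: 'a \<Rightarrow>\<^sub>L 'a)"
    by (rule blinfun_eqI) simp
  have "N t o\<^sub>L M t = id_blinfun" if t: "t \<in> {a..e}" for t
  proof (rule has_vector_derivative_zero_constant[OF _ der])
    fix K assume K: "\<And>t. t \<in> {a..e} \<Longrightarrow> N t o\<^sub>L M t = K"
    have "N a o\<^sub>L M a = K" using \<open>a < e\<close> by (intro K) simp
    then show ?thesis using K[OF t] by (simp add: M(3) N(3) id)
  qed simp_all
  then show thesis
    using \<open>a < e\<close> \<open>e \<le> e0\<close> M(3) N(3) M' N' by (intro that[of e M N]) simp_all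
qed

section \<open>Parallel transport along a curve\<close>

text \<open>This differentiates the components in a second chart of a vector field along a curve. Both the base
  point and the components in the first chart move; expanding the latter in the coordinate
  directions reduces the claim to the product rule.\<close>

lemma has_vector_derivative_frechet_apply:
  fixes \<phi> :: "real^'n \<Rightarrow> 'b::real_normed_vector"
  assumes S: "open S" "smooth_on S \<phi>" and xt: "x t \<in> S" and t: "t \<in> I"
    and x: "(x has_vector_derivative u) (at t within I)"
    and w: "(w has_vector_derivative w') (at t within I)"
  shows "((\<lambda>\<tau>. frechet_derivative \<phi> (at (x \<tau>)) (w \<tau>)) has_vector_derivative
    frechet_derivative (\<lambda>y. frechet_derivative \<phi> (at y) (w t)) (at (x t)) u
    + frechet_derivative \<phi> (at (x t)) w') (at t within I)"
proof -
  let ?d = "\<lambda>y. frechet_derivative \<phi> (at y)"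
  let ?H = "\<lambda>i. frechet_derivative (\<lambda>y. ?d y (axis i 1)) (at (x t))"
  have expand: "?d y z = (\<Sum>i\<in>UNIV. (z $ i) *\<^sub>R ?d y (axis i 1))" if "y \<in> S" for y z
    by (rule linear_eq_sum_axis) (rule linear_frechet_derivative[OF smooth_on_differentiable[OF S that]])
  have H: "((\<lambda>y. ?d y (axis i 1)) has_derivative ?H i) (at (x t))" for i
    by (rule smooth_on_has_derivative[OF S(1) smooth_on_frechet_derivative[OF S] xt])
  have "((\<lambda>y. \<Sum>i\<in>UNIV. (w t $ i) *\<^sub>R ?d y (axis i 1)) has_derivative
      (\<lambda>h. \<Sum>i\<in>UNIV. (w t $ i) *\<^sub>R ?H i h)) (at (x t))"
    by (intro has_derivative_sum has_derivative_scaleR_right H)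
  then have "((\<lambda>y. ?d y (w t)) has_derivative (\<lambda>h. \<Sum>i\<in>UNIV. (w t $ i) *\<^sub>R ?H i h)) (at (x t))"
    by (rule has_derivative_transform_within_open[OF _ S(1) xt]) (rule expand[symmetric])
  from fun_cong[OF frechet_derivative_at[OF this], of u]
  have Hw: "frechet_derivative (\<lambda>y. ?d y (w t)) (at (x t)) u = (\<Sum>i\<in>UNIV. (w t $ i) *\<^sub>R ?H i u)" ..
  have G: "((\<lambda>\<tau>. ?d (x \<tau>) (axis i 1)) has_vector_derivative ?H i u) (at t within I)" for i
    using vector_derivative_diff_chain_within[OF x has_derivative_at_withinI[OF H[of i]]]
    by (simp add: o_def)
  have wi: "((\<lambda>\<tau>. w \<tau> $ i) has_real_derivative w' $ i) (at t within I)" for i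
    using bounded_linear.has_vector_derivative[OF bounded_linear_vec_nth w]
    by (simp add: has_real_derivative_iff_has_vector_derivative)
  have "((\<lambda>\<tau>. \<Sum>i\<in>UNIV. (w \<tau> $ i) *\<^sub>R ?d (x \<tau>) (axis i 1)) has_vector_derivative
      (\<Sum>i\<in>UNIV. (w t $ i) *\<^sub>R ?H i u + (w' $ i) *\<^sub>R ?d (x t) (axis i 1))) (at t within I)"
    by (intro has_vector_derivative_sum has_vector_derivative_scaleR wi G)
  also have "(\<Sum>i\<in>UNIV. (w t $ i) *\<^sub>R ?H i u + (w' $ i) *\<^sub>R ?d (x t) (axis i 1)) =
      frechet_derivative (\<lambda>y. ?d y (w t)) (at (x t)) u + ?d (x t) w'"
    by (simp only: sum.distrib Hw expand[OF xt, of w', symmetric])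
  finally have der: "((\<lambda>\<tau>. \<Sum>i\<in>UNIV. (w \<tau> $ i) *\<^sub>R ?d (x \<tau>) (axis i 1)) has_derivative
      (\<lambda>h. h *\<^sub>R (frechet_derivative (\<lambda>y. ?d y (w t)) (at (x t)) u + ?d (x t) w'))) (at t within I)"
    by (simp only: has_vector_derivative_def)
  have "continuous (at t within I) x" by (rule has_vector_derivative_continuous[OF x])
  then have "\<forall>\<^sub>F \<tau> in at t within I. x \<tau> \<in> S"
    using S(1) xt by (auto simp: continuous_within dest: topological_tendstoD)
  then have "\<forall>\<^sub>F \<tau> in at t within I. (\<Sum>i\<in>UNIV. (w \<tau> $ i) *\<^sub>R ?d (x \<tau>) (axis i 1)) = ?d (x \<tau>) (w \<tau>)"
    by eventually_elim (rule expand[symmetric])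
  from has_derivative_transform_eventually[OF der this expand[OF xt, symmetric] t]
  show ?thesis unfolding has_vector_derivative_def .
qed

locale aniso_curve = aniso_conn \<Phi> A nabla
  for \<Phi> :: "('m::{t2_space, second_countable_topology}, 'n::finite) chart set"
    and A :: "('m, 'n) tvec set" and nabla :: "('m, 'n) conn" +
  fixes a b :: real and \<gamma> :: "real \<Rightarrow> 'm"
  assumes ab: "a < b" and curve: "smooth_curve \<Phi> {a..b} \<gamma>"
begin

abbreviation vel :: "('m, 'n) chart \<Rightarrow> real \<Rightarrow> real^'n" where
  "vel c t \<equiv> comps (velocity \<Phi> {a..b} \<gamma> t) c"

text \<open>Smoothness on a closed interval means extendability, so the curve is handled through a smooth map on
  an open set of times, also at the end points.\<close>

lemma curve_local:
  assumes t: "t \<in> {a..b}" and c: "c \<in> charts_at \<Phi> (\<gamma> t)"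
  obtains V g where "open V" "t \<in> V" "smooth_on V g"
    "\<forall>\<tau>\<in>{a..b} \<inter> V. c \<in> charts_at \<Phi> (\<gamma> \<tau>) \<and> cmap c (\<gamma> \<tau>) = g \<tau>"
proof -
  have c': "c \<in> \<Phi>" "\<gamma> t \<in> cdom c" using c by (auto simp: charts_at_def)
  let ?S = "{t \<in> {a..b}. \<gamma> t \<in> cdom c}"
  have "smooth_on ?S (cmap c \<circ> \<gamma>)" using curve c' unfolding smooth_curve_def by blast
  moreover have "t \<in> ?S" using t c' by blast
  ultimately obtain U g where U: "open U" "t \<in> U" "\<forall>k. Ck_on k U g" "\<forall>y\<in>?S \<inter> U. g y = (cmap c \<circ> \<gamma>) y"
    unfolding smooth_on_def by meson
  have "continuous_on {a..b} \<gamma>" using curve unfolding smooth_curve_def by blast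
  from continuous_openin_preimage_gen[OF this open_cdom[OF c'(1)]]
  obtain W where W: "open W" "{a..b} \<inter> \<gamma> -` cdom c = {a..b} \<inter> W"
    unfolding openin_open by blast
  have mem: "\<gamma> \<tau> \<in> cdom c" if "\<tau> \<in> {a..b}" "\<tau> \<in> W" for \<tau>
  proof -
    have "\<tau> \<in> {a..b} \<inter> \<gamma> -` cdom c" unfolding W(2) using that by simp
    then show ?thesis by simp
  qed
  show thesis
  proof (rule that[of "U \<inter> W" g])
    show "open (U \<inter> W)" using U(1) W(1) by (rule open_Int)
    have "t \<in> {a..b} \<inter> W" unfolding W(2)[symmetric] using t c' by simp
    with U(2) show "t \<in> U \<inter> W" by simp
    have "smooth_on U g" unfolding smooth_on_open_iff[OF U(1)] by (rule U(3))
    then show "smooth_on (U \<inter> W) g" by (rule smooth_on_subset) simp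
    show "\<forall>\<tau>\<in>{a..b} \<inter> (U \<inter> W). c \<in> charts_at \<Phi> (\<gamma> \<tau>) \<and> cmap c (\<gamma> \<tau>) = g \<tau>"
    proof
      fix \<tau> assume "\<tau> \<in> {a..b} \<inter> (U \<inter> W)"
      then show "c \<in> charts_at \<Phi> (\<gamma> \<tau>) \<and> cmap c (\<gamma> \<tau>) = g \<tau>"
        using bspec[OF U(4), of \<tau>] mem[of \<tau>] c'(1) by (simp add: charts_at_def)
    qed
  qed
qed

lemma curve_local_derivative:
  assumes t: "t \<in> {a..b}" and V: "open V" "t \<in> V" "smooth_on V g"
    and g: "\<forall>\<tau>\<in>{a..b} \<inter> V. c \<in> charts_at \<Phi> (\<gamma> \<tau>) \<and> cmap c (\<gamma> \<tau>) = g \<tau>"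
  shows "vel c t = frechet_derivative g (at t) 1"
    and "((\<lambda>\<tau>. cmap c (\<gamma> \<tau>)) has_vector_derivative vel c t) (at t within {a..b})"
proof -
  let ?g' = "frechet_derivative g (at t)"
  have der: "(g has_derivative ?g') (at t)" by (rule smooth_on_has_derivative[OF V(1,3,2)])
  have "?g' = (\<lambda>h. h *\<^sub>R ?g' 1)"
  proof
    show "?g' h = h *\<^sub>R ?g' 1" for h
      using linear_scale[OF has_derivative_linear[OF der], of h 1] by simp
  qed
  with der have "(g has_derivative (\<lambda>h. h *\<^sub>R ?g' 1)) (at t)"
    by (rule has_derivative_eq_rhs)
  then have "(g has_derivative (\<lambda>h. h *\<^sub>R ?g' 1)) (at t within {a..b})"
    by (rule has_derivative_at_withinI)
  moreover have "\<forall>\<^sub>F \<tau> in at t within {a..b}. g \<tau> = cmap c (\<gamma> \<tau>)"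
    unfolding eventually_at_topological using V g by (intro exI[of _ V]) auto
  moreover have "g t = cmap c (\<gamma> t)" using g t V by auto
  ultimately have "((\<lambda>\<tau>. cmap c (\<gamma> \<tau>)) has_derivative (\<lambda>h. h *\<^sub>R ?g' 1)) (at t within {a..b})"
    using t by (rule has_derivative_transform_eventually)
  then have 1: "((\<lambda>\<tau>. cmap c (\<gamma> \<tau>)) has_vector_derivative ?g' 1) (at t within {a..b})"
    by (simp only: has_vector_derivative_def)
  have "vector_derivative (cmap c \<circ> \<gamma>) (at t within {a..b}) = ?g' 1"
    using vector_derivative_within_closed_interval[OF ab t 1] by (simp add: o_def)
  then show 2: "vel c t = ?g' 1"
    using g t V by (simp add: velocity_def)
  show "((\<lambda>\<tau>. cmap c (\<gamma> \<tau>)) has_vector_derivative vel c t) (at t within {a..b})"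
    using 1 unfolding 2 .
qed

lemma curve_has_vector_derivative:
  assumes t: "t \<in> {a..b}" and c: "c \<in> charts_at \<Phi> (\<gamma> t)"
  shows "((\<lambda>\<tau>. cmap c (\<gamma> \<tau>)) has_vector_derivative vel c t) (at t within {a..b})"
proof -
  obtain V g where "open V" "t \<in> V" "smooth_on V g"
    "\<forall>\<tau>\<in>{a..b} \<inter> V. c \<in> charts_at \<Phi> (\<gamma> \<tau>) \<and> cmap c (\<gamma> \<tau>) = g \<tau>"
    by (rule curve_local[OF t c])
  then show ?thesis by (rule curve_local_derivative(2)[OF t])
qed

lemma continuous_vel:
  assumes sub: "I \<subseteq> {a..b}" and c: "\<And>t. t \<in> I \<Longrightarrow> c \<in> charts_at \<Phi> (\<gamma> t)"
  shows "continuous_on I (vel c)" "continuous_on I (\<lambda>t. cmap c (\<gamma> t))"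
proof -
  show "continuous_on I (vel c)"
    unfolding continuous_on_eq_continuous_within
  proof
    fix t assume t: "t \<in> I"
    then have t': "t \<in> {a..b}" using sub by blast
    obtain V g where V: "open V" "t \<in> V" "smooth_on V g"
      "\<forall>\<tau>\<in>{a..b} \<inter> V. c \<in> charts_at \<Phi> (\<gamma> \<tau>) \<and> cmap c (\<gamma> \<tau>) = g \<tau>"
      by (rule curve_local[OF t' c[OF t]])
    have "continuous_on V (\<lambda>\<tau>. frechet_derivative g (at \<tau>) 1)"
      by (rule smooth_on_imp_continuous_on[OF V(1) smooth_on_frechet_derivative[OF V(1,3)]])
    then have "isCont (\<lambda>\<tau>. frechet_derivative g (at \<tau>) 1) t"
      using V(2) by (simp add: continuous_on_eq_continuous_at[OF V(1)])
    then have "((\<lambda>\<tau>. frechet_derivative g (at \<tau>) 1) \<longlongrightarrow> frechet_derivative g (at t) 1) (at t within I)"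
      unfolding isCont_def by (rule tendsto_within_subset) simp
    moreover have "\<forall>\<^sub>F \<tau> in at t within I. frechet_derivative g (at \<tau>) 1 = vel c \<tau>"
      unfolding eventually_at_topological
      using V(1,2) sub curve_local_derivative(1)[OF _ V(1) _ V(3,4)]
      by (intro exI[of _ V]) (auto dest!: subsetD)
    ultimately have "(vel c \<longlongrightarrow> frechet_derivative g (at t) 1) (at t within I)"
      by (rule Lim_transform_eventually)
    then show "continuous (at t within I) (vel c)"
      unfolding continuous_within curve_local_derivative(1)[OF t' V] .
  qed
  show "continuous_on I (\<lambda>t. cmap c (\<gamma> t))"
    unfolding continuous_on_eq_continuous_within
    using sub c curve_has_vector_derivative has_vector_derivative_continuous continuous_within_subset
    by blast
qed

lemma vel_change:
  assumes t: "t \<in> {a..b}" and cd: "c \<in> charts_at \<Phi> (\<gamma> t)" "d \<in> charts_at \<Phi> (\<gamma> t)"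
  shows "vel d t = J c d (cmap c (\<gamma> t)) (vel c t)"
proof -
  have c: "c \<in> \<Phi>" using cd by (auto simp: charts_at_def)
  obtain V g where V: "open V" "t \<in> V" "smooth_on V g"
      "\<forall>\<tau>\<in>{a..b} \<inter> V. c \<in> charts_at \<Phi> (\<gamma> \<tau>) \<and> cmap c (\<gamma> \<tau>) = g \<tau>"
    by (rule curve_local[OF t cd(1)])
  have "((cmap d \<circ> cinv c) \<circ> (\<lambda>\<tau>. cmap c (\<gamma> \<tau>)) has_vector_derivative
      J c d (cmap c (\<gamma> t)) (vel c t)) (at t within {a..b})"
    by (rule vector_derivative_diff_chain_within[OF curve_has_vector_derivative[OF t cd(1)]])
      (rule has_derivative_at_withinI[OF has_derivative_transition[OF cd]])
  then have "((cmap d \<circ> cinv c) \<circ> (\<lambda>\<tau>. cmap c (\<gamma> \<tau>)) has_derivative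
      (\<lambda>h. h *\<^sub>R J c d (cmap c (\<gamma> t)) (vel c t))) (at t within {a..b})"
    by (simp only: has_vector_derivative_def)
  moreover have "\<forall>\<^sub>F \<tau> in at t within {a..b}. ((cmap d \<circ> cinv c) \<circ> (\<lambda>\<tau>. cmap c (\<gamma> \<tau>))) \<tau> = cmap d (\<gamma> \<tau>)"
  proof -
    have "((cmap d \<circ> cinv c) \<circ> (\<lambda>\<tau>. cmap c (\<gamma> \<tau>))) \<tau> = cmap d (\<gamma> \<tau>)"
      if "\<tau> \<in> V" "\<tau> \<in> {a..b}" for \<tau>
    proof -
      have "c \<in> charts_at \<Phi> (\<gamma> \<tau>)" using V(4) that by blast
      then show ?thesis by (simp add: charts_atD)
    qed
    then show ?thesis
      unfolding eventually_at_topological using V(1,2) by blast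
  qed
  moreover have "((cmap d \<circ> cinv c) \<circ> (\<lambda>\<tau>. cmap c (\<gamma> \<tau>))) t = cmap d (\<gamma> t)"
    using cd by (auto simp: charts_at_def)
  ultimately have "((\<lambda>\<tau>. cmap d (\<gamma> \<tau>)) has_derivative (\<lambda>h. h *\<^sub>R J c d (cmap c (\<gamma> t)) (vel c t))) (at t within {a..b})"
    using t by (rule has_derivative_transform_eventually)
  then have "((\<lambda>\<tau>. cmap d (\<gamma> \<tau>)) has_vector_derivative J c d (cmap c (\<gamma> t)) (vel c t)) (at t within {a..b})"
    by (simp only: has_vector_derivative_def)
  then show ?thesis
    using vector_derivative_within_closed_interval[OF ab t] curve_has_vector_derivative[OF t cd(2)] by metis
qed

lemma velocity_subinterval:
  assumes e: "a < e" "e \<le> b" and t: "t \<in> {a..e}" and c: "c \<in> charts_at \<Phi> (\<gamma> t)"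
  shows "comps (velocity \<Phi> {a..e} \<gamma> t) c = vel c t"
proof -
  have "((\<lambda>\<tau>. cmap c (\<gamma> \<tau>)) has_vector_derivative vel c t) (at t within {a..e})"
    using e t by (intro has_vector_derivative_within_subset[OF curve_has_vector_derivative] c) auto
  from vector_derivative_within_closed_interval[OF e(1) t this]
  show ?thesis using c by (simp add: velocity_def o_def)
qed

text \<open>On a nondegenerate interval one-sided derivatives are unique, also at the end points. So the
  velocity on a subinterval is that of the whole curve, and a vanishing covariant
  derivative is a differential equation for the components.\<close>

lemma parallel_along_iff:
  assumes e: "a < e" "e \<le> b"
  shows "parallel_along \<Phi> nabla {a..e} \<gamma> W X \<longleftrightarrow>
    (\<forall>t\<in>{a..e}. X t \<in> tangent_space \<Phi> (\<gamma> t) \<and>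
      (\<forall>c\<in>charts_at \<Phi> (\<gamma> t). ((\<lambda>\<tau>. comps (X \<tau>) c) has_vector_derivative
        - Gam c (W t) (vel c t) (comps (X t) c)) (at t within {a..e})))"
proof -
  have eq: "comps (cov_deriv_along \<Phi> nabla {a..e} \<gamma> W X t) c =
      vector_derivative (\<lambda>\<tau>. comps (X \<tau>) c) (at t within {a..e}) + Gam c (W t) (vel c t) (comps (X t) c)"
    if "t \<in> {a..e}" "c \<in> charts_at \<Phi> (\<gamma> t)" for t c
    using that velocity_subinterval[OF e that] by (simp add: cov_deriv_along_def Gam_def)
  have zero: "cov_deriv_along \<Phi> nabla {a..e} \<gamma> W X t = tzero (\<gamma> t) \<longleftrightarrow>
      (\<forall>c\<in>charts_at \<Phi> (\<gamma> t). comps (cov_deriv_along \<Phi> nabla {a..e} \<gamma> W X t) c = 0)" for t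
    by (auto simp: cov_deriv_along_def tzero_def fun_eq_iff)
  have key: "(\<lambda>\<tau>. comps (X \<tau>) c) differentiable (at t within {a..e}) \<and>
      comps (cov_deriv_along \<Phi> nabla {a..e} \<gamma> W X t) c = 0 \<longleftrightarrow>
      ((\<lambda>\<tau>. comps (X \<tau>) c) has_vector_derivative - Gam c (W t) (vel c t) (comps (X t) c)) (at t within {a..e})"
    (is "?D \<and> ?Z \<longleftrightarrow> ?V") if t: "t \<in> {a..e}" and c: "c \<in> charts_at \<Phi> (\<gamma> t)" for t c
  proof
    assume DZ: "?D \<and> ?Z"
    then have "vector_derivative (\<lambda>\<tau>. comps (X \<tau>) c) (at t within {a..e}) = - Gam c (W t) (vel c t) (comps (X t) c)"
      using eq[OF t c] by (simp add: eq_neg_iff_add_eq_0)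
    moreover have "((\<lambda>\<tau>. comps (X \<tau>) c) has_vector_derivative
        vector_derivative (\<lambda>\<tau>. comps (X \<tau>) c) (at t within {a..e})) (at t within {a..e})"
      using DZ by (simp only: vector_derivative_works)
    ultimately show ?V by (simp only:)
  next
    assume V: ?V
    then have ?D by (rule differentiableI_vector)
    moreover have ?Z
      unfolding eq[OF t c] vector_derivative_within_closed_interval[OF e(1) t V] by simp
    ultimately show "?D \<and> ?Z" ..
  qed
  show ?thesis
    unfolding parallel_along_def field_along_def zero using key by blast
qed

text \<open>Differentiating the change of components produces the second derivative of the transition map, which
  the transformation law of the Christoffel symbols cancels. So a solution constructed in one
  chart is parallel.\<close>

lemma parallel_along_chartI:
  assumes e: "a < e" "e \<le> b"
    and c: "\<And>t. t \<in> {a..e} \<Longrightarrow> c \<in> charts_at \<Phi> (\<gamma> t)"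
    and W: "\<And>t. t \<in> {a..e} \<Longrightarrow> W t \<in> A" "\<And>t. t \<in> {a..e} \<Longrightarrow> base (W t) = \<gamma> t"
    and X: "\<And>t. t \<in> {a..e} \<Longrightarrow> X t \<in> tangent_space \<Phi> (\<gamma> t)"
    and ode: "\<And>t. t \<in> {a..e} \<Longrightarrow> ((\<lambda>\<tau>. comps (X \<tau>) c) has_vector_derivative
      - Gam c (W t) (vel c t) (comps (X t) c)) (at t within {a..e})"
  shows "parallel_along \<Phi> nabla {a..e} \<gamma> W X"
  unfolding parallel_along_iff[OF e]
proof (intro ballI conjI X)
  fix t d assume t: "t \<in> {a..e}" and d: "d \<in> charts_at \<Phi> (\<gamma> t)"
  note ct = c[OF t]
  have cd: "c \<in> \<Phi>" "d \<in> \<Phi>" "\<gamma> t \<in> cdom c" "\<gamma> t \<in> cdom d" using ct d by (auto simp: charts_at_def)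
  have tb: "t \<in> {a..b}" using t e by auto
  have sub: "{a..e} \<subseteq> {a..b}" using e by auto
  let ?x = "\<lambda>\<tau>. cmap c (\<gamma> \<tau>)" and ?w = "\<lambda>\<tau>. comps (X \<tau>) c"
  have "((\<lambda>\<tau>. J c d (?x \<tau>) (?w \<tau>)) has_vector_derivative
      frechet_derivative (\<lambda>y. J c d y (?w t)) (at (?x t)) (vel c t)
      + J c d (?x t) (- Gam c (W t) (vel c t) (?w t))) (at t within {a..e})"
  proof (rule has_vector_derivative_frechet_apply[OF open_overlap smooth_transition])
    show "(?x has_vector_derivative vel c t) (at t within {a..e})"
      by (rule has_vector_derivative_within_subset[OF curve_has_vector_derivative[OF tb ct] sub])
    show "(?w has_vector_derivative - Gam c (W t) (vel c t) (?w t)) (at t within {a..e})"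
      by (rule ode[OF t])
  qed (use cd t in auto)
  also have "frechet_derivative (\<lambda>y. J c d y (?w t)) (at (?x t)) (vel c t)
      + J c d (?x t) (- Gam c (W t) (vel c t) (?w t)) = - Gam d (W t) (vel d t) (comps (X t) d)"
  proof -
    have "Gam d (W t) (J c d (?x t) (vel c t)) (J c d (?x t) (?w t))
        + frechet_derivative (\<lambda>y. J c d y (?w t)) (at (?x t)) (vel c t)
        = J c d (?x t) (Gam c (W t) (vel c t) (?w t))"
      using Gam_transform[OF W(1)[OF t], of c d "vel c t" "?w t"] ct d by (simp add: W(2)[OF t])
    then show ?thesis
      unfolding vel_change[OF tb ct d] comps_change[OF X[OF t] ct d] linear_neg[OF linear_J[OF ct d]]
      by (simp add: algebra_simps)
  qed
  finally have "((\<lambda>\<tau>. J c d (?x \<tau>) (?w \<tau>)) has_derivative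
      (\<lambda>h. h *\<^sub>R (- Gam d (W t) (vel d t) (comps (X t) d)))) (at t within {a..e})"
    by (simp only: has_vector_derivative_def)
  moreover have "\<forall>\<^sub>F \<tau> in at t within {a..e}. J c d (?x \<tau>) (?w \<tau>) = comps (X \<tau>) d"
  proof -
    obtain V g where V: "open V" "t \<in> V" "smooth_on V g"
      "\<forall>\<tau>\<in>{a..b} \<inter> V. d \<in> charts_at \<Phi> (\<gamma> \<tau>) \<and> cmap d (\<gamma> \<tau>) = g \<tau>"
      by (rule curve_local[OF tb d])
    have "J c d (?x \<tau>) (?w \<tau>) = comps (X \<tau>) d" if "\<tau> \<in> V" "\<tau> \<in> {a..e}" for \<tau>
    proof -
      have "d \<in> charts_at \<Phi> (\<gamma> \<tau>)" using V(4) that sub by blast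
      from comps_change[OF X[OF that(2)] c[OF that(2)] this] show ?thesis by (rule sym)
    qed
    then show ?thesis
      unfolding eventually_at_topological using V(1,2) by blast
  qed
  moreover have "J c d (?x t) (?w t) = comps (X t) d"
    by (rule comps_change[OF X[OF t] ct d, symmetric])
  ultimately have "((\<lambda>\<tau>. comps (X \<tau>) d) has_derivative
      (\<lambda>h. h *\<^sub>R (- Gam d (W t) (vel d t) (comps (X t) d)))) (at t within {a..e})"
    using t by (rule has_derivative_transform_eventually)
  then show "((\<lambda>\<tau>. comps (X \<tau>) d) has_vector_derivative
      - Gam d (W t) (vel d t) (comps (X t) d)) (at t within {a..e})"
    by (simp only: has_vector_derivative_def)
qed

end

section \<open>Existence and uniqueness of transport in a chart\<close>

context aniso_conn
begin

lemma smooth_Gam: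
  fixes z :: "'a::euclidean_space \<Rightarrow> (real^'n) \<times> (real^'n)"
  assumes c: "c \<in> \<Phi>" and S: "open S" "smooth_on S z" "z ` S \<subseteq> tcoords c ` over A c"
    and u: "smooth_on S u" and w: "smooth_on S w"
  shows "smooth_on S (\<lambda>q. Gam c (of_tcoords \<Phi> c (z q)) (u q) (w q))"
  unfolding Gam_def
  by (intro smooth_on_vec_lambda smooth_on_sum smooth_on_mult smooth_on_vec_nth u w S(1)
      smooth_on_compose[OF S(1) open_tcoords_A[OF c] S(3) smooth_christoffel[OF c] S(2)])

lemma Gam_linear:
  shows "linear (Gam c v u)"
  by (rule linearI) (simp_all add: Gam_def vec_eq_iff sum.distrib algebra_simps sum_distrib_left)

text \<open>The right-hand sides of the transport equations as one smooth map on an open set of point, reference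
  vector, velocity and transported vector. Its Lipschitz constants on compact sets serve both for the
  existence and for the uniqueness of solutions.\<close>

definition Gam_dom :: "('m, 'n) chart \<Rightarrow> (((real^'n) \<times> (real^'n)) \<times> (real^'n)) \<times> (real^'n) \<Rightarrow> bool" where
  "Gam_dom c q \<longleftrightarrow> fst (fst q) \<in> tcoords c ` over A c"

abbreviation Gam3 :: "('m, 'n) chart \<Rightarrow> (((real^'n) \<times> (real^'n)) \<times> (real^'n)) \<times> (real^'n) \<Rightarrow> real^'n" where
  "Gam3 c q \<equiv> Gam c (of_tcoords \<Phi> c (fst (fst q))) (snd (fst q)) (snd q)"

lemma smooth_Gam3:
  assumes c: "c \<in> \<Phi>"
  shows "open (Collect (Gam_dom c))" "smooth_on (Collect (Gam_dom c)) (Gam3 c)"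
proof -
  have eq: "Collect (Gam_dom c) = (tcoords c ` over A c \<times> UNIV) \<times> UNIV"
    by (auto simp: Gam_dom_def)
  show o: "open (Collect (Gam_dom c))"
    unfolding eq by (intro open_Times open_tcoords_A c open_UNIV)
  note lin = smooth_on_bounded_linear[OF _ o smooth_on_ident[OF o]]
  have f: "bounded_linear (\<lambda>q :: (((real^'n) \<times> (real^'n)) \<times> (real^'n)) \<times> (real^'n). fst (fst q))"
    "bounded_linear (\<lambda>q :: (((real^'n) \<times> (real^'n)) \<times> (real^'n)) \<times> (real^'n). snd (fst q))"
    by (intro bounded_linear_intros)+
  show "smooth_on (Collect (Gam_dom c)) (Gam3 c)"
    by (intro smooth_Gam[OF c o] lin[OF f(1)] lin[OF f(2)] lin[OF bounded_linear_snd])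
      (auto simp: Gam_dom_def)
qed

lemma Gam_lipschitz:
  assumes c: "c \<in> \<Phi>" and K: "compact K" "K \<subseteq> Collect (Gam_dom c)"
  obtains L where "L \<ge> 0" "\<forall>x y u w y' w'. ((((x, y), u), w) \<in> K \<and> (((x, y'), u), w') \<in> K) \<longrightarrow>
    norm (Gam c (of_tcoords \<Phi> c (x, y)) u w - Gam c (of_tcoords \<Phi> c (x, y')) u w')
      \<le> L * (norm (y - y') + norm (w - w'))"
proof -
  obtain L where L: "L-lipschitz_on K (Gam3 c)"
    by (rule smooth_on_lipschitz_on_compact[OF smooth_Gam3[OF c] K])
  have "L \<ge> 0" using L by (rule lipschitz_on_nonneg)
  have "norm (Gam c (of_tcoords \<Phi> c (x, y)) u w - Gam c (of_tcoords \<Phi> c (x, y')) u w')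
      \<le> L * (norm (y - y') + norm (w - w'))"
    if "(((x, y), u), w) \<in> K" "(((x, y'), u), w') \<in> K" for x y u w y' w'
  proof -
    have "dist (Gam3 c (((x, y), u), w)) (Gam3 c (((x, y'), u), w')) \<le>
        L * dist (((x, y), u), w) (((x, y'), u), w')"
      using L that by (rule lipschitz_onD)
    also have "dist (((x, y), u), w) (((x, y'), u), w') = sqrt ((dist y y')\<^sup>2 + (dist w w')\<^sup>2)"
      by (simp add: dist_Pair_Pair)
    also have "L * \<dots> \<le> L * (norm (y - y') + norm (w - w'))"
      unfolding dist_norm using \<open>L \<ge> 0\<close> by (intro mult_left_mono sqrt_sum_squares_le_sum) simp_all
    finally show ?thesis by (simp add: dist_norm)
  qed
  with \<open>L \<ge> 0\<close> show thesis by (intro that[of L]) blast+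
qed

end

context aniso_curve
begin

text \<open>The bound on the distance will keep the curve in a ball on which the Christoffel symbols are
  controlled.\<close>

lemma initial_interval:
  assumes c: "c \<in> charts_at \<Phi> (\<gamma> a)" and "r > 0"
  obtains e where "a < e" "e \<le> b" "\<forall>t\<in>{a..e}. c \<in> charts_at \<Phi> (\<gamma> t)"
    "\<forall>t\<in>{a..e}. dist (cmap c (\<gamma> t)) (cmap c (\<gamma> a)) < r"
proof -
  have a: "a \<in> {a..b}" using ab by simp
  obtain V g where V: "open V" "a \<in> V" "smooth_on V g"
    "\<forall>\<tau>\<in>{a..b} \<inter> V. c \<in> charts_at \<Phi> (\<gamma> \<tau>) \<and> cmap c (\<gamma> \<tau>) = g \<tau>"
    by (rule curve_local[OF a c])
  have "open (V \<inter> g -` ball (g a) r)"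
    by (intro continuous_open_preimage[OF smooth_on_imp_continuous_on] V open_ball)
  moreover have "a \<in> V \<inter> g -` ball (g a) r" using V \<open>r > 0\<close> by simp
  ultimately obtain \<delta> where \<delta>: "\<delta> > 0" "ball a \<delta> \<subseteq> V \<inter> g -` ball (g a) r"
    unfolding open_contains_ball by blast
  define e where "e = min b (a + \<delta> / 2)"
  have e: "a < e" "e \<le> b" using \<delta> ab by (auto simp: e_def)
  have mem: "t \<in> V \<inter> g -` ball (g a) r" "t \<in> {a..b} \<inter> V" if "t \<in> {a..e}" for t
  proof -
    have "t \<in> ball a \<delta>" using that \<delta>(1) by (auto simp: e_def dist_real_def)
    then show "t \<in> V \<inter> g -` ball (g a) r" using \<delta>(2) by blast
    then show "t \<in> {a..b} \<inter> V" using that e by simp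
  qed
  show thesis
  proof (rule that[OF e])
    show "\<forall>t\<in>{a..e}. c \<in> charts_at \<Phi> (\<gamma> t)" using mem(2) V(4) by blast
    show "\<forall>t\<in>{a..e}. dist (cmap c (\<gamma> t)) (cmap c (\<gamma> a)) < r"
    proof
      fix t assume t: "t \<in> {a..e}"
      have "cmap c (\<gamma> t) = g t" "cmap c (\<gamma> a) = g a" using V(4) mem(2)[OF t] mem(2)[of a] e by auto
      then show "dist (cmap c (\<gamma> t)) (cmap c (\<gamma> a)) < r" using mem(1)[OF t] by (simp add: dist_commute)
    qed
  qed
qed

lemma parallel_chart_ode:
  assumes e: "a < e" "e \<le> b" and t1: "t1 \<le> e"
    and c: "\<forall>t\<in>{a..t1}. c \<in> charts_at \<Phi> (\<gamma> t)"
    and X: "parallel_along \<Phi> nabla {a..e} \<gamma> W X" and t: "t \<in> {a..t1}"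
  shows "X t \<in> tangent_space \<Phi> (\<gamma> t)"
    and "((\<lambda>\<tau>. comps (X \<tau>) c) has_vector_derivative - Gam c (W t) (vel c t) (comps (X t) c)) (at t within {a..t1})"
proof -
  have sub: "{a..t1} \<subseteq> {a..e}" using t1 by auto
  note par = X[unfolded parallel_along_iff[OF e], rule_format, OF subsetD[OF sub t]]
  show "X t \<in> tangent_space \<Phi> (\<gamma> t)" using par by blast
  have "c \<in> charts_at \<Phi> (\<gamma> t)" using c t by blast
  then have "((\<lambda>\<tau>. comps (X \<tau>) c) has_vector_derivative - Gam c (W t) (vel c t) (comps (X t) c)) (at t within {a..e})"
    using par by blast
  then show "((\<lambda>\<tau>. comps (X \<tau>) c) has_vector_derivative - Gam c (W t) (vel c t) (comps (X t) c)) (at t within {a..t1})"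
    by (rule has_vector_derivative_within_subset[OF _ sub])
qed

text \<open>One statement covers both the nonlinear equation of the reference vector, in which
  \<open>y\<close> and \<open>w\<close> coincide, and the linear one of an arbitrary vector with given reference \<open>y\<close>.\<close>

lemma Gam_ode_unique:
  assumes t1: "t1 \<le> b" and c: "c \<in> \<Phi>" "\<forall>t\<in>{a..t1}. c \<in> charts_at \<Phi> (\<gamma> t)"
    and y: "continuous_on {a..t1} y1" "continuous_on {a..t1} y2"
      "\<forall>t\<in>{a..t1}. (cmap c (\<gamma> t), y1 t) \<in> tcoords c ` over A c"
      "\<forall>t\<in>{a..t1}. (cmap c (\<gamma> t), y2 t) \<in> tcoords c ` over A c"
    and w: "\<And>t. t \<in> {a..t1} \<Longrightarrow> (w1 has_vector_derivative
        - Gam c (of_tcoords \<Phi> c (cmap c (\<gamma> t), y1 t)) (vel c t) (w1 t)) (at t within {a..t1})"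
      "\<And>t. t \<in> {a..t1} \<Longrightarrow> (w2 has_vector_derivative
        - Gam c (of_tcoords \<Phi> c (cmap c (\<gamma> t), y2 t)) (vel c t) (w2 t)) (at t within {a..t1})"
    and init: "w1 a = w2 a" and ref: "\<forall>t\<in>{a..t1}. y1 t = y2 t \<or> (y1 t = w1 t \<and> y2 t = w2 t)"
    and t: "t \<in> {a..t1}"
  shows "w1 t = w2 t"
proof -
  let ?x = "\<lambda>t. cmap c (\<gamma> t)"
  let ?q1 = "\<lambda>t. (((?x t, y1 t), vel c t), w1 t)" and ?q2 = "\<lambda>t. (((?x t, y2 t), vel c t), w2 t)"
  have sub: "{a..t1} \<subseteq> {a..b}" using t1 by auto
  have cx: "continuous_on {a..t1} (vel c)" "continuous_on {a..t1} ?x"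
    by (rule continuous_vel[OF sub], use c in blast)+
  have cw: "continuous_on {a..t1} w1" "continuous_on {a..t1} w2"
    unfolding continuous_on_eq_continuous_within
    using has_vector_derivative_continuous[OF w(1)] has_vector_derivative_continuous[OF w(2)] by blast+
  define K where "K = ?q1 ` {a..t1} \<union> ?q2 ` {a..t1}"
  have "compact K" unfolding K_def
    by (intro compact_Un compact_continuous_image continuous_on_Pair cx cw y(1,2)) auto
  moreover have "K \<subseteq> Collect (Gam_dom c)"
    using y(3,4) by (auto simp: K_def Gam_dom_def)
  ultimately obtain L where L: "L \<ge> 0" "\<forall>x y u w y' w'. ((((x, y), u), w) \<in> K \<and> (((x, y'), u), w') \<in> K) \<longrightarrow>
      norm (Gam c (of_tcoords \<Phi> c (x, y)) u w - Gam c (of_tcoords \<Phi> c (x, y')) u w')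
        \<le> L * (norm (y - y') + norm (w - w'))"
    by (rule Gam_lipschitz[OF c(1)])
  show ?thesis
  proof (rule ode_solutions_coincide[OF w _ init t])
    fix s assume s: "s \<in> {a..t1}"
    let ?G1 = "Gam c (of_tcoords \<Phi> c (?x s, y1 s)) (vel c s) (w1 s)"
      and ?G2 = "Gam c (of_tcoords \<Phi> c (?x s, y2 s)) (vel c s) (w2 s)"
    have "?q1 s \<in> K" "?q2 s \<in> K" using s unfolding K_def by blast+
    then have le: "norm (?G1 - ?G2) \<le> L * (norm (y1 s - y2 s) + norm (w1 s - w2 s))"
      using L(2) by blast
    have "norm (y1 s - y2 s) \<le> norm (w1 s - w2 s)" using bspec[OF ref s] by auto
    then have "L * (norm (y1 s - y2 s) + norm (w1 s - w2 s)) \<le> L * (norm (w1 s - w2 s) + norm (w1 s - w2 s))"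
      using L(1) by (intro mult_left_mono) auto
    with le have "norm (?G1 - ?G2) \<le> (2 * L) * norm (w1 s - w2 s)" by simp
    then show "norm (- ?G1 - - ?G2) \<le> (2 * L) * norm (w1 s - w2 s)"
      by (simp add: norm_minus_commute)
  qed
qed

lemma A_in_tcoords:
  assumes "v \<in> A" "base v = p" "c \<in> charts_at \<Phi> p"
  shows "(cmap c p, comps v c) \<in> tcoords c ` over A c"
  using tcoords_A_I[OF assms(1)] assms(2,3) by (auto simp: tcoords_def)

lemma autoparallel_unique:
  assumes e: "a < e1" "e1 \<le> b" "a < e2" "e2 \<le> b" and t1: "a \<le> t1" "t1 \<le> e1" "t1 \<le> e2"
    and c: "\<forall>t\<in>{a..t1}. c \<in> charts_at \<Phi> (\<gamma> t)"
    and V1: "autoparallel_from \<Phi> A nabla a e1 \<gamma> v V1" and V2: "autoparallel_from \<Phi> A nabla a e2 \<gamma> v V2"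
    and t: "t \<in> {a..t1}"
  shows "V1 t = V2 t"
proof -
  have cPhi: "c \<in> \<Phi>" using c t1 by (auto simp: charts_at_def)
  have par: "parallel_along \<Phi> nabla {a..e1} \<gamma> V1 V1" "parallel_along \<Phi> nabla {a..e2} \<gamma> V2 V2"
    and init: "V1 a = v" "V2 a = v"
    using V1 V2 unfolding autoparallel_from_def by blast+
  have inA: "V1 s \<in> A" "V2 s \<in> A" if "s \<in> {a..t1}" for s
    using V1 V2 that t1 unfolding autoparallel_from_def by auto
  note ode1 = parallel_chart_ode[OF e(1,2) t1(2) c par(1)] and ode2 = parallel_chart_ode[OF e(3,4) t1(3) c par(2)]
  have eq: "of_tcoords \<Phi> c (cmap c (\<gamma> s), comps (V1 s) c) = V1 s"
    "of_tcoords \<Phi> c (cmap c (\<gamma> s), comps (V2 s) c) = V2 s" if "s \<in> {a..t1}" for s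
    using tvec_of_comps[OF ode1(1)[OF that]] tvec_of_comps[OF ode2(1)[OF that]] c that by blast+
  have cont: "continuous_on {a..t1} (\<lambda>s. comps (V1 s) c)" "continuous_on {a..t1} (\<lambda>s. comps (V2 s) c)"
    unfolding continuous_on_eq_continuous_within
    using has_vector_derivative_continuous[OF ode1(2)] has_vector_derivative_continuous[OF ode2(2)] by blast+
  have "comps (V1 t) c = comps (V2 t) c"
  proof (rule Gam_ode_unique[OF _ cPhi c cont _ _ _ _ _ _ t])
    show "\<forall>t\<in>{a..t1}. (cmap c (\<gamma> t), comps (V1 t) c) \<in> tcoords c ` over A c"
      "\<forall>t\<in>{a..t1}. (cmap c (\<gamma> t), comps (V2 t) c) \<in> tcoords c ` over A c"
      using A_in_tcoords[OF inA(1) base_tangent_space[OF ode1(1)]]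
        A_in_tcoords[OF inA(2) base_tangent_space[OF ode2(1)]] c by blast+
    fix s assume s: "s \<in> {a..t1}"
    show "((\<lambda>s. comps (V1 s) c) has_vector_derivative
        - Gam c (of_tcoords \<Phi> c (cmap c (\<gamma> s), comps (V1 s) c)) (vel c s) (comps (V1 s) c)) (at s within {a..t1})"
      unfolding eq[OF s] by (rule ode1(2)[OF s])
    show "((\<lambda>s. comps (V2 s) c) has_vector_derivative
        - Gam c (of_tcoords \<Phi> c (cmap c (\<gamma> s), comps (V2 s) c)) (vel c s) (comps (V2 s) c)) (at s within {a..t1})"
      unfolding eq[OF s] by (rule ode2(2)[OF s])
  qed (use e t1 init in auto)
  then show ?thesis
    using tangent_space_eqI[OF ode1(1)[OF t] ode2(1)[OF t]] c t by blast
qed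

text \<open>The reference vectors of the two fields agree by the previous lemma, so that both fields solve the
  same linear equation.\<close>

lemma parallel_unique:
  assumes e: "a < e1" "e1 \<le> b" "a < e2" "e2 \<le> b" and t1: "a \<le> t1" "t1 \<le> e1" "t1 \<le> e2"
    and c: "\<forall>t\<in>{a..t1}. c \<in> charts_at \<Phi> (\<gamma> t)"
    and V1: "autoparallel_from \<Phi> A nabla a e1 \<gamma> v V1" and V2: "autoparallel_from \<Phi> A nabla a e2 \<gamma> v V2"
    and X: "parallel_along \<Phi> nabla {a..e1} \<gamma> V1 X1" "parallel_along \<Phi> nabla {a..e2} \<gamma> V2 X2" "X1 a = X2 a"
    and t: "t \<in> {a..t1}"
  shows "X1 t = X2 t"
proof -
  have cPhi: "c \<in> \<Phi>" using c t1 by (auto simp: charts_at_def)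
  have par: "parallel_along \<Phi> nabla {a..e1} \<gamma> V1 V1"
    using V1 unfolding autoparallel_from_def by blast
  have inA: "V1 s \<in> A" if "s \<in> {a..t1}" for s
    using V1 that t1 unfolding autoparallel_from_def by auto
  have V12: "V2 s = V1 s" if "s \<in> {a..t1}" for s
    by (rule autoparallel_unique[OF e t1 c V1 V2 that, symmetric])
  note odeV = parallel_chart_ode[OF e(1,2) t1(2) c par]
  note ode1 = parallel_chart_ode[OF e(1,2) t1(2) c X(1)] and ode2 = parallel_chart_ode[OF e(3,4) t1(3) c X(2)]
  have eq: "of_tcoords \<Phi> c (cmap c (\<gamma> s), comps (V1 s) c) = V1 s" if "s \<in> {a..t1}" for s
    using tvec_of_comps[OF odeV(1)[OF that]] c that by blast
  have eq2: "of_tcoords \<Phi> c (cmap c (\<gamma> s), comps (V1 s) c) = V2 s" if "s \<in> {a..t1}" for s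
    using eq[OF that] V12[OF that] by (simp only:)
  have cont: "continuous_on {a..t1} (\<lambda>s. comps (V1 s) c)"
    unfolding continuous_on_eq_continuous_within
    using has_vector_derivative_continuous[OF odeV(2)] by blast
  have A: "\<forall>t\<in>{a..t1}. (cmap c (\<gamma> t), comps (V1 t) c) \<in> tcoords c ` over A c"
    using A_in_tcoords[OF inA base_tangent_space[OF odeV(1)]] c by blast
  have "comps (X1 t) c = comps (X2 t) c"
  proof (rule Gam_ode_unique[OF _ cPhi c cont cont A A _ _ _ _ t])
    fix s assume s: "s \<in> {a..t1}"
    show "((\<lambda>s. comps (X1 s) c) has_vector_derivative
        - Gam c (of_tcoords \<Phi> c (cmap c (\<gamma> s), comps (V1 s) c)) (vel c s) (comps (X1 s) c)) (at s within {a..t1})"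
      unfolding eq[OF s] by (rule ode1(2)[OF s])
    show "((\<lambda>s. comps (X2 s) c) has_vector_derivative
        - Gam c (of_tcoords \<Phi> c (cmap c (\<gamma> s), comps (V1 s) c)) (vel c s) (comps (X2 s) c)) (at s within {a..t1})"
      unfolding eq2[OF s] by (rule ode2(2)[OF s])
  qed (use e t1 X(3) in auto)
  then show ?thesis
    using tangent_space_eqI[OF ode1(1)[OF t] ode2(1)[OF t]] c t by blast
qed

text \<open>The map is smooth near the initial value, hence Lipschitz on a compact neighbourhood of it, and the
  Picard theorem applies.\<close>

lemma local_autoparallel:
  assumes v: "v \<in> A" "base v = \<gamma> a" and c: "c \<in> charts_at \<Phi> (\<gamma> a)"
  obtains e y where "a < e" "e \<le> b" "\<forall>t\<in>{a..e}. c \<in> charts_at \<Phi> (\<gamma> t)" "y a = comps v c"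
    "\<forall>t\<in>{a..e}. (cmap c (\<gamma> t), y t) \<in> tcoords c ` over A c"
    "\<forall>t\<in>{a..e}. (y has_vector_derivative
      - Gam c (of_tcoords \<Phi> c (cmap c (\<gamma> t), y t)) (vel c t) (y t)) (at t within {a..e})"
proof -
  have cPhi: "c \<in> \<Phi>" using c by (auto simp: charts_at_def)
  let ?x = "\<lambda>t. cmap c (\<gamma> t)" and ?y0 = "comps v c" and ?O = "tcoords c ` over A c"
  have "(?x a, ?y0) \<in> ?O" using A_in_tcoords[OF v c] .
  then obtain \<rho> where \<rho>: "\<rho> > 0" "cball (?x a, ?y0) \<rho> \<subseteq> ?O"
    using open_tcoords_A[OF cPhi] unfolding open_contains_cball by blast
  (* One half of the radius is for the base point, the other one for the vector. *)
  define r where "r = \<rho> / 2"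
  have r: "r > 0" using \<rho> by (simp add: r_def)
  obtain e1 where e1: "a < e1" "e1 \<le> b" "\<forall>t\<in>{a..e1}. c \<in> charts_at \<Phi> (\<gamma> t)"
    "\<forall>t\<in>{a..e1}. dist (?x t) (?x a) < r"
    by (rule initial_interval[OF c r])
  have sub: "{a..e1} \<subseteq> {a..b}" using e1 by auto
  have cx: "continuous_on {a..e1} (vel c)" "continuous_on {a..e1} ?x"
    by (rule continuous_vel[OF sub], use e1 in blast)+
  let ?q = "\<lambda>(t, y). (((?x t, y), vel c t), y)"
  have dom: "(?x t, y) \<in> ?O" if "t \<in> {a..e1}" "y \<in> cball ?y0 r" for t y
  proof -
    have "dist (?x a, ?y0) (?x t, y) \<le> dist (?x a) (?x t) + dist ?y0 y"
      unfolding dist_Pair_Pair by (rule sqrt_sum_squares_le_sum) auto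
    also have "\<dots> \<le> r + r"
    proof (rule add_mono)
      show "dist (?x a) (?x t) \<le> r" using bspec[OF e1(4) that(1)] by (simp add: dist_commute)
      show "dist ?y0 y \<le> r" using that(2) by simp
    qed
    also have "\<dots> = \<rho>" by (simp add: r_def)
    finally show ?thesis using \<rho>(2) by (auto simp: subset_iff)
  qed
  have cq: "continuous_on ({a..e1} \<times> cball ?y0 r) ?q"
    unfolding case_prod_beta
    by (intro continuous_on_Pair continuous_on_compose2[OF cx(1)] continuous_on_compose2[OF cx(2)]
        continuous_on_fst continuous_on_snd continuous_on_id) auto
  define K where "K = ?q ` ({a..e1} \<times> cball ?y0 r)"
  have "compact K" unfolding K_def by (intro compact_continuous_image cq compact_Times compact_cball) simp
  moreover have KD: "K \<subseteq> Collect (Gam_dom c)"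
    using dom by (auto simp: K_def Gam_dom_def)
  ultimately obtain L where L: "L \<ge> 0" "\<forall>x y u w y' w'. ((((x, y), u), w) \<in> K \<and> (((x, y'), u), w') \<in> K) \<longrightarrow>
      norm (Gam c (of_tcoords \<Phi> c (x, y)) u w - Gam c (of_tcoords \<Phi> c (x, y')) u w')
        \<le> L * (norm (y - y') + norm (w - w'))"
    by (rule Gam_lipschitz[OF cPhi])
  let ?F = "\<lambda>t y. - Gam c (of_tcoords \<Phi> c (?x t, y)) (vel c t) y"
  have "continuous_on ({a..e1} \<times> cball ?y0 r) (\<lambda>p. Gam3 c (?q p))"
    by (rule continuous_on_compose2[OF smooth_on_imp_continuous_on[OF smooth_Gam3[OF cPhi]] cq])
      (use KD in \<open>simp add: K_def\<close>)
  then have contF: "continuous_on ({a..e1} \<times> cball ?y0 r) (\<lambda>(t, y). ?F t y)"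
    unfolding case_prod_beta by (intro continuous_on_minus) simp
  have lipF: "(2 * L)-lipschitz_on (cball ?y0 r) (?F t)" if t: "t \<in> {a..e1}" for t
  proof (rule lipschitz_onI)
    fix y y' assume yy: "y \<in> cball ?y0 r" "y' \<in> cball ?y0 r"
    have K: "(((?x t, y), vel c t), y) \<in> K" if "y \<in> cball ?y0 r" for y
      unfolding K_def by (rule image_eqI[of _ _ "(t, y)"]) (use t that in auto)
    have "norm (Gam c (of_tcoords \<Phi> c (?x t, y)) (vel c t) y - Gam c (of_tcoords \<Phi> c (?x t, y')) (vel c t) y')
        \<le> L * (norm (y - y') + norm (y - y'))"
      using L(2) K[OF yy(1)] K[OF yy(2)] by blast
    then show "dist (?F t y) (?F t y') \<le> 2 * L * dist y y'"
      by (simp add: dist_norm norm_minus_commute)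
  qed (use L in auto)
  obtain e y where y: "a < e" "e \<le> e1" "y a = ?y0" "\<forall>t\<in>{a..e}. y t \<in> cball ?y0 r"
    "\<forall>t\<in>{a..e}. (y has_vector_derivative ?F t (y t)) (at t within {a..e})"
    by (rule picard_local_existence[OF e1(1) r contF lipF])
  show thesis
  proof (rule that[OF y(1) _ _ y(3) _ y(5)])
    show "e \<le> b" using y e1 by simp
    show "\<forall>t\<in>{a..e}. c \<in> charts_at \<Phi> (\<gamma> t)" using e1(3) y(2) by simp
    show "\<forall>t\<in>{a..e}. (?x t, y t) \<in> ?O" using dom y(2,4) by simp
  qed
qed

text \<open>The definite descriptions in the definitions of the two transports are resolved here: the solution
  constructed in the chart is one candidate, and uniqueness in the chart excludes any other, on
  whatever interval it lives. The fundamental solution \<open>M\<close> serves all transported vectors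
  at once, so that a single interval suffices. Of the differential equations only the initial
  derivatives are recorded, since the transported tensor is differentiated at \<open>a\<close> only.\<close>

lemma transport_in_chart:
  assumes v: "v \<in> A" "base v = \<gamma> a" and c: "c \<in> charts_at \<Phi> (\<gamma> a)"
  obtains e y M N where "a < e" "e \<le> b" "\<forall>t\<in>{a..e}. c \<in> charts_at \<Phi> (\<gamma> t)" "y a = comps v c"
    "\<forall>t\<in>{a..e}. (cmap c (\<gamma> t), y t) \<in> tcoords c ` over A c"
    "(y has_vector_derivative - Gam c v (vel c a) (comps v c)) (at a within {a..b})"
    "M a = id_blinfun" "N a = id_blinfun"
    "(M has_vector_derivative - Blinfun (Gam c v (vel c a))) (at a within {a..b})"
    "(N has_vector_derivative Blinfun (Gam c v (vel c a))) (at a within {a..b})"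
    "\<forall>t\<in>{a..e}. \<forall>w. blinfun_apply (N t) (blinfun_apply (M t) w) = w"
    "\<forall>t\<in>{a..e}. transport \<Phi> A nabla a b \<gamma> t v = tvec_of c (\<gamma> t) (y t)"
    "\<forall>t\<in>{a..e}. \<forall>w. lin_transport \<Phi> A nabla a b \<gamma> t v (tvec_of c (\<gamma> a) w) = tvec_of c (\<gamma> t) (blinfun_apply (M t) w)"
proof -
  have cPhi: "c \<in> \<Phi>" using c by (auto simp: charts_at_def)
  let ?x = "\<lambda>t. cmap c (\<gamma> t)" and ?O = "tcoords c ` over A c"
  obtain e0 y where y: "a < e0" "e0 \<le> b" "\<forall>t\<in>{a..e0}. c \<in> charts_at \<Phi> (\<gamma> t)" "y a = comps v c"
    "\<forall>t\<in>{a..e0}. (?x t, y t) \<in> ?O"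
    "\<forall>t\<in>{a..e0}. (y has_vector_derivative - Gam c (of_tcoords \<Phi> c (?x t, y t)) (vel c t) (y t)) (at t within {a..e0})"
    by (rule local_autoparallel[OF v c])
  define V where "V = (\<lambda>t. tvec_of c (\<gamma> t) (y t))"
  have Va: "V a = v" unfolding V_def y(4) using tvec_of_comps[OF A_tangent[OF v(1)]] v(2) c by simp
  have V: "V t \<in> A" "base (V t) = \<gamma> t" "V t \<in> tangent_space \<Phi> (\<gamma> t)" "comps (V t) c = y t" if t: "t \<in> {a..e0}" for t
  proof -
    have ct: "c \<in> charts_at \<Phi> (\<gamma> t)" using y(3) t by blast
    have "(?x t, y t) \<in> ?O" using y(5) t by blast
    then obtain u where "u \<in> A" "c \<in> charts_at \<Phi> (base u)" "(?x t, y t) = tcoords c u" "of_tcoords \<Phi> c (?x t, y t) = u"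
      using cPhi by (rule tcoords_A_E)
    then show "V t \<in> A" by (simp add: V_def)
    show "base (V t) = \<gamma> t" "V t \<in> tangent_space \<Phi> (\<gamma> t)" "comps (V t) c = y t"
      unfolding V_def using ct by simp_all
  qed
  define B where "B = (\<lambda>t. Blinfun (Gam c (V t) (vel c t)))"
  have B: "blinfun_apply (B t) = Gam c (V t) (vel c t)" for t
    unfolding B_def by (rule bounded_linear_Blinfun_apply) (rule linear_conv_bounded_linear[THEN iffD1, OF Gam_linear])
  have sub0: "{a..e0} \<subseteq> {a..b}" using y by auto
  have cx: "continuous_on {a..e0} (vel c)" "continuous_on {a..e0} ?x"
    by (rule continuous_vel[OF sub0], use y(3) in blast)+
  have cy: "continuous_on {a..e0} y"
    unfolding continuous_on_eq_continuous_within
    using has_vector_derivative_continuous[OF bspec[OF y(6)]] by blast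
  have "continuous_on {a..e0} B"
  proof (rule continuous_on_blinfun_componentwise)
    fix i :: "real^'n" assume "i \<in> Basis"
    have "continuous_on {a..e0} (\<lambda>t. Gam3 c (((?x t, y t), vel c t), i))"
      by (rule continuous_on_compose2[OF smooth_on_imp_continuous_on[OF smooth_Gam3[OF cPhi]]])
        (use y(5) in \<open>auto simp: Gam_dom_def intro!: continuous_on_Pair cx cy continuous_on_const\<close>)
    then show "continuous_on {a..e0} (\<lambda>t. blinfun_apply (B t) i)"
      by (simp add: B V_def)
  qed
  from fundamental_solution[OF y(1) this]
  obtain e M N where M: "a < e" "e \<le> e0" "M a = id_blinfun" "N a = id_blinfun"
    "\<forall>t\<in>{a..e}. (M has_vector_derivative - (B t o\<^sub>L M t)) (at t within {a..e})"
    "\<forall>t\<in>{a..e}. (N has_vector_derivative N t o\<^sub>L B t) (at t within {a..e})"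
    "\<forall>t\<in>{a..e}. N t o\<^sub>L M t = id_blinfun"
    by metis
  have eb: "a < e" "e \<le> b" using M y by auto
  have sub: "{a..e} \<subseteq> {a..e0}" using M by auto
  have ce: "\<forall>t\<in>{a..e}. c \<in> charts_at \<Phi> (\<gamma> t)" using y(3) sub by blast
  have inside: "(f has_vector_derivative f') (at a within {a..b})"
    if "(f has_vector_derivative f') (at a within {a..e'})" "a < e'" for f :: "real \<Rightarrow> 'z::real_normed_vector" and f' e'
    using that eb ab by (simp add: at_within_Icc_at_right)
  have autopar: "autoparallel_from \<Phi> A nabla a e \<gamma> v V"
    unfolding autoparallel_from_def
  proof (intro conjI ballI Va)
    show "V t \<in> A" if "t \<in> {a..e}" for t using V that sub by blast
    show "parallel_along \<Phi> nabla {a..e} \<gamma> V V"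
    proof (rule parallel_along_chartI[OF eb])
      fix t assume t: "t \<in> {a..e}"
      then have t0: "t \<in> {a..e0}" using sub by blast
      show "c \<in> charts_at \<Phi> (\<gamma> t)" using ce t by blast
      show "V t \<in> A" "base (V t) = \<gamma> t" "V t \<in> tangent_space \<Phi> (\<gamma> t)" using V[OF t0] by blast+
      have "(y has_vector_derivative - Gam c (V t) (vel c t) (comps (V t) c)) (at t within {a..e})"
        unfolding V(4)[OF t0] using has_vector_derivative_within_subset[OF bspec[OF y(6) t0] sub]
        by (simp only: V_def)
      then show "((\<lambda>\<tau>. comps (V \<tau>) c) has_vector_derivative - Gam c (V t) (vel c t) (comps (V t) c)) (at t within {a..e})"
        by (rule has_vector_derivative_transform[OF t, rotated]) (use V(4) sub in blast)
    qed
  qed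
  define X where "X = (\<lambda>w t. tvec_of c (\<gamma> t) (blinfun_apply (M t) w))"
  have X: "X w t \<in> tangent_space \<Phi> (\<gamma> t)" "comps (X w t) c = blinfun_apply (M t) w" if "t \<in> {a..e}" for w t
    using ce that unfolding X_def by simp_all
  have par: "parallel_along \<Phi> nabla {a..e} \<gamma> V (X w)" for w
  proof (rule parallel_along_chartI[OF eb])
    fix t assume t: "t \<in> {a..e}"
    then have t0: "t \<in> {a..e0}" using sub by blast
    show "c \<in> charts_at \<Phi> (\<gamma> t)" using ce t by blast
    show "V t \<in> A" "base (V t) = \<gamma> t" using V[OF t0] by blast+
    show "X w t \<in> tangent_space \<Phi> (\<gamma> t)" by (rule X(1)[OF t])
    have "((\<lambda>\<tau>. blinfun_apply (M \<tau>) w) has_vector_derivative blinfun_apply (- (B t o\<^sub>L M t)) w) (at t within {a..e})"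
      by (rule bounded_linear.has_vector_derivative[OF blinfun.bounded_linear_left bspec[OF M(5) t]])
    then have "((\<lambda>\<tau>. blinfun_apply (M \<tau>) w) has_vector_derivative - Gam c (V t) (vel c t) (comps (X w t) c)) (at t within {a..e})"
      unfolding X(2)[OF t] by (simp add: blinfun.bilinear_simps B)
    then show "((\<lambda>\<tau>. comps (X w \<tau>) c) has_vector_derivative - Gam c (V t) (vel c t) (comps (X w t) c)) (at t within {a..e})"
      by (rule has_vector_derivative_transform[OF t, rotated]) (rule X(2))
  qed
  have Xa: "X w a = tvec_of c (\<gamma> a) w" for w by (simp add: X_def M(3))
  show thesis
  proof (rule that[of e y M N, OF eb ce y(4) _ _ M(3,4)])
    show "\<forall>t\<in>{a..e}. (?x t, y t) \<in> ?O" using y(5) sub by blast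
    have comp_id: "P o\<^sub>L id_blinfun = P" "id_blinfun o\<^sub>L P = P" for P :: "(real^'n) \<Rightarrow>\<^sub>L (real^'n)"
      by (rule blinfun_eqI, simp)+
    have a0: "a \<in> {a..e0}" "a \<in> {a..e}" using y M by auto
    show "(y has_vector_derivative - Gam c v (vel c a) (comps v c)) (at a within {a..b})"
      using inside[OF bspec[OF y(6) a0(1)] y(1)] Va y(4) by (simp add: V_def)
    show "(M has_vector_derivative - Blinfun (Gam c v (vel c a))) (at a within {a..b})"
      using inside[OF bspec[OF M(5) a0(2)] M(1)] Va M(3) by (simp add: B_def comp_id)
    show "(N has_vector_derivative Blinfun (Gam c v (vel c a))) (at a within {a..b})"
      using inside[OF bspec[OF M(6) a0(2)] M(1)] Va M(4) by (simp add: B_def comp_id)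
    show "\<forall>t\<in>{a..e}. \<forall>w. blinfun_apply (N t) (blinfun_apply (M t) w) = w"
      using M(7) by (metis blinfun_apply_blinfun_compose blinfun_apply_id_blinfun)
    show "\<forall>t\<in>{a..e}. transport \<Phi> A nabla a b \<gamma> t v = tvec_of c (\<gamma> t) (y t)"
    proof
      fix t assume t: "t \<in> {a..e}"
      show "transport \<Phi> A nabla a b \<gamma> t v = tvec_of c (\<gamma> t) (y t)"
        unfolding transport_def
      proof (rule the_equality)
        show "\<exists>e V. a < e \<and> e \<le> b \<and> a \<le> t \<and> t \<le> e \<and> autoparallel_from \<Phi> A nabla a e \<gamma> v V \<and> V t = tvec_of c (\<gamma> t) (y t)"
          using eb t autopar by (intro exI[of _ e] exI[of _ V]) (auto simp: V_def)
      next
        fix w assume "\<exists>e V. a < e \<and> e \<le> b \<and> a \<le> t \<and> t \<le> e \<and> autoparallel_from \<Phi> A nabla a e \<gamma> v V \<and> V t = w"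
        then obtain e' V' where V': "a < e'" "e' \<le> b" "a \<le> t" "t \<le> e'" "autoparallel_from \<Phi> A nabla a e' \<gamma> v V'" "V' t = w"
          by blast
        have "V' t = V t"
          by (rule autoparallel_unique[OF V'(1,2) eb V'(3,4) _ _ V'(5) autopar]) (use t ce in auto)
        then show "w = tvec_of c (\<gamma> t) (y t)" using V'(6) by (simp add: V_def)
      qed
    qed
    show "\<forall>t\<in>{a..e}. \<forall>w. lin_transport \<Phi> A nabla a b \<gamma> t v (tvec_of c (\<gamma> a) w) = tvec_of c (\<gamma> t) (blinfun_apply (M t) w)"
    proof (intro ballI allI)
      fix t w assume t: "t \<in> {a..e}"
      show "lin_transport \<Phi> A nabla a b \<gamma> t v (tvec_of c (\<gamma> a) w) = tvec_of c (\<gamma> t) (blinfun_apply (M t) w)"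
        unfolding lin_transport_def
      proof (rule the_equality)
        show "\<exists>e V W. a < e \<and> e \<le> b \<and> a \<le> t \<and> t \<le> e \<and> autoparallel_from \<Phi> A nabla a e \<gamma> v V \<and>
            W a = tvec_of c (\<gamma> a) w \<and> parallel_along \<Phi> nabla {a..e} \<gamma> V W \<and> W t = tvec_of c (\<gamma> t) (blinfun_apply (M t) w)"
          using eb t autopar par[of w] Xa[of w]
          by (intro exI[of _ e] exI[of _ V] exI[of _ "X w"]) (auto simp: X_def)
      next
        fix w' assume "\<exists>e V W. a < e \<and> e \<le> b \<and> a \<le> t \<and> t \<le> e \<and> autoparallel_from \<Phi> A nabla a e \<gamma> v V \<and>
            W a = tvec_of c (\<gamma> a) w \<and> parallel_along \<Phi> nabla {a..e} \<gamma> V W \<and> W t = w'"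
        then obtain e' V' W where V': "a < e'" "e' \<le> b" "a \<le> t" "t \<le> e'" "autoparallel_from \<Phi> A nabla a e' \<gamma> v V'"
          and W: "W a = tvec_of c (\<gamma> a) w" "parallel_along \<Phi> nabla {a..e'} \<gamma> V' W" "W t = w'"
          by blast
        have "W t = X w t"
          by (rule parallel_unique[OF V'(1,2) eb V'(3,4) _ _ V'(5) autopar W(2) par])
            (use t ce W(1) Xa in auto)
        then show "w' = tvec_of c (\<gamma> t) (blinfun_apply (M t) w)" using W(3) by (simp add: X_def)
      qed
    qed
  qed
qed

end

section \<open>Multilinear forms and tensors\<close>

definition multilinear :: "nat \<Rightarrow> ((real^'n) list \<Rightarrow> real) \<Rightarrow> bool" where
  "multilinear n f \<longleftrightarrow> (\<forall>xs l. length xs = n \<longrightarrow> l < n \<longrightarrow> linear (\<lambda>y. f (xs[l := y])))"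

abbreviation axes :: "'n::finite list \<Rightarrow> (real^'n) list" where
  "axes js \<equiv> map (\<lambda>j. axis j 1) js"

lemma multilinearD: "multilinear n f \<Longrightarrow> length xs = n \<Longrightarrow> l < n \<Longrightarrow> linear (\<lambda>y. f (xs[l := y]))"
  by (simp add: multilinear_def)

lemma finite_lists_of_length: "finite {js :: 'n::finite list. length js = n}"
  using finite_lists_length_eq[OF finite[of UNIV], of n] by simp

lemma sum_lists_Suc:
  fixes g :: "'n::finite list \<Rightarrow> real"
  shows "(\<Sum>js | length js = Suc n. g js) = (\<Sum>j\<in>UNIV. \<Sum>js | length js = n. g (j # js))"
proof -
  have "{js :: 'n list. length js = Suc n} = (\<lambda>x. fst x # snd x) ` (UNIV \<times> {js. length js = n})"
    by (auto simp: length_Suc_conv image_iff)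
  moreover have "inj_on (\<lambda>x. fst x # snd x) (UNIV \<times> {js :: 'n list. length js = n})"
    by (auto simp: inj_on_def)
  ultimately show ?thesis
    by (simp add: sum.reindex sum.cartesian_product split_def)
qed

text \<open>A multilinear form is determined by its values on lists of coordinate vectors. All derivatives and
  comparisons of tensors go through this expansion.\<close>

lemma multilinear_expand:
  fixes f :: "(real^'n) list \<Rightarrow> real"
  assumes "multilinear n f" "length xs = n"
  shows "f xs = (\<Sum>js | length js = n. (\<Prod>l<n. xs ! l $ js ! l) * f (axes js))"
  using assms
proof (induction n arbitrary: f xs)
  case 0
  then show ?case by simp
next
  case (Suc n)
  then obtain x ys where xs: "xs = x # ys" "length ys = n" by (auto simp: length_Suc_conv)
  have lin: "linear (\<lambda>y. f (y # ys))"
    using multilinearD[OF Suc.prems(1), of "x # ys" 0] xs by simp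
  have tail: "multilinear n (\<lambda>zs. f (z # zs))" for z
    unfolding multilinear_def
  proof (intro allI impI)
    fix zs :: "(real^'n) list" and l assume "length zs = n" "l < n"
    then show "linear (\<lambda>y. f (z # zs[l := y]))"
      using multilinearD[OF Suc.prems(1), of "z # zs" "Suc l"] by simp
  qed
  have "f xs = (\<Sum>j\<in>UNIV. x $ j * f (axis j 1 # ys))"
    using linear_eq_sum_axis[OF lin, of x] by (simp add: xs)
  also have "\<dots> = (\<Sum>j\<in>UNIV. x $ j * (\<Sum>js | length js = n. (\<Prod>l<n. ys ! l $ js ! l) * f (axis j 1 # axes js)))"
    by (intro sum.cong refl arg_cong2[of _ _ _ _ "(*)"] Suc.IH[OF tail xs(2)])
  also have "\<dots> = (\<Sum>js | length js = Suc n. (\<Prod>l<Suc n. xs ! l $ js ! l) * f (axes js))"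
    by (simp add: sum_lists_Suc xs(1) prod.lessThan_Suc_shift sum_distrib_left mult.assoc
        del: prod.lessThan_Suc)
  finally show ?case .
qed

lemma prod_axes:
  assumes "length ks = n" "length js = n"
  shows "(\<Prod>l<n. axes ks ! l $ js ! l) = (if js = ks then 1 else (0::real))"
proof (cases "js = ks")
  case True
  then show ?thesis using assms by simp
next
  case False
  then obtain l where "l < n" "js ! l \<noteq> ks ! l" using assms nth_equalityI by metis
  then have "\<exists>l\<in>{..<n}. axes ks ! l $ js ! l = (0::real)"
    using assms by (intro bexI[of _ l]) (auto simp: axis_def)
  then show ?thesis using False by (simp add: prod_zero_iff)
qed

lemma prod_list_update:
  fixes xs :: "(real^'n) list"
  assumes "length xs = n" "l < n"
  shows "(\<Prod>k<n. xs[l := y] ! k $ js ! k) = (y $ js ! l) * (\<Prod>k\<in>{..<n} - {l}. xs ! k $ js ! k)"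
proof -
  have "(\<Prod>k<n. xs[l := y] ! k $ js ! k) = (xs[l := y] ! l $ js ! l) * (\<Prod>k\<in>{..<n} - {l}. xs[l := y] ! k $ js ! k)"
    using assms by (intro prod.remove) auto
  also have "(\<Prod>k\<in>{..<n} - {l}. xs[l := y] ! k $ js ! k) = (\<Prod>k\<in>{..<n} - {l}. xs ! k $ js ! k)"
    by (intro prod.cong) auto
  finally show ?thesis using assms by simp
qed

lemma multilinear_of_coefficients:
  fixes C :: "'n::finite list \<Rightarrow> real"
  shows "multilinear n (\<lambda>xs. \<Sum>js | length js = n. (\<Prod>l<n. xs ! l $ js ! l) * C js)"
  unfolding multilinear_def
proof (intro allI impI)
  fix xs :: "(real^'n) list" and l assume l: "length xs = n" "l < n"
  show "linear (\<lambda>y. \<Sum>js | length js = n. (\<Prod>k<n. xs[l := y] ! k $ js ! k) * C js)"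
    unfolding prod_list_update[OF l]
    by (rule linearI) (simp_all add: algebra_simps sum.distrib sum_distrib_left)
qed

lemma multilinear_compose:
  fixes h :: "nat \<Rightarrow> real^'n \<Rightarrow> real^'n"
  assumes f: "multilinear n f" and h: "\<And>l. l < n \<Longrightarrow> linear (h l)"
  shows "multilinear n (\<lambda>xs. f (map (\<lambda>l. h l (xs ! l)) [0..<n]))"
  unfolding multilinear_def
proof (intro allI impI)
  fix xs :: "(real^'n) list" and l assume l: "length xs = n" "l < n"
  have "map (\<lambda>k. h k (xs[l := y] ! k)) [0..<n] = (map (\<lambda>k. h k (xs ! k)) [0..<n])[l := h l y]" for y
    using l by (intro nth_equalityI) (auto simp: nth_list_update)
  then show "linear (\<lambda>y. f (map (\<lambda>k. h k (xs[l := y] ! k)) [0..<n]))"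
    using linear_compose[OF h[OF l(2)] multilinearD[OF f, of "map (\<lambda>k. h k (xs ! k)) [0..<n]" l]] l
    by (simp add: o_def)
qed

text \<open>The product rule for a multilinear form whose coefficients and arguments all depend on time.
  Expanding into coefficients reduces it to the product rule for finite products.\<close>

lemma has_derivative_multilinear:
  fixes p :: "nat \<Rightarrow> real \<Rightarrow> real^'n"
  assumes f: "\<forall>t\<in>I. multilinear n (f t)" and a: "a \<in> I"
    and C: "\<And>js. length js = n \<Longrightarrow> ((\<lambda>t. f t (axes js)) has_real_derivative C js) (at a within I)"
    and p: "\<And>l. l < n \<Longrightarrow> (p l has_vector_derivative p' l) (at a within I)"
  shows "((\<lambda>t. f t (map (\<lambda>l. p l t) [0..<n])) has_real_derivative
    (\<Sum>js | length js = n. (\<Prod>l<n. p l a $ js ! l) * C js)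
    + (\<Sum>l<n. f a ((map (\<lambda>l. p l a) [0..<n])[l := p' l]))) (at a within I)"
proof -
  let ?P = "\<lambda>t. map (\<lambda>l. p l t) [0..<n]"
  have pc: "((\<lambda>t. p l t $ j) has_derivative (\<lambda>h. h * p' l $ j)) (at a within I)" if "l < n" for l j
    using bounded_linear.has_vector_derivative[OF bounded_linear_vec_nth p[OF that], of j]
    by (simp add: has_vector_derivative_def)
  have prod: "((\<lambda>t. \<Prod>l<n. p l t $ js ! l) has_real_derivative
      (\<Sum>l<n. p' l $ js ! l * (\<Prod>k\<in>{..<n} - {l}. p k a $ js ! k))) (at a within I)" for js
  proof (rule has_derivative_imp_has_field_derivative)
    show "((\<lambda>t. \<Prod>l<n. p l t $ js ! l) has_derivative
        (\<lambda>h. \<Sum>l<n. (h * p' l $ js ! l) * (\<Prod>k\<in>{..<n} - {l}. p k a $ js ! k))) (at a within I)"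
      by (rule has_derivative_prod) (simp add: pc)
  qed (simp add: sum_distrib_left mult_ac)
  have "((\<lambda>t. \<Sum>js | length js = n. (\<Prod>l<n. p l t $ js ! l) * f t (axes js)) has_real_derivative
      (\<Sum>js | length js = n. (\<Prod>l<n. p l a $ js ! l) * C js
        + (\<Sum>l<n. p' l $ js ! l * (\<Prod>k\<in>{..<n} - {l}. p k a $ js ! k)) * f a (axes js))) (at a within I)"
  proof (rule DERIV_sum)
    fix js :: "'n list" assume "js \<in> {js. length js = n}"
    then show "((\<lambda>t. (\<Prod>l<n. p l t $ js ! l) * f t (axes js)) has_real_derivative
        (\<Prod>l<n. p l a $ js ! l) * C js
        + (\<Sum>l<n. p' l $ js ! l * (\<Prod>k\<in>{..<n} - {l}. p k a $ js ! k)) * f a (axes js)) (at a within I)"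
      by (intro DERIV_mult' prod C) simp
  qed
  moreover have "(\<Sum>js | length js = n. (\<Prod>l<n. p l t $ js ! l) * f t (axes js)) = f t (?P t)"
    if "t \<in> I" for t
    using multilinear_expand[OF bspec[OF f that], of "?P t"] by simp
  ultimately have D: "((\<lambda>t. f t (?P t)) has_real_derivative
      (\<Sum>js | length js = n. (\<Prod>l<n. p l a $ js ! l) * C js
        + (\<Sum>l<n. p' l $ js ! l * (\<Prod>k\<in>{..<n} - {l}. p k a $ js ! k)) * f a (axes js))) (at a within I)"
    by (rule has_field_derivative_transform_within[OF _ zero_less_one a])
  have "f a ((?P a)[l := p' l]) =
      (\<Sum>js | length js = n. (p' l $ js ! l * (\<Prod>k\<in>{..<n} - {l}. p k a $ js ! k)) * f a (axes js))"
    if l: "l < n" for l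
  proof -
    have "f a ((?P a)[l := p' l]) = (\<Sum>js | length js = n. (\<Prod>k<n. (?P a)[l := p' l] ! k $ js ! k) * f a (axes js))"
      by (rule multilinear_expand[OF bspec[OF f a]]) simp
    also have "\<dots> = (\<Sum>js | length js = n. (p' l $ js ! l * (\<Prod>k\<in>{..<n} - {l}. ?P a ! k $ js ! k)) * f a (axes js))"
      using l by (subst prod_list_update) auto
    also have "\<dots> = (\<Sum>js | length js = n. (p' l $ js ! l * (\<Prod>k\<in>{..<n} - {l}. p k a $ js ! k)) * f a (axes js))"
      by (intro sum.cong refl arg_cong2[of _ _ _ _ "(*)"] prod.cong) auto
    finally show ?thesis .
  qed
  then have "(\<Sum>l<n. f a ((?P a)[l := p' l])) =
      (\<Sum>l<n. \<Sum>js | length js = n. (p' l $ js ! l * (\<Prod>k\<in>{..<n} - {l}. p k a $ js ! k)) * f a (axes js))"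
    by simp
  also have "\<dots> = (\<Sum>js | length js = n. (\<Sum>l<n. p' l $ js ! l * (\<Prod>k\<in>{..<n} - {l}. p k a $ js ! k)) * f a (axes js))"
    by (subst sum.swap) (simp add: sum_distrib_right)
  finally show ?thesis using D by (simp add: sum.distrib)
qed

context manifold
begin

text \<open>Tensors at a point and multilinear forms on the coordinate space correspond to each other; the
  list of the covector arguments is put in front of that of the vector arguments.\<close>

definition covec_coords :: "('m, 'n) chart \<Rightarrow> 'm \<Rightarrow> ('m, 'n) covec \<Rightarrow> real^'n" where
  "covec_coords c p \<theta> = (\<chi> j. \<theta> (tvec_of c p (axis j 1)))"

lemma covec_of_coords:
  assumes "\<theta> \<in> cotangent_space \<Phi> p" "c \<in> charts_at \<Phi> p"
  shows "covec_of c p (covec_coords c p \<theta>) = \<theta>"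
proof
  obtain \<eta> where \<theta>: "\<theta> = covec_of c p \<eta>" by (rule covec_of_surj[OF assms])
  have "covec_coords c p \<theta> = \<eta>"
    using assms(2) by (simp add: covec_coords_def \<theta> covec_of_def vec_eq_iff inner_axis)
  then show "covec_of c p (covec_coords c p \<theta>) v = \<theta> v" for v by (simp add: \<theta>)
qed

lemma covec_coords_of: "c \<in> charts_at \<Phi> p \<Longrightarrow> covec_coords c p (covec_of c p \<eta>) = \<eta>"
  by (simp add: covec_coords_def covec_of_def vec_eq_iff inner_axis)

definition form_of ::
  "nat \<Rightarrow> ('m, 'n) chart \<Rightarrow> 'm \<Rightarrow> ('m, 'n) tensor \<Rightarrow> (real^'n) list \<Rightarrow> real" where
  "form_of r c p S zs = S (map (covec_of c p) (take r zs)) (map (tvec_of c p) (drop r zs))"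

definition arg_coords ::
  "('m, 'n) chart \<Rightarrow> 'm \<Rightarrow> ('m, 'n) covec list \<Rightarrow> ('m, 'n) tvec list \<Rightarrow> (real^'n) list" where
  "arg_coords c p \<theta>s vs = map (covec_coords c p) \<theta>s @ map (\<lambda>v. comps v c) vs"

text \<open>Inverse to \<open>form_of\<close> on multilinear forms; inadmissible lists of arguments get the value 0, as
  the definition of tensors demands.\<close>

definition tensor_of ::
  "nat \<Rightarrow> nat \<Rightarrow> ('m, 'n) chart \<Rightarrow> 'm \<Rightarrow> ((real^'n) list \<Rightarrow> real) \<Rightarrow> ('m, 'n) tensor" where
  "tensor_of r s c p f = (\<lambda>\<theta>s vs. if (\<theta>s, vs) \<in> tensor_args r s \<Phi> p then f (arg_coords c p \<theta>s vs) else 0)"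

lemma tensor_argsD:
  assumes "(\<theta>s, vs) \<in> tensor_args r s \<Phi> p"
  shows "length \<theta>s = r" "length vs = s" "set \<theta>s \<subseteq> cotangent_space \<Phi> p" "set vs \<subseteq> tangent_space \<Phi> p"
  using assms unfolding tensor_args_def by blast+

lemma tensor_argsI:
  assumes "length \<theta>s = r" "length vs = s" "set \<theta>s \<subseteq> cotangent_space \<Phi> p" "set vs \<subseteq> tangent_space \<Phi> p"
  shows "(\<theta>s, vs) \<in> tensor_args r s \<Phi> p"
  using assms unfolding tensor_args_def by blast

lemma tensorsD:
  assumes "S \<in> tensors r s \<Phi> p"
  shows "(\<theta>s, vs) \<in> tensor_args r s \<Phi> p \<Longrightarrow> l < r \<Longrightarrow> \<alpha> \<in> cotangent_space \<Phi> p \<Longrightarrow> \<beta> \<in> cotangent_space \<Phi> p \<Longrightarrow>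
      S (\<theta>s[l := \<lambda>u. x * \<alpha> u + y * \<beta> u]) vs = x * S (\<theta>s[l := \<alpha>]) vs + y * S (\<theta>s[l := \<beta>]) vs"
    and "(\<theta>s, vs) \<in> tensor_args r s \<Phi> p \<Longrightarrow> l < s \<Longrightarrow> u \<in> tangent_space \<Phi> p \<Longrightarrow> w \<in> tangent_space \<Phi> p \<Longrightarrow>
      S \<theta>s (vs[l := tadd (tscale x u) (tscale y w)]) = x * S \<theta>s (vs[l := u]) + y * S \<theta>s (vs[l := w])"
    and "(\<theta>s, vs) \<notin> tensor_args r s \<Phi> p \<Longrightarrow> S \<theta>s vs = 0"
  using assms unfolding tensors_def mem_Collect_eq by blast+

lemma form_of_coords:
  assumes args: "(\<theta>s, vs) \<in> tensor_args r s \<Phi> p" and c: "c \<in> charts_at \<Phi> p"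
  shows "form_of r c p S (arg_coords c p \<theta>s vs) = S \<theta>s vs"
proof -
  note a = tensor_argsD[OF args]
  have "map (covec_of c p) (map (covec_coords c p) \<theta>s) = \<theta>s"
    unfolding map_map using a(3) c by (intro map_idI) (auto simp: covec_of_coords)
  moreover have "map (tvec_of c p) (map (\<lambda>v. comps v c) vs) = vs"
    unfolding map_map
  proof (rule map_idI)
    fix v assume "v \<in> set vs"
    then have "v \<in> tangent_space \<Phi> p" using a(4) by blast
    then show "(tvec_of c p \<circ> (\<lambda>v. comps v c)) v = v" using c by simp
  qed
  ultimately show ?thesis using a(1) by (simp add: form_of_def arg_coords_def)
qed

lemma arg_coords_of:
  assumes c: "c \<in> charts_at \<Phi> p" and "length zs = r + s"
  shows "arg_coords c p (map (covec_of c p) (take r zs)) (map (tvec_of c p) (drop r zs)) = zs"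
    and "(map (covec_of c p) (take r zs), map (tvec_of c p) (drop r zs)) \<in> tensor_args r s \<Phi> p"
proof -
  have "map (covec_coords c p) (map (covec_of c p) (take r zs)) = take r zs"
    unfolding map_map using c by (intro map_idI) (simp add: covec_coords_of)
  moreover have "map (\<lambda>v. comps v c) (map (tvec_of c p) (drop r zs)) = drop r zs"
    unfolding map_map using c by (intro map_idI) simp
  ultimately show "arg_coords c p (map (covec_of c p) (take r zs)) (map (tvec_of c p) (drop r zs)) = zs"
    by (simp add: arg_coords_def)
  show "(map (covec_of c p) (take r zs), map (tvec_of c p) (drop r zs)) \<in> tensor_args r s \<Phi> p"
    using assms by (intro tensor_argsI) auto
qed

lemma multilinear_form_of:
  assumes S: "S \<in> tensors r s \<Phi> p" and c: "c \<in> charts_at \<Phi> p"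
  shows "multilinear (r + s) (form_of r c p S)"
  unfolding multilinear_def
proof (intro allI impI)
  fix zs :: "(real^'n) list" and l assume zs: "length zs = r + s" and l: "l < r + s"
  note args = arg_coords_of(2)[OF c zs]
  have lin: "form_of r c p S (zs[l := x *\<^sub>R y + q *\<^sub>R z]) = x * form_of r c p S (zs[l := y]) + q * form_of r c p S (zs[l := z])"
    for x q y z
  proof (cases "l < r")
    case True
    then have "take r (zs[l := w]) = (take r zs)[l := w]" "drop r (zs[l := w]) = drop r zs" for w
      by (simp_all add: take_update_swap)
    then show ?thesis
      unfolding form_of_def by (simp add: map_update covec_of_linear tensorsD(1)[OF S args True])
  next
    case False
    then have "take r (zs[l := w]) = take r zs" "drop r (zs[l := w]) = (drop r zs)[l - r := w]" for w
      by (simp_all add: drop_update_swap)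
    moreover have "l - r < s" using False l by simp
    ultimately show ?thesis
      unfolding form_of_def using c
      by (simp add: map_update tvec_of_linear tensorsD(2)[OF S args])
  qed
  show "linear (\<lambda>y. form_of r c p S (zs[l := y]))"
    using lin[of 1 _ 1] lin[of _ _ 0 0] by (intro linearI) simp_all
qed

lemma tensor_of_in_tensors:
  assumes f: "multilinear (r + s) f" and c: "c \<in> charts_at \<Phi> p"
  shows "tensor_of r s c p f \<in> tensors r s \<Phi> p"
proof -
  have lin: "f (zs[l := x *\<^sub>R y + q *\<^sub>R z]) = x * f (zs[l := y]) + q * f (zs[l := z])"
    if "length zs = r + s" "l < r + s" for zs l x q y z
    by (simp add: linear_add[OF multilinearD[OF f that]] linear_scale[OF multilinearD[OF f that]])
  show ?thesis
    unfolding tensors_def mem_Collect_eq case_prod_beta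
  proof (intro conjI ballI allI impI)
    fix P l and \<alpha> \<beta> :: "('m, 'n) covec" and x y :: real
    assume P: "P \<in> tensor_args r s \<Phi> p" and l: "l < r"
      and \<alpha>: "\<alpha> \<in> cotangent_space \<Phi> p" and \<beta>: "\<beta> \<in> cotangent_space \<Phi> p"
    obtain \<theta>s vs where Peq: "P = (\<theta>s, vs)" by (cases P)
    note a = tensor_argsD[OF P[unfolded Peq]]
    have args: "(\<theta>s[l := \<theta>], vs) \<in> tensor_args r s \<Phi> p" if "\<theta> \<in> cotangent_space \<Phi> p" for \<theta>
      using a that set_update_subset_insert[of \<theta>s l \<theta>] by (intro tensor_argsI) auto
    have comb: "(\<lambda>u. x * \<alpha> u + y * \<beta> u) \<in> cotangent_space \<Phi> p"
    proof -
      have "(\<lambda>u. x * \<alpha> u + y * \<beta> u) = covec_of c p (x *\<^sub>R covec_coords c p \<alpha> + y *\<^sub>R covec_coords c p \<beta>)"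
        unfolding covec_of_linear covec_of_coords[OF \<alpha> c] covec_of_coords[OF \<beta> c] ..
      then show ?thesis by simp
    qed
    have upd: "arg_coords c p (\<theta>s[l := \<theta>]) vs = (arg_coords c p \<theta>s vs)[l := covec_coords c p \<theta>]" for \<theta>
      using l a by (simp add: arg_coords_def map_update list_update_append)
    have coords: "covec_coords c p (\<lambda>u. x * \<alpha> u + y * \<beta> u) = x *\<^sub>R covec_coords c p \<alpha> + y *\<^sub>R covec_coords c p \<beta>"
      by (simp add: covec_coords_def vec_eq_iff)
    have len: "length (arg_coords c p \<theta>s vs) = r + s" using a by (simp add: arg_coords_def)
    show "tensor_of r s c p f ((fst P)[l := \<lambda>u. x * \<alpha> u + y * \<beta> u]) (snd P) =
        x * tensor_of r s c p f ((fst P)[l := \<alpha>]) (snd P) + y * tensor_of r s c p f ((fst P)[l := \<beta>]) (snd P)"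
      using args[OF \<alpha>] args[OF \<beta>] args[OF comb] lin[OF len, of l] l
      by (simp add: Peq tensor_of_def upd coords)
  next
    fix P l and u w :: "('m, 'n) tvec" and x y :: real
    assume P: "P \<in> tensor_args r s \<Phi> p" and l: "l < s"
      and u: "u \<in> tangent_space \<Phi> p" and w: "w \<in> tangent_space \<Phi> p"
    obtain \<theta>s vs where Peq: "P = (\<theta>s, vs)" by (cases P)
    note a = tensor_argsD[OF P[unfolded Peq]]
    have args: "(\<theta>s, vs[l := v]) \<in> tensor_args r s \<Phi> p" if "v \<in> tangent_space \<Phi> p" for v
      using a that set_update_subset_insert[of vs l v] by (intro tensor_argsI) auto
    have comb: "tadd (tscale x u) (tscale y w) \<in> tangent_space \<Phi> p"
      using u w by simp
    have upd: "arg_coords c p \<theta>s (vs[l := v]) = (arg_coords c p \<theta>s vs)[r + l := comps v c]" for v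
      using l a by (simp add: arg_coords_def map_update list_update_append)
    have len: "length (arg_coords c p \<theta>s vs) = r + s" using a by (simp add: arg_coords_def)
    show "tensor_of r s c p f (fst P) ((snd P)[l := tadd (tscale x u) (tscale y w)]) =
        x * tensor_of r s c p f (fst P) ((snd P)[l := u]) + y * tensor_of r s c p f (fst P) ((snd P)[l := w])"
      using args[OF u] args[OF w] args[OF comb] lin[OF len, of "r + l"] l
      by (simp add: Peq tensor_of_def upd)
  next
    fix \<theta>s vs assume "(\<theta>s, vs) \<notin> tensor_args r s \<Phi> p"
    then show "tensor_of r s c p f \<theta>s vs = 0" by (simp add: tensor_of_def)
  qed
qed

lemma tensor_comp_form_of:
  assumes "length as = r"
  shows "tensor_comp \<Phi> c p S as bs = form_of r c p S (axes (as @ bs))"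
proof -
  have "coord_vec \<Phi> c p = (\<lambda>i. tvec_of c p (axis i 1))" "coord_covec \<Phi> c p = (\<lambda>i. covec_of c p (axis i 1))"
    by (rule ext, rule coord_vec_eq) (rule ext, rule coord_covec_eq)
  then show ?thesis using assms by (simp add: tensor_comp_def form_of_def o_def)
qed

text \<open>One chart suffices, since components there determine the values on all admissible arguments and
  all other values are 0.\<close>

lemma tensor_eqI:
  assumes S: "S \<in> tensors r s \<Phi> p" "S' \<in> tensors r s \<Phi> p" and c: "c \<in> charts_at \<Phi> p"
    and comps: "\<And>as bs. length as = r \<Longrightarrow> length bs = s \<Longrightarrow> tensor_comp \<Phi> c p S as bs = tensor_comp \<Phi> c p S' as bs"
  shows "S = S'"
proof (intro ext)
  fix \<theta>s vs
  show "S \<theta>s vs = S' \<theta>s vs"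
  proof (cases "(\<theta>s, vs) \<in> tensor_args r s \<Phi> p")
    case False
    then show ?thesis using tensorsD(3)[OF S(1)] tensorsD(3)[OF S(2)] by simp
  next
    case True
    have len: "length (arg_coords c p \<theta>s vs) = r + s"
      using tensor_argsD[OF True] by (simp add: arg_coords_def)
    have "form_of r c p S (axes js) = form_of r c p S' (axes js)" if "length js = r + s" for js
      using comps[of "take r js" "drop r js"] that tensor_comp_form_of[of "take r js" r c p _ "drop r js"] by simp
    then have "form_of r c p S (arg_coords c p \<theta>s vs) = form_of r c p S' (arg_coords c p \<theta>s vs)"
      unfolding multilinear_expand[OF multilinear_form_of[OF S(1) c] len]
        multilinear_expand[OF multilinear_form_of[OF S(2) c] len]
      by (intro sum.cong) auto
    then show ?thesis unfolding form_of_coords[OF True c] .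
  qed
qed

end

section \<open>Parallel transport computes the covariant derivative\<close>

context aniso_conn
begin

lemma Gam_axis_right: "Gam c v u (axis m 1) $ i = (\<Sum>k\<in>UNIV. christoffel \<Phi> nabla c i k m v * u $ k)"
  by (simp add: Gam_def sum_mult_axis)

text \<open>The covariant derivative in the direction \<open>u\<close>, sorted by the three kinds of objects whose
  rates of change it collects: the point of the domain, the covector slots and the vector slots.\<close>

lemma cov_deriv_comp_direction:
  fixes as bs :: "'n list" and c :: "('m, 'n) chart" and T :: "('m, 'n) tvec \<Rightarrow> ('m, 'n) tensor"
  defines "Tc \<equiv> \<lambda>as bs z. tensor_comp \<Phi> c (cinv c (fst z)) (T (of_tcoords \<Phi> c z)) as bs"
  assumes diff: "Tc as bs differentiable (at (tcoords c v))"
  shows "(\<Sum>k\<in>UNIV. (u $ k) * cov_deriv_comp \<Phi> nabla c T v k as bs) =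
    frechet_derivative (Tc as bs) (at (tcoords c v)) (u, - Gam c v u (comps v c))
    + (\<Sum>l<length as. \<Sum>j\<in>UNIV. Gam c v u (axis j 1) $ (as ! l) * Tc (as[l := j]) bs (tcoords c v))
    + (\<Sum>l<length bs. \<Sum>j\<in>UNIV. (- Gam c v u (axis (bs ! l) 1)) $ j * Tc as (bs[l := j]) (tcoords c v))"
proof -
  let ?D = "frechet_derivative (Tc as bs) (at (tcoords c v))" and ?z = "tcoords c v" and ?Y = "comps v c"
  let ?G = "\<lambda>i j k. christoffel \<Phi> nabla c i j k v"
  have lin: "linear ?D" by (rule linear_frechet_derivative[OF diff])
  have "linear (\<lambda>x. ?D (x, 0))" "linear (\<lambda>y. ?D (0, y))"
    using linear_compose[OF _ lin, of "\<lambda>x. (x, 0)"] linear_compose[OF _ lin, of "\<lambda>y. (0, y)"]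
    by (simp_all add: o_def linear_iff)
  note ax = linear_eq_sum_axis[OF this(1)] linear_eq_sum_axis[OF this(2)]
  have D: "?D (u, - Gam c v u ?Y) = (\<Sum>k\<in>UNIV. u $ k * ?D (axis k 1, 0))
      - (\<Sum>i\<in>UNIV. Gam c v u ?Y $ i * ?D (0, axis i 1))"
  proof -
    have "?D (u, - Gam c v u ?Y) = ?D (u, 0) + ?D (0, - Gam c v u ?Y)"
      using linear_add[OF lin, of "(u, 0)" "(0, - Gam c v u ?Y)"] by simp
    also have "\<dots> = (\<Sum>k\<in>UNIV. u $ k * ?D (axis k 1, 0)) + (\<Sum>i\<in>UNIV. (- Gam c v u ?Y) $ i * ?D (0, axis i 1))"
      by (simp only: ax(1)[of u] ax(2)[of "- Gam c v u ?Y"] real_scaleR_def)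
    finally show ?thesis by (simp add: sum_negf)
  qed
  have B: "(\<Sum>k\<in>UNIV. u $ k * (\<Sum>i\<in>UNIV. \<Sum>j\<in>UNIV. ?G i k j * ?Y $ j * ?D (0, axis i 1))) =
      (\<Sum>i\<in>UNIV. Gam c v u ?Y $ i * ?D (0, axis i 1))"
  proof -
    have "(\<Sum>k\<in>UNIV. u $ k * (\<Sum>i\<in>UNIV. \<Sum>j\<in>UNIV. ?G i k j * ?Y $ j * ?D (0, axis i 1))) =
        (\<Sum>i\<in>UNIV. \<Sum>k\<in>UNIV. u $ k * (\<Sum>j\<in>UNIV. ?G i k j * ?Y $ j * ?D (0, axis i 1)))"
      by (simp only: sum_distrib_left) (rule sum.swap)
    also have "\<dots> = (\<Sum>i\<in>UNIV. Gam c v u ?Y $ i * ?D (0, axis i 1))"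
      by (simp add: Gam_def sum_distrib_left sum_distrib_right mult_ac)
    finally show ?thesis .
  qed
  have slots: "(\<Sum>k\<in>UNIV. u $ k * (\<Sum>l\<in>L. \<Sum>j\<in>UNIV. g l k j * X l j)) =
      (\<Sum>l\<in>L. \<Sum>j\<in>UNIV. (\<Sum>k\<in>UNIV. g l k j * u $ k) * X l j)"
    for L :: "nat set" and g :: "nat \<Rightarrow> 'n \<Rightarrow> 'n \<Rightarrow> real" and X :: "nat \<Rightarrow> 'n \<Rightarrow> real"
  proof -
    have "(\<Sum>k\<in>UNIV. u $ k * (\<Sum>l\<in>L. \<Sum>j\<in>UNIV. g l k j * X l j)) =
        (\<Sum>l\<in>L. \<Sum>k\<in>UNIV. \<Sum>j\<in>UNIV. u $ k * (g l k j * X l j))"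
      by (simp only: sum_distrib_left) (rule sum.swap)
    also have "\<dots> = (\<Sum>l\<in>L. \<Sum>j\<in>UNIV. \<Sum>k\<in>UNIV. u $ k * (g l k j * X l j))"
      by (intro sum.cong refl sum.swap)
    also have "\<dots> = (\<Sum>l\<in>L. \<Sum>j\<in>UNIV. (\<Sum>k\<in>UNIV. g l k j * u $ k) * X l j)"
      by (simp only: sum_distrib_right) (simp only: mult_ac)
    finally show ?thesis .
  qed
  have C: "(\<Sum>k\<in>UNIV. u $ k * (\<Sum>l<length as. \<Sum>j\<in>UNIV. ?G (as ! l) k j * Tc (as[l := j]) bs ?z)) =
      (\<Sum>l<length as. \<Sum>j\<in>UNIV. Gam c v u (axis j 1) $ (as ! l) * Tc (as[l := j]) bs ?z)"
    unfolding Gam_axis_right by (rule slots)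
  have E: "(\<Sum>k\<in>UNIV. u $ k * (\<Sum>l<length bs. \<Sum>i\<in>UNIV. ?G i k (bs ! l) * Tc as (bs[l := i]) ?z)) =
      (\<Sum>l<length bs. \<Sum>j\<in>UNIV. Gam c v u (axis (bs ! l) 1) $ j * Tc as (bs[l := j]) ?z)"
    unfolding Gam_axis_right by (rule slots)
  have "cov_deriv_comp \<Phi> nabla c T v k as bs = ?D (axis k 1, 0)
      - (\<Sum>i\<in>UNIV. \<Sum>j\<in>UNIV. ?G i k j * ?Y $ j * ?D (0, axis i 1))
      + (\<Sum>l<length as. \<Sum>j\<in>UNIV. ?G (as ! l) k j * Tc (as[l := j]) bs ?z)
      - (\<Sum>l<length bs. \<Sum>i\<in>UNIV. ?G i k (bs ! l) * Tc as (bs[l := i]) ?z)" for k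
    unfolding cov_deriv_comp_def Let_def Tc_def ..
  then have "(\<Sum>k\<in>UNIV. (u $ k) * cov_deriv_comp \<Phi> nabla c T v k as bs) =
      (\<Sum>k\<in>UNIV. u $ k * ?D (axis k 1, 0))
      - (\<Sum>k\<in>UNIV. u $ k * (\<Sum>i\<in>UNIV. \<Sum>j\<in>UNIV. ?G i k j * ?Y $ j * ?D (0, axis i 1)))
      + (\<Sum>k\<in>UNIV. u $ k * (\<Sum>l<length as. \<Sum>j\<in>UNIV. ?G (as ! l) k j * Tc (as[l := j]) bs ?z))
      - (\<Sum>k\<in>UNIV. u $ k * (\<Sum>l<length bs. \<Sum>i\<in>UNIV. ?G i k (bs ! l) * Tc as (bs[l := i]) ?z))"
    by (simp only: right_diff_distrib distrib_left sum.distrib sum_subtractf)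
  also have "\<dots> = ?D (u, - Gam c v u ?Y)
    + (\<Sum>l<length as. \<Sum>j\<in>UNIV. Gam c v u (axis j 1) $ (as ! l) * Tc (as[l := j]) bs ?z)
    + (\<Sum>l<length bs. \<Sum>j\<in>UNIV. (- Gam c v u (axis (bs ! l) 1)) $ j * Tc as (bs[l := j]) ?z)"
    unfolding B C E D by (simp add: sum_negf)
  finally show ?thesis .
qed

end

context aniso_curve
begin

text \<open>In a chart, the tensor transported back is the tensor at the transported reference vector with
  the fundamental solution applied in the vector slots and the transpose of its inverse in
  the covector slots. Since these are the identity at time \<open>a\<close>, differentiating there slot by slot gives
  exactly the terms of the covariant derivative.\<close>

lemma transport_back_derivative:
  assumes v: "v \<in> A" "base v = \<gamma> a" and c: "c \<in> charts_at \<Phi> (\<gamma> a)" and T: "T \<in> aniso_tensors r s \<Phi> A"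
  defines "F \<equiv> \<lambda>t. form_of r c (\<gamma> a) (tensor_transport_back \<Phi> A nabla a b \<gamma> T v t)"
  obtains e where "a < e" "e \<le> b" "\<forall>t\<in>{a..e}. multilinear (r + s) (F t)"
    "\<forall>as bs. length as = r \<longrightarrow> length bs = s \<longrightarrow> ((\<lambda>t. F t (axes (as @ bs))) has_real_derivative
      (\<Sum>k\<in>UNIV. (vel c a $ k) * cov_deriv_comp \<Phi> nabla c T v k as bs)) (at a within {a..b})"
proof -
  let ?x = "\<lambda>t. cmap c (\<gamma> t)" and ?O = "tcoords c ` over A c" and ?n = "r + s"
  let ?u = "vel c a" and ?p = "\<gamma> a"
  have cPhi: "c \<in> \<Phi>" using c by (auto simp: charts_at_def)
  obtain e y M N where e: "a < e" "e \<le> b" and ce: "\<forall>t\<in>{a..e}. c \<in> charts_at \<Phi> (\<gamma> t)"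
    and y: "y a = comps v c" "\<forall>t\<in>{a..e}. (?x t, y t) \<in> ?O"
      "(y has_vector_derivative - Gam c v ?u (comps v c)) (at a within {a..b})"
    and Ma: "M a = id_blinfun" and Na: "N a = id_blinfun"
    and M': "(M has_vector_derivative - Blinfun (Gam c v ?u)) (at a within {a..b})"
    and N': "(N has_vector_derivative Blinfun (Gam c v ?u)) (at a within {a..b})"
    and NM: "\<forall>t\<in>{a..e}. \<forall>w. blinfun_apply (N t) (blinfun_apply (M t) w) = w"
    and tr: "\<forall>t\<in>{a..e}. transport \<Phi> A nabla a b \<gamma> t v = tvec_of c (\<gamma> t) (y t)"
    and lt: "\<forall>t\<in>{a..e}. \<forall>w. lin_transport \<Phi> A nabla a b \<gamma> t v (tvec_of c ?p w) = tvec_of c (\<gamma> t) (blinfun_apply (M t) w)"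
    by (rule transport_in_chart[OF v c])
  have a: "a \<in> {a..e}" and sub: "{a..e} \<subseteq> {a..b}" using e by auto
  have inside: "at a within {a..b} = at a within {a..e}"
    using e ab by (simp add: at_within_Icc_at_right)
  define V where "V = (\<lambda>t. tvec_of c (\<gamma> t) (y t))"
  have V: "V t \<in> A" "base (V t) = \<gamma> t" if t: "t \<in> {a..e}" for t
  proof -
    have "(?x t, y t) \<in> ?O" using y(2) t by blast
    then obtain w where "w \<in> A" "c \<in> charts_at \<Phi> (base w)" "(?x t, y t) = tcoords c w" "of_tcoords \<Phi> c (?x t, y t) = w"
      using cPhi by (rule tcoords_A_E)
    then show "V t \<in> A" by (simp add: V_def)
    show "base (V t) = \<gamma> t" unfolding V_def using ce t by simp
  qed
  have Va: "V a = v" unfolding V_def y(1) using tvec_of_comps[OF A_tangent[OF v(1)]] v(2) c by simp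
  have B: "blinfun_apply (Blinfun (Gam c v ?u)) = Gam c v ?u"
    by (rule bounded_linear_Blinfun_apply) (rule linear_conv_bounded_linear[THEN iffD1, OF Gam_linear])
  define f where "f = (\<lambda>t. form_of r c (\<gamma> t) (T (V t)))"
  have f: "multilinear ?n (f t)" if t: "t \<in> {a..e}" for t
  proof -
    have "T (V t) \<in> tensors r s \<Phi> (base (V t))"
      using T V(1)[OF t] unfolding aniso_tensors_def by blast
    then have "T (V t) \<in> tensors r s \<Phi> (\<gamma> t)" by (simp add: V(2)[OF t])
    then show ?thesis unfolding f_def using ce t by (intro multilinear_form_of) blast+
  qed
  (* What the transport does in slot l: the transpose of the inverse for covectors. *)
  define h where "h = (\<lambda>t l. if l < r then (\<lambda>\<eta>. \<chi> j. \<eta> \<bullet> blinfun_apply (N t) (axis j 1)) else blinfun_apply (M t))"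
  have h_linear: "linear (h t l)" for t l
    by (rule linearI) (simp_all add: h_def vec_eq_iff inner_add_left blinfun.bilinear_simps)
  have transposed: "(\<chi> j. \<eta> \<bullet> blinfun_apply (N t) (axis j 1)) \<bullet> w = \<eta> \<bullet> blinfun_apply (N t) w" for \<eta> w t
  proof -
    have "linear (\<lambda>w. \<eta> \<bullet> blinfun_apply (N t) w)"
      by (rule linearI) (simp_all add: blinfun.bilinear_simps inner_add_right)
    from linear_eq_sum_axis[OF this, of w] show ?thesis
      by (simp add: inner_vec_def[of "\<chi> j. _ j"] mult.commute)
  qed
  (* In finite dimensions the left inverse is also a right inverse. *)
  have MN: "blinfun_apply (M t) (blinfun_apply (N t) w) = w" if t: "t \<in> {a..e}" for t w
  proof -
    have lin: "linear (blinfun_apply (M t))" by (rule bounded_linear.linear[OF blinfun.bounded_linear_right])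
    have "inj (blinfun_apply (M t))" using NM t by (intro inj_on_inverseI[of _ "blinfun_apply (N t)"]) blast
    then have "surj (blinfun_apply (M t))" by (rule linear_injective_imp_surjective[OF lin _ refl])
    then obtain w' where "w = blinfun_apply (M t) w'" by (rule surjE)
    then show ?thesis using NM t by simp
  qed
  have covec: "covec_transport \<Phi> A nabla a b \<gamma> t v (covec_of c ?p \<eta>) =
      covec_of c (\<gamma> t) (\<chi> j. \<eta> \<bullet> blinfun_apply (N t) (axis j 1))" if t: "t \<in> {a..e}" for t \<eta>
  proof
    fix w
    have ct: "c \<in> charts_at \<Phi> (\<gamma> t)" using ce t by blast
    let ?L = "lin_transport \<Phi> A nabla a b \<gamma> t v"
    have L: "?L w = tvec_of c (\<gamma> t) (blinfun_apply (M t) (comps w c))" if "w \<in> tangent_space \<Phi> ?p" for w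
      using bspec[OF lt t, rule_format, of "comps w c"] tvec_of_comps[OF that c] by simp
    have inj: "inj_on ?L (tangent_space \<Phi> ?p)"
    proof (rule inj_onI)
      fix w w' assume w: "w \<in> tangent_space \<Phi> ?p" "w' \<in> tangent_space \<Phi> ?p" and eq: "?L w = ?L w'"
      from arg_cong[OF eq, of "\<lambda>z. comps z c"]
      have "blinfun_apply (M t) (comps w c) = blinfun_apply (M t) (comps w' c)"
        unfolding L[OF w(1)] L[OF w(2)] using ct by simp
      then have "comps w c = comps w' c" using bspec[OF NM t] by metis
      then show "w = w'" by (rule tangent_space_eqI[OF w c])
    qed
    show "covec_transport \<Phi> A nabla a b \<gamma> t v (covec_of c ?p \<eta>) w =
        covec_of c (\<gamma> t) (\<chi> j. \<eta> \<bullet> blinfun_apply (N t) (axis j 1)) w"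
    proof (cases "w \<in> tangent_space \<Phi> (\<gamma> t)")
      case True
      have "inv_into (tangent_space \<Phi> ?p) ?L w = tvec_of c ?p (blinfun_apply (N t) (comps w c))"
      proof (rule inv_into_f_eq[OF inj])
        show "tvec_of c ?p (blinfun_apply (N t) (comps w c)) \<in> tangent_space \<Phi> ?p" using c by simp
        show "?L (tvec_of c ?p (blinfun_apply (N t) (comps w c))) = w"
          using bspec[OF lt t] MN[OF t] tvec_of_comps[OF True ct] by simp
      qed
      then show ?thesis using True c by (simp add: covec_transport_def covec_of_def transposed)
    qed (simp add: covec_transport_def covec_of_def)
  qed
  have F: "F t zs = f t (map (\<lambda>l. h t l (zs ! l)) [0..<?n])" if t: "t \<in> {a..e}" and zs: "length zs = ?n" for t zs
  proof -
    have "take r (map (\<lambda>l. h t l (zs ! l)) [0..<?n]) = map (\<lambda>\<eta>. \<chi> j. \<eta> \<bullet> blinfun_apply (N t) (axis j 1)) (take r zs)"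
      "drop r (map (\<lambda>l. h t l (zs ! l)) [0..<?n]) = map (blinfun_apply (M t)) (drop r zs)"
      using zs by (auto intro!: nth_equalityI simp: h_def)
    then show ?thesis
      unfolding F_def f_def form_of_def tensor_transport_back_def
      using bspec[OF tr t] bspec[OF lt t] covec[OF t] by (simp add: V_def o_def)
  qed
  show thesis
  proof (rule that[OF e])
    show "\<forall>t\<in>{a..e}. multilinear ?n (F t)"
    proof
      fix t assume t: "t \<in> {a..e}"
      have "multilinear ?n (\<lambda>zs. f t (map (\<lambda>l. h t l (zs ! l)) [0..<?n]))"
        by (rule multilinear_compose[OF f[OF t] h_linear])
      then show "multilinear ?n (F t)"
        unfolding multilinear_def using F[OF t] by simp
    qed
    show "\<forall>as bs. length as = r \<longrightarrow> length bs = s \<longrightarrow> ((\<lambda>t. F t (axes (as @ bs))) has_real_derivative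
      (\<Sum>k\<in>UNIV. (?u $ k) * cov_deriv_comp \<Phi> nabla c T v k as bs)) (at a within {a..b})"
    proof (intro allI impI)
      fix as bs :: "'n list" assume len: "length as = r" "length bs = s"
      let ?js = "as @ bs"
      define Tc where "Tc = (\<lambda>as bs z. tensor_comp \<Phi> c (cinv c (fst z)) (T (of_tcoords \<Phi> c z)) as bs)"
      let ?z = "\<lambda>t. (?x t, y t)"
      let ?DT = "\<lambda>as bs. frechet_derivative (Tc as bs) (at (tcoords c v)) (?u, - Gam c v ?u (comps v c))"
      have za: "?z a = tcoords c v" by (simp add: y(1) tcoords_def v(2))
      have zO: "?z a \<in> ?O" using y(2) a by blast
      have Tc_smooth: "smooth_on ?O (Tc as bs)" if "length as = r" "length bs = s" for as bs
        using T cPhi that unfolding aniso_tensors_def Tc_def by blast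
      have fTc: "f t (axes (as @ bs)) = Tc as bs (?z t)" if "t \<in> {a..e}" "length as = r" for t as bs
      proof -
        have "\<gamma> t \<in> cdom c" using ce that(1) by (auto simp: charts_at_def)
        then show ?thesis
          using cPhi tensor_comp_form_of[OF that(2), of c "\<gamma> t" "T (V t)" bs] by (simp add: f_def Tc_def V_def)
      qed
      have z': "(?z has_vector_derivative (?u, - Gam c v ?u (comps v c))) (at a within {a..e})"
        unfolding inside[symmetric] using ab
        by (intro has_vector_derivative_Pair curve_has_vector_derivative c y(3)) simp
      have C: "((\<lambda>t. f t (axes js)) has_real_derivative
          ?DT (take r js) (drop r js)) (at a within {a..e})"
        if js: "length js = ?n" for js
      proof -
        have l: "length (take r js) = r" "length (drop r js) = s" using js by simp_all
        have "((Tc (take r js) (drop r js) \<circ> ?z) has_vector_derivative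
            frechet_derivative (Tc (take r js) (drop r js)) (at (?z a)) (?u, - Gam c v ?u (comps v c))) (at a within {a..e})"
          by (rule vector_derivative_diff_chain_within[OF z'])
            (rule has_derivative_at_withinI[OF smooth_on_has_derivative[OF open_tcoords_A[OF cPhi] Tc_smooth[OF l] zO]])
        then have "((Tc (take r js) (drop r js) \<circ> ?z) has_real_derivative
            ?DT (take r js) (drop r js)) (at a within {a..e})"
          by (simp only: has_real_derivative_iff_has_vector_derivative za)
        then show ?thesis
        proof (rule has_field_derivative_transform_within[OF _ zero_less_one a])
          show "(Tc (take r js) (drop r js) \<circ> ?z) t = f t (axes js)" if "t \<in> {a..e}" for t
            using fTc[OF that l(1), of "drop r js"] by simp
        qed
      qed
      (* The argument in slot l at time t, and its derivative at time a. *)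
      define q where "q = (\<lambda>l t. h t l (axes ?js ! l))"
      define q' where "q' = (\<lambda>l. if l < r then (\<chi> j. axis (?js ! l) 1 \<bullet> Gam c v ?u (axis j 1))
        else - Gam c v ?u (axis (?js ! l) 1))"
      have al: "axes ?js ! l = axis (?js ! l) 1" if "l < ?n" for l
        using that len by (simp del: map_append)
      have q: "(q l has_vector_derivative q' l) (at a within {a..e})" if l: "l < ?n" for l
      proof (cases "l < r")
        case True
        have "((\<lambda>t. \<Sum>j\<in>UNIV. (axis (?js ! l) 1 \<bullet> blinfun_apply (N t) (axis j 1)) *\<^sub>R axis j (1::real)) has_vector_derivative
            (\<Sum>j\<in>UNIV. (axis (?js ! l) 1 \<bullet> blinfun_apply (Blinfun (Gam c v ?u)) (axis j 1)) *\<^sub>R axis j 1)) (at a within {a..e})"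
          unfolding inside[symmetric]
          by (intro has_vector_derivative_sum bounded_linear.has_vector_derivative[OF bounded_linear_scaleR_left]
              bounded_linear.has_vector_derivative[OF bounded_linear_inner_right]
              bounded_linear.has_vector_derivative[OF blinfun.bounded_linear_left N'])
        moreover have "(\<Sum>j\<in>UNIV. g j *\<^sub>R axis j (1::real)) = (\<chi> j. g j)" for g :: "'n \<Rightarrow> real"
          using vec_eq_sum_axis[of "\<chi> j. g j"] by simp
        ultimately show ?thesis using True by (simp add: q_def q'_def h_def B al[OF l] del: map_append)
      next
        case False
        have "((\<lambda>t. blinfun_apply (M t) (axis (?js ! l) 1)) has_vector_derivative
            blinfun_apply (- Blinfun (Gam c v ?u)) (axis (?js ! l) 1)) (at a within {a..e})"
          unfolding inside[symmetric]
          by (rule bounded_linear.has_vector_derivative[OF blinfun.bounded_linear_left M'])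
        then show ?thesis using False by (simp add: q_def q'_def h_def B blinfun.bilinear_simps al[OF l] del: map_append)
      qed
      have qa: "q l a = axes ?js ! l" if "l < ?n" for l
        using that len by (simp add: q_def h_def Na Ma inner_axis vec_eq_iff)
      have qlist: "map (\<lambda>l. q l a) [0..<?n] = axes ?js"
        using qa len by (intro nth_equalityI) simp_all
      have "((\<lambda>t. f t (map (\<lambda>l. q l t) [0..<?n])) has_real_derivative
          (\<Sum>js | length js = ?n. (\<Prod>l<?n. q l a $ js ! l) * ?DT (take r js) (drop r js))
          + (\<Sum>l<?n. f a ((map (\<lambda>l. q l a) [0..<?n])[l := q' l]))) (at a within {a..e})"
        by (rule has_derivative_multilinear[where f = f and p = q and p' = q', OF _ a C q]) (use f in auto)
      also have "(\<Sum>js | length js = ?n. (\<Prod>l<?n. q l a $ js ! l) * ?DT (take r js) (drop r js))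
          = ?DT as bs"
      proof -
        have "(\<Prod>l<?n. q l a $ js ! l) = (if js = ?js then 1 else 0)" if "length js = ?n" for js
          using prod_axes[of ?js ?n js] that len qa by simp
        then have "(\<Sum>js | length js = ?n. (\<Prod>l<?n. q l a $ js ! l) * ?DT (take r js) (drop r js))
          = (\<Sum>js | length js = ?n. if js = ?js then ?DT as bs else 0)"
          using len by (intro sum.cong) auto
        then show ?thesis using len by (simp add: finite_lists_of_length)
      qed
      also have "(\<Sum>l<?n. f a ((map (\<lambda>l. q l a) [0..<?n])[l := q' l])) =
          (\<Sum>l<r. \<Sum>j\<in>UNIV. Gam c v ?u (axis j 1) $ (as ! l) * Tc (as[l := j]) bs (tcoords c v))
          + (\<Sum>l<s. \<Sum>j\<in>UNIV. (- Gam c v ?u (axis (bs ! l) 1)) $ j * Tc as (bs[l := j]) (tcoords c v))"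
      proof -
        have slot: "f a ((axes ?js)[l := w]) = (\<Sum>j\<in>UNIV. w $ j * f a (axes (?js[l := j])))" if "l < ?n" for l w
          using linear_eq_sum_axis[OF multilinearD[OF f[OF a] _ that, of "axes ?js"], of w] len
          by (simp add: map_update)
        have "f a ((axes ?js)[l := q' l]) = (\<Sum>j\<in>UNIV. Gam c v ?u (axis j 1) $ (as ! l) * Tc (as[l := j]) bs (tcoords c v))"
          if l: "l < r" for l
        proof -
          have "?js[l := j] = as[l := j] @ bs" for j using l len by (simp add: list_update_append)
          then have "f a (axes (?js[l := j])) = Tc (as[l := j]) bs (tcoords c v)" for j
            using fTc[OF a, of "as[l := j]" bs] len za by simp
          then show ?thesis
            using l len slot[of l "q' l"] by (simp add: q'_def nth_append inner_axis')
        qed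
        moreover have "f a ((axes ?js)[r + l := q' (r + l)]) =
            (\<Sum>j\<in>UNIV. (- Gam c v ?u (axis (bs ! l) 1)) $ j * Tc as (bs[l := j]) (tcoords c v))"
          if l: "l < s" for l
        proof -
          have "?js[r + l := j] = as @ bs[l := j]" for j using l len by (simp add: list_update_append)
          then have "f a (axes (?js[r + l := j])) = Tc as (bs[l := j]) (tcoords c v)" for j
            using fTc[OF a, of as "bs[l := j]"] len za by simp
          then show ?thesis
            using l len slot[of "r + l" "q' (r + l)"] by (simp add: q'_def nth_append)
        qed
        moreover have "(\<Sum>l<r + s. g l) = (\<Sum>l<r. g l) + (\<Sum>l<s. g (r + l))" for g :: "nat \<Rightarrow> real"
          by (induction s) (simp_all add: add.assoc)
        ultimately show ?thesis by (simp only: qlist) simp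
      qed
      also have "?DT as bs +
          ((\<Sum>l<r. \<Sum>j\<in>UNIV. Gam c v ?u (axis j 1) $ (as ! l) * Tc (as[l := j]) bs (tcoords c v))
          + (\<Sum>l<s. \<Sum>j\<in>UNIV. (- Gam c v ?u (axis (bs ! l) 1)) $ j * Tc as (bs[l := j]) (tcoords c v))) =
          (\<Sum>k\<in>UNIV. (?u $ k) * cov_deriv_comp \<Phi> nabla c T v k as bs)"
      proof -
        have "Tc as bs differentiable (at (tcoords c v))"
          using smooth_on_differentiable[OF open_tcoords_A[OF cPhi] Tc_smooth[OF len] zO] za by simp
        then show ?thesis
          using cov_deriv_comp_direction[of c T as bs v ?u] len unfolding Tc_def by simp
      qed
      finally have "((\<lambda>t. f t (map (\<lambda>l. q l t) [0..<?n])) has_real_derivative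
          (\<Sum>k\<in>UNIV. (?u $ k) * cov_deriv_comp \<Phi> nabla c T v k as bs)) (at a within {a..e})" .
      then have "((\<lambda>t. F t (axes ?js)) has_real_derivative
          (\<Sum>k\<in>UNIV. (?u $ k) * cov_deriv_comp \<Phi> nabla c T v k as bs)) (at a within {a..e})"
      proof (rule has_field_derivative_transform_within[OF _ zero_less_one a])
        show "f t (map (\<lambda>l. q l t) [0..<?n]) = F t (axes ?js)" if "t \<in> {a..e}" for t
          using F[OF that, of "axes ?js"] len by (simp add: q_def)
      qed
      then show "((\<lambda>t. F t (axes (as @ bs))) has_real_derivative
          (\<Sum>k\<in>UNIV. (?u $ k) * cov_deriv_comp \<Phi> nabla c T v k as bs)) (at a within {a..b})"
        unfolding inside .
    qed
  qed
qed

lemma has_real_derivative_unique_at_start: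
  assumes "(g has_real_derivative D) (at a within {a..b})" "(g has_real_derivative D') (at a within {a..b})"
  shows "D = D'"
  using vector_derivative_within_closed_interval[OF ab, of a g D]
    vector_derivative_within_closed_interval[OF ab, of a g D'] assms ab
  by (simp add: has_real_derivative_iff_has_vector_derivative)

text \<open>The derivative of the transported tensor exists and is a tensor defined without a chart, while
  its components in every chart are those that define the covariant derivative. So the latter
  exists, and no transformation law of its components has to be checked.\<close>

lemma transport_back_has_cov_deriv:
  assumes v: "v \<in> A" "base v = \<gamma> a" and T: "T \<in> aniso_tensors r s \<Phi> A"
  shows "has_tensor_derivative r s \<Phi> (\<gamma> a) (\<lambda>t. tensor_transport_back \<Phi> A nabla a b \<gamma> T v t)
    (cov_deriv r s \<Phi> nabla (velocity \<Phi> {a..b} \<gamma> a) T v) (at a within {a..b})"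
proof -
  let ?p = "\<gamma> a" and ?n = "r + s" and ?TB = "\<lambda>t. tensor_transport_back \<Phi> A nabla a b \<gamma> T v t"
  obtain c where c: "c \<in> charts_at \<Phi> ?p" by (rule chart_around)
  obtain e where e: "a < e" "e \<le> b" "\<forall>t\<in>{a..e}. multilinear ?n (form_of r c ?p (?TB t))"
    "\<forall>as bs. length as = r \<longrightarrow> length bs = s \<longrightarrow> ((\<lambda>t. form_of r c ?p (?TB t) (axes (as @ bs))) has_real_derivative
      (\<Sum>k\<in>UNIV. (vel c a $ k) * cov_deriv_comp \<Phi> nabla c T v k as bs)) (at a within {a..b})"
    by (rule transport_back_derivative[OF v c T])
  (* The derivative of the form at coordinate vectors in one chart, extended multilinearly. *)
  define C where "C = (\<lambda>js. \<Sum>k\<in>UNIV. (vel c a $ k) * cov_deriv_comp \<Phi> nabla c T v k (take r js) (drop r js))"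
  define D where "D = (\<lambda>zs :: (real^'n) list. \<Sum>js | length js = ?n. (\<Prod>l<?n. zs ! l $ js ! l) * C js)"
  define S where "S = tensor_of r s c ?p D"
  have inside: "at a within {a..b} = at a within {a..e}"
    using e ab by (simp add: at_within_Icc_at_right)
  have a: "a \<in> {a..e}" using e by simp
  have C: "((\<lambda>t. form_of r c ?p (?TB t) (axes js)) has_real_derivative C js) (at a within {a..b})"
    if "length js = ?n" for js
    using e(4)[rule_format, of "take r js" "drop r js"] that by (simp add: C_def)
  have D: "((\<lambda>t. form_of r c ?p (?TB t) zs) has_real_derivative D zs) (at a within {a..b})"
    if zs: "length zs = ?n" for zs
  proof -
    have "((\<lambda>t. \<Sum>js | length js = ?n. (\<Prod>l<?n. zs ! l $ js ! l) * form_of r c ?p (?TB t) (axes js))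
        has_real_derivative D zs) (at a within {a..b})"
      unfolding D_def
    proof (rule DERIV_sum)
      fix js :: "'n list" assume "js \<in> {js. length js = ?n}"
      then show "((\<lambda>t. (\<Prod>l<?n. zs ! l $ js ! l) * form_of r c ?p (?TB t) (axes js)) has_real_derivative
          (\<Prod>l<?n. zs ! l $ js ! l) * C js) (at a within {a..b})"
        by (intro DERIV_cmult C) simp
    qed
    then show ?thesis
      unfolding inside
    proof (rule has_field_derivative_transform_within[OF _ zero_less_one a])
      fix t assume "t \<in> {a..e}"
      from multilinear_expand[OF bspec[OF e(3) this] zs]
      show "(\<Sum>js | length js = ?n. (\<Prod>l<?n. zs ! l $ js ! l) * form_of r c ?p (?TB t) (axes js)) =
          form_of r c ?p (?TB t) zs" ..
    qed
  qed
  have S_in: "S \<in> tensors r s \<Phi> ?p"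
    unfolding S_def D_def by (rule tensor_of_in_tensors[OF multilinear_of_coefficients c])
  have S_deriv: "((\<lambda>t. ?TB t \<theta>s vs) has_real_derivative S \<theta>s vs) (at a within {a..b})"
    if args: "(\<theta>s, vs) \<in> tensor_args r s \<Phi> ?p" for \<theta>s vs
  proof -
    have "length (arg_coords c ?p \<theta>s vs) = ?n"
      using tensor_argsD[OF args] by (simp add: arg_coords_def)
    from D[OF this] show ?thesis
      unfolding form_of_coords[OF args c] by (simp add: S_def tensor_of_def args)
  qed
  (* S was built with the chart c, but as the derivative of the transported tensor it has the right
     components in every other chart d too. *)
  have S_comp: "tensor_comp \<Phi> d ?p S as bs = (\<Sum>k\<in>UNIV. (vel d a $ k) * cov_deriv_comp \<Phi> nabla d T v k as bs)"
    if d: "d \<in> charts_at \<Phi> ?p" and len: "length as = r" "length bs = s" for d as bs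
  proof -
    obtain e' where "a < e'" "e' \<le> b" "\<forall>t\<in>{a..e'}. multilinear ?n (form_of r d ?p (?TB t))"
      and 1: "\<forall>as bs. length as = r \<longrightarrow> length bs = s \<longrightarrow> ((\<lambda>t. form_of r d ?p (?TB t) (axes (as @ bs))) has_real_derivative
        (\<Sum>k\<in>UNIV. (vel d a $ k) * cov_deriv_comp \<Phi> nabla d T v k as bs)) (at a within {a..b})"
      by (rule transport_back_derivative[OF v d T])
    have "length (axes (as @ bs)) = ?n" using len by simp
    from S_deriv[OF arg_coords_of(2)[OF d this]]
    have "((\<lambda>t. form_of r d ?p (?TB t) (axes (as @ bs))) has_real_derivative form_of r d ?p S (axes (as @ bs))) (at a within {a..b})"
      unfolding form_of_def .
    then show ?thesis
      unfolding tensor_comp_form_of[OF len(1)]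
      using 1[rule_format, OF len] by (rule has_real_derivative_unique_at_start)
  qed
  have "cov_deriv r s \<Phi> nabla (velocity \<Phi> {a..b} \<gamma> a) T v = S"
    unfolding cov_deriv_def v(2)
  proof (rule the_equality)
    show "S \<in> tensors r s \<Phi> ?p \<and> (\<forall>c\<in>charts_at \<Phi> ?p. \<forall>as bs. length as = r \<longrightarrow> length bs = s \<longrightarrow>
        tensor_comp \<Phi> c ?p S as bs = (\<Sum>k\<in>UNIV. (vel c a $ k) * cov_deriv_comp \<Phi> nabla c T v k as bs))"
      using S_in S_comp by blast
    fix S' assume S': "S' \<in> tensors r s \<Phi> ?p \<and> (\<forall>c\<in>charts_at \<Phi> ?p. \<forall>as bs. length as = r \<longrightarrow> length bs = s \<longrightarrow>
        tensor_comp \<Phi> c ?p S' as bs = (\<Sum>k\<in>UNIV. (vel c a $ k) * cov_deriv_comp \<Phi> nabla c T v k as bs))"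
    show "S' = S"
    proof (rule tensor_eqI[OF _ S_in c])
      show "S' \<in> tensors r s \<Phi> ?p" using S' by blast
      fix as bs :: "'n list" assume "length as = r" "length bs = s"
      then show "tensor_comp \<Phi> c ?p S' as bs = tensor_comp \<Phi> c ?p S as bs"
        using bspec[OF conjunct2[OF S'] c, rule_format, of as bs] S_comp[OF c, of as bs] by simp
    qed
  qed
  then show ?thesis
    unfolding has_tensor_derivative_def using S_deriv by auto
qed

end

theorem proposition5:
  fixes \<Phi> :: "('m::{t2_space, second_countable_topology}, 'n::finite) chart set"
    and A :: "('m, 'n) tvec set"
    and nabla :: "('m, 'n) conn"
    and r s :: nat
    and T :: "('m, 'n) tvec \<Rightarrow> ('m, 'n) tensor"
    and \<gamma> :: "real \<Rightarrow> 'm"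
    and a b :: real
    and v :: "('m, 'n) tvec"
  assumes "smooth_manifold \<Phi>"
    and "conic_domain \<Phi> A"
    and "aniso_connection \<Phi> A nabla"
    and "T \<in> aniso_tensors r s \<Phi> A"
    and "a < b"
    and "smooth_curve \<Phi> {a..b} \<gamma>"
    and "regular_curve \<Phi> {a..b} \<gamma>"
    and "v \<in> tangent_space \<Phi> (\<gamma> a) \<inter> A"
  shows "has_tensor_derivative r s \<Phi> (\<gamma> a)
           (\<lambda>t. tensor_transport_back \<Phi> A nabla a b \<gamma> T v t)
           (cov_deriv r s \<Phi> nabla (velocity \<Phi> {a..b} \<gamma> a) T v)
           (at a within {a..b})"
proof -
  interpret aniso_curve \<Phi> A nabla a b \<gamma>
    by unfold_locales (fact assms)+
  show ?thesis
    using assms(8) base_tangent_space[of v "\<gamma> a"] by (intro transport_back_has_cov_deriv assms(4)) auto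
qed

end
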